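(* Let $P(z^2)=\sum_{k=0}^{n} a_k z^{2k}$ be any polynomial with non-negative integer coefficients $a_k$. Then there exists a Legendrian link $\Lambda$ in $\mathbb{R}^3_{std}$ (equipped with a Maslov potential on a front) whose graded ruling polynomial satisfies $R_{\Lambda}(z)=P(z^2)$.
   Context: $\mathbb{R}^3_{std}$ is $\mathbb{R}^3$ with coordinates $(x,y,z)$ and contact structure $\ker(dz-y\,dx)$. A Legendrian link is a smooth link everywhere tangent to the contact structure; links may be disconnected and split. Its front $D$ is its image under the projection $(x,y,z)\mapsto(x,z)$. Maslov potential: for a Legendrian link whose components all have rotation number zero, with fixed front $D$, a Maslov potential is a locally constant function $\mu: D\setminus\{\text{cusps}\}\to\mathbb{Z}$ (defined along the strands of $D$) that increases by one when passing upwards through a cusp and decreases by one when passing downwards through a cusp. A front with a Maslov potential is a graded front. At a crossing $c$ with upper strand $c_u$ (the strand of smaller slope) and lower strand $c_l$, the degree is $|c|=\mu(c_u)-\mu(c_l)$. For links, the Maslov potential is part of the data. Normal rulings: an ungraded normal ruling $\rho$ of a front $D$ is a decomposition of $D$ into pairs of paths (ruling paths), where the two paths of a pair begin at the same left cusp, end at the same right cusp, and co-bound a topological disk (a ruling disk). Ruling paths are smooth except at cusps and at certain crossings called switches. Moreover (1) any two ruling paths intersect only at crossings or cusps; (2) near a switch, the two ruling paths meeting there both turn the corner (one lies above the other) and the two ruling disks involved satisfy the usual normality condition: on vertical lines near the switch, the intervals cut out by the two disks are either disjoint or nested. A graded normal ruling is a normal ruling of a graded front all of whose switches are crossings of degree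 $0$. Graded ruling polynomial: $R_{\Lambda}(z)=z^{|\pi_0(\Lambda)|}\sum_{\rho}z^{-\chi(\rho)}$, the sum over graded normal rulings $\rho$ of $D$, where $|\pi_0(\Lambda)|$ is the number of components of $\Lambda$ and $\chi(\rho)=d(\rho)-s(\rho)$ with $d(\rho)$ the number of ruling disks and $s(\rho)$ the number of switches. It is invariant under Legendrian isotopy (with Maslov potential). *)

theory Defs
  imports "HOL-Analysis.Analysis" "HOL-Computational_Algebra.Formal_Laurent_Series"
begin

text \<open>
  \<open>\<real>\<^sup>3\<close> is \<^typ>\<open>real \<times> real \<times> real\<close> with coordinates \<open>(x, y, z)\<close>, and the contact structure is
  \<open>ker (dz - y dx)\<close>.
\<close>

definition xc :: "real \<times> real \<times> real \<Rightarrow> real" where "xc p = fst p"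
definition yc :: "real \<times> real \<times> real \<Rightarrow> real" where "yc p = fst (snd p)"
definition zc :: "real \<times> real \<times> real \<Rightarrow> real" where "zc p = snd (snd p)"

definition front_proj :: "real \<times> real \<times> real \<Rightarrow> real \<times> real" where
  "front_proj p = (xc p, zc p)"

definition smooth_curve :: "(real \<Rightarrow> 'a::real_normed_vector) \<Rightarrow> bool" where
  "smooth_curve c \<longleftrightarrow>
     (\<exists>D :: nat \<Rightarrow> real \<Rightarrow> 'a. D 0 = c \<and>
        (\<forall>n t. (D n has_vector_derivative D (Suc n) t) (at t)))"

text \<open>A smoothly embedded circle \<open>\<real>/\<int> \<rightarrow> \<real>\<^sup>3\<close> that is tangent to the contact structure.\<close>

definition legendrian_knot :: "(real \<Rightarrow> real \<times> real \<times> real) \<Rightarrow> bool" where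
  "legendrian_knot c \<longleftrightarrow>
     smooth_curve c \<and>
     (\<forall>t. c (t + 1) = c t) \<and>
     inj_on c {0..<1} \<and>
     (\<forall>t. vector_derivative c (at t) \<noteq> 0) \<and>
     (\<forall>t. deriv (zc \<circ> c) t = yc (c t) * deriv (xc \<circ> c) t)"

text \<open>
  A link is given by a nonempty list of parametrised knots with pairwise disjoint images. All
  notions below depend only on its image.
\<close>

type_synonym link = "(real \<Rightarrow> real \<times> real \<times> real) list"

definition link_set :: "link \<Rightarrow> (real \<times> real \<times> real) set" where
  "link_set L = (\<Union>c\<in>set L. range c)"

definition legendrian_link :: "link \<Rightarrow> bool" where
  "legendrian_link L \<longleftrightarrow>
     L \<noteq> [] \<and>
     (\<forall>c\<in>set L. legendrian_knot c) \<and>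
     (\<forall>i<length L. \<forall>j<length L. i \<noteq> j \<longrightarrow> range (L ! i) \<inter> range (L ! j) = {})"

definition front :: "link \<Rightarrow> (real \<times> real) set" where
  "front L = front_proj ` link_set L"

text \<open>
  Cusps are the singular points of the front projection of the link, i.e. the points at which
  \<open>dx\<close> (and hence \<open>dz\<close>) vanishes on the link. They are recorded as points of the link in
  \<open>\<real>\<^sup>3\<close>. A left (right) cusp is a nondegenerate minimum (maximum) of \<open>x\<close>.
\<close>

definition cusps :: "link \<Rightarrow> (real \<times> real \<times> real) set" where
  "cusps L = {c t | c t. c \<in> set L \<and> deriv (xc \<circ> c) t = 0}"

definition left_cusps :: "link \<Rightarrow> (real \<times> real \<times> real) set" where
  "left_cusps L =
     {c t | c t. c \<in> set L \<and> deriv (xc \<circ> c) t = 0 \<and> deriv (deriv (xc \<circ> c)) t > 0}"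

definition right_cusps :: "link \<Rightarrow> (real \<times> real \<times> real) set" where
  "right_cusps L =
     {c t | c t. c \<in> set L \<and> deriv (xc \<circ> c) t = 0 \<and> deriv (deriv (xc \<circ> c)) t < 0}"

text \<open>
  The link points over a front point \<open>d\<close> are \<open>(fst d, y, snd d)\<close>, where \<open>y\<close> is the slope
  \<open>dz/dx\<close> of the strand of the front through \<open>d\<close> that the link point belongs to.
\<close>

definition slopes :: "link \<Rightarrow> real \<times> real \<Rightarrow> real set" where
  "slopes L d = {y. (fst d, y, snd d) \<in> link_set L}"

definition crossings :: "link \<Rightarrow> (real \<times> real) set" where
  "crossings L = {d. card (slopes L d) = 2}"

text \<open>
  Fronts are generic: the only singularities are semicubical cusps and double points of two
  immersed strands (transverse, since the two slopes differ). Crossings have pairwise different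
  \<open>x\<close>-coordinates; without this the normality condition below, which looks at the vertical
  lines near one switch, could be disturbed by another crossing on the same vertical line.
\<close>

definition generic_front :: "link \<Rightarrow> bool" where
  "generic_front L \<longleftrightarrow>
     cusps L = left_cusps L \<union> right_cusps L \<and>
     (\<forall>d. finite (slopes L d) \<and> card (slopes L d) \<le> 2) \<and>
     (\<forall>p\<in>cusps L. front_proj p \<notin> crossings L) \<and>
     inj_on fst (crossings L)"

text \<open>
  A potential on the strands of the front is a function on the link in \<open>\<real>\<^sup>3\<close>, where the two
  strands at a crossing are separated; its values at cusps and off the link are irrelevant.
  Near a cusp, two different points of the link with the same \<open>x\<close>-coordinate lie on the two
  branches of the cusp.
\<close>

definition maslov_potential :: "link \<Rightarrow> (real \<times> real \<times> real \<Rightarrow> int) \<Rightarrow> bool" where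
  "maslov_potential L \<mu> \<longleftrightarrow>
     (\<forall>p\<in>link_set L - cusps L. \<forall>\<^sub>F q in at p within (link_set L - cusps L). \<mu> q = \<mu> p) \<and>
     (\<forall>k\<in>cusps L. \<exists>U. open U \<and> k \<in> U \<and>
        (\<forall>p\<in>link_set L \<inter> U. \<forall>q\<in>link_set L \<inter> U.
           xc p = xc q \<and> zc p < zc q \<longrightarrow> \<mu> q = \<mu> p + 1))"

text \<open>The upper strand at a crossing is the one of smaller slope.\<close>

definition crossing_degree ::
    "link \<Rightarrow> (real \<times> real \<times> real \<Rightarrow> int) \<Rightarrow> real \<times> real \<Rightarrow> int" where
  "crossing_degree L \<mu> d =
     \<mu> (fst d, Min (slopes L d), snd d) - \<mu> (fst d, Max (slopes L d), snd d)"

text \<open>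
  A ruling path is a subset of the plane, and a ruling disk is given by its pair
  (upper path, lower path).
\<close>

type_synonym disk = "(real \<times> real) set \<times> (real \<times> real) set"

definition boundary :: "disk \<Rightarrow> (real \<times> real) set" where
  "boundary R = fst R \<union> snd R"

definition ruling_disk :: "link \<Rightarrow> disk \<Rightarrow> bool" where
  "ruling_disk L R \<longleftrightarrow>
     (\<exists>a b f g. a < b \<and> continuous_on {a..b} f \<and> continuous_on {a..b} g \<and>
        fst R = (\<lambda>x. (x, f x)) ` {a..b} \<and>
        snd R = (\<lambda>x. (x, g x)) ` {a..b} \<and>
        boundary R \<subseteq> front L \<and>
        f a = g a \<and> (a, f a) \<in> front_proj ` left_cusps L \<and>
        f b = g b \<and> (b, f b) \<in> front_proj ` right_cusps L \<and>
        (\<forall>x. a < x \<and> x < b \<longrightarrow> g x < f x))"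

text \<open>The interval that a disk cuts out of the vertical line at \<open>x\<close>.\<close>

definition slice :: "disk \<Rightarrow> real \<Rightarrow> real set" where
  "slice R x = {z. \<exists>u l. (x, u) \<in> fst R \<and> (x, l) \<in> snd R \<and> l \<le> z \<and> z \<le> u}"

text \<open>
  A path through a crossing either follows one of the two strands, or it turns a corner there,
  in which case its one-sided slopes at the crossing differ. In the latter case the other path
  through the crossing turns a corner as well. Elsewhere in their interior, ruling paths are
  automatically smooth.
\<close>

definition path_smooth_at :: "(real \<times> real) set \<Rightarrow> real \<times> real \<Rightarrow> bool" where
  "path_smooth_at P d \<longleftrightarrow>
     (\<exists>f :: real \<Rightarrow> real. f differentiable (at (fst d)) \<and>
        (\<forall>\<^sub>F x in nhds (fst d). (x, f x) \<in> P))"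

definition switches :: "link \<Rightarrow> disk set \<Rightarrow> (real \<times> real) set" where
  "switches L \<rho> =
     {d \<in> crossings L. \<exists>R\<in>\<rho>. \<exists>P\<in>{fst R, snd R}. d \<in> P \<and> \<not> path_smooth_at P d}"

text \<open>
  The two paths of one disk meet only at their end points by definition of \<open>ruling_disk\<close>, so the
  intersection condition is only needed for paths of different disks. In the normality
  condition the vertical line through the switch itself is excluded, as both disks have the
  switch in their boundary.
\<close>

definition normal_ruling :: "link \<Rightarrow> disk set \<Rightarrow> bool" where
  "normal_ruling L \<rho> \<longleftrightarrow>
     (\<forall>R\<in>\<rho>. ruling_disk L R) \<and>
     (\<Union>R\<in>\<rho>. boundary R) = front L \<and>
     (\<forall>R\<in>\<rho>. \<forall>S\<in>\<rho>. R \<noteq> S \<longrightarrow>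
        boundary R \<inter> boundary S \<subseteq> crossings L \<union> front_proj ` cusps L) \<and>
     (\<forall>d\<in>switches L \<rho>. \<forall>R\<in>\<rho>. \<forall>S\<in>\<rho>. R \<noteq> S \<and> d \<in> boundary R \<and> d \<in> boundary S \<longrightarrow>
        (\<forall>\<^sub>F x in at (fst d).
           slice R x \<inter> slice S x = {} \<or> slice R x \<subseteq> slice S x \<or> slice S x \<subseteq> slice R x))"

definition graded_normal_ruling ::
    "link \<Rightarrow> (real \<times> real \<times> real \<Rightarrow> int) \<Rightarrow> disk set \<Rightarrow> bool" where
  "graded_normal_ruling L \<mu> \<rho> \<longleftrightarrow>
     normal_ruling L \<rho> \<and> (\<forall>d\<in>switches L \<rho>. crossing_degree L \<mu> d = 0)"

definition ruling_euler_char :: "link \<Rightarrow> disk set \<Rightarrow> int" where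
  "ruling_euler_char L \<rho> = int (card \<rho>) - int (card (switches L \<rho>))"

text \<open>
  The ruling polynomial is a priori a Laurent polynomial, so it is taken as an element of
  \<open>\<int>((z))\<close> with \<^term>\<open>fls_X\<close> as \<open>z\<close>. A generic front has finitely many crossings and hence
  finitely many normal rulings.
\<close>

definition ruling_polynomial :: "link \<Rightarrow> (real \<times> real \<times> real \<Rightarrow> int) \<Rightarrow> int fls" where
  "ruling_polynomial L \<mu> =
     fls_X ^ card (components (link_set L)) *
     (\<Sum>\<rho> | graded_normal_ruling L \<mu> \<rho>. fls_X_intpow (- ruling_euler_char L \<rho>))"

end

theory Submission
  imports Defs
begin

text \<open>
  Every polynomial in question is realised by a single Legendrian knot with a front in plat position:
  all left cusps lie on one vertical line, all right cusps on another, and the \<open>2d\<close> strands in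
  between are described by a word \<open>W\<close>, whose letter \<open>i\<close> stands for a crossing of the strands in
  the positions \<open>i\<close> and \<open>i + 1\<close>, counted from the top. The positions \<open>2q\<close> and \<open>2q + 1\<close> meet in a
  cusp at both ends. Strands starting in even positions have potential 1 (type U), the others have
  potential 0 (type L), so a crossing has degree 0 iff its strands have the same type.

  A ruling of such a front is determined by its set \<open>S\<close> of switches: the ruling paths follow the
  strands and turn a corner exactly at the crossings in \<open>S\<close>. Conversely, \<open>S\<close> gives a graded normal
  ruling iff two ruling paths of one disk never meet before the right cusps, switches join strands of
  the same type, the normality condition holds at every switch, and the paths of each disk end in a
  common cusp (\<open>graded_normal_rulings\<close>). Hence the ruling polynomial is \<open>z\<close> to the power \<open>1 - d\<close>
  times the sum of \<open>z ^ card S\<close> over these sets, and the sum can be computed by sweeping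
  the front from left to right and remembering only which positions are paired by a disk
  (\<open>ruling_sum\<close>, \<open>ruling_polynomial_knot\<close>).

  The word is a product of blocks, each working in a window of six positions. Four strands, of the
  types U, U, L, L, stay active; a block takes up one new pair of strands below them and releases one
  finished pair above them. Up to dead ends, the active strands are paired in one of two ways,
  called undecided (interleaved) and decided (nested), and the sweep starts undecided and must end
  decided. There are two blocks. On these two states the slip block acts by the matrix
  \<open>z * ((1, z), (0, 1))\<close>, so it may or may not slip from undecided to decided; the weight
  block acts by the diagonal matrix \<open>(z ^ 3, z)\<close>. Exactly one slip block of the word performs the change,
  and it contributes a power of \<open>z\<close> that exceeds a fixed one by twice the number of weight blocks to its
  left. Placing \<open>a k\<close> slip blocks between consecutive weight blocks therefore gives \<open>\<Sum>k\<le>n. a k * z ^ (2 * k)\<close>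
  times \<open>z\<close> to the number of blocks plus one, and this factor cancels against \<open>z\<close> to the power \<open>1 - d\<close>
  (\<open>ruling_sum_front_word\<close>, \<open>slip_sum_coefficient_blocks\<close>).

  The geometry is made explicit. The height of a strand interpolates between its successive positions by
  smooth steps, and near the two ends the strands are pinched together in pairs. With
  \<open>x = K / 2 - (K / 2 + 1) * cos (pi * s)\<close>, where \<open>K\<close> is the length of \<open>W\<close>, the two branches of a cusp
  are given by one smooth formula in \<open>s\<close>, so the strands fit together to a smooth Legendrian curve. It
  closes up to a single knot if the strands can be arranged in one cycle in which consecutive strands
  share alternately a right and a left cusp (locale \<open>plat_knot\<close>); for the words above such a cycle is
  constructed block by block (\<open>plat_knot_family\<close>).
\<close>

section \<open>Smooth functions on the real line\<close>

text \<open>Smoothness is usually proved by exhibiting a class of functions that is closed under derivatives;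
  the sequence of higher derivatives is then obtained by choosing inside the class.\<close>

lemma smooth_curveI_class:
  fixes f :: "real \<Rightarrow> 'a::real_normed_vector"
  assumes step: "\<And>g. g \<in> F \<Longrightarrow> \<exists>g'\<in>F. \<forall>t. (g has_vector_derivative g' t) (at t)"
    and f: "f \<in> F"
  shows "smooth_curve f"
proof -
  define nxt where "nxt g = (SOME g'. g' \<in> F \<and> (\<forall>t. (g has_vector_derivative g' t) (at t)))" for g
  have nxt: "nxt g \<in> F \<and> (\<forall>t. (g has_vector_derivative nxt g t) (at t))" if "g \<in> F" for g
  proof -
    have "\<exists>g'. g' \<in> F \<and> (\<forall>t. (g has_vector_derivative g' t) (at t))"
      using step[OF that] unfolding Bex_def .
    from someI_ex[OF this] show ?thesis unfolding nxt_def .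
  qed
  have mem: "(nxt ^^ n) f \<in> F" for n
    by (induction n) (simp_all add: f nxt)
  show ?thesis
    unfolding smooth_curve_def
  proof (intro exI[of _ "\<lambda>n. (nxt ^^ n) f"] conjI allI)
    fix n t
    show "((nxt ^^ n) f has_vector_derivative (nxt ^^ Suc n) f t) (at t)"
      using nxt[OF mem[of n]] by simp
  qed simp
qed

lemma smooth_curve_derivative:
  assumes "smooth_curve f"
  obtains f' where "smooth_curve f'" "\<And>t. (f has_vector_derivative f' t) (at t)"
proof -
  from assms obtain D where D: "D 0 = f" "\<And>n t. (D n has_vector_derivative D (Suc n) t) (at t)"
    unfolding smooth_curve_def by blast
  have "smooth_curve (D 1)"
    unfolding smooth_curve_def by (rule exI[of _ "\<lambda>n. D (Suc n)"]) (use D in simp)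
  moreover have "(f has_vector_derivative D 1 t) (at t)" for t
    using D(2)[of 0] D(1) by simp
  ultimately show ?thesis by (rule that)
qed

lemma has_vector_derivative_nhds_cong:
  assumes "\<forall>\<^sub>F s in nhds t. f s = g s" "(g has_vector_derivative g') (at t)"
  shows "(f has_vector_derivative g') (at t)"
proof -
  have "\<forall>\<^sub>F s in nhds t. s \<in> UNIV \<longrightarrow> f s = g s" using assms(1) by simp
  from has_vector_derivative_cong_ev[OF this eventually_nhds_x_imp_x[OF assms(1)]] assms(2)
  show ?thesis by simp
qed

text \<open>The knot is glued from charts, so smoothness has to be a local property. The class of locally smooth
  functions is closed under derivatives, as the derivative agrees near each point with that
  of the local model.\<close>

lemma smooth_curve_local:
  fixes f :: "real \<Rightarrow> 'a::real_normed_vector"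
  assumes "\<And>t. \<exists>g. smooth_curve g \<and> (\<forall>\<^sub>F s in nhds t. f s = g s)"
  shows "smooth_curve f"
proof (rule smooth_curveI_class)
  define F where "F = {f :: real \<Rightarrow> 'a. \<forall>t. \<exists>g. smooth_curve g \<and> (\<forall>\<^sub>F s in nhds t. f s = g s)}"
  show "f \<in> F" using assms by (simp add: F_def)
  fix g assume "g \<in> F"
  define g' where "g' t = vector_derivative g (at t)" for t
  have "\<exists>h. smooth_curve h \<and> (\<forall>\<^sub>F s in nhds t. g' s = h s) \<and> (g has_vector_derivative g' t) (at t)" for t
  proof -
    from \<open>g \<in> F\<close> obtain k where k: "smooth_curve k" "\<forall>\<^sub>F s in nhds t. g s = k s"
      unfolding F_def by blast
    obtain k' where k': "smooth_curve k'" "\<And>t. (k has_vector_derivative k' t) (at t)"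
      using smooth_curve_derivative[OF k(1)] by blast
    have "\<forall>\<^sub>F s in nhds t. \<forall>\<^sub>F r in nhds s. g r = k r"
      using k(2) by (simp add: eventually_eventually)
    then have ev: "\<forall>\<^sub>F s in nhds t. (g has_vector_derivative k' s) (at s)"
    proof eventually_elim
      case (elim s)
      show ?case
        by (rule has_vector_derivative_nhds_cong[OF elim k'(2)])
    qed
    then have "\<forall>\<^sub>F s in nhds t. g' s = k' s"
      by eventually_elim (simp add: g'_def vector_derivative_at)
    moreover have "(g has_vector_derivative g' t) (at t)"
      using eventually_nhds_x_imp_x[OF ev] eventually_nhds_x_imp_x[OF calculation] by simp
    ultimately show ?thesis using k'(1) by (intro exI[of _ k'] conjI)
  qed
  note h = this
  have "\<exists>h. smooth_curve h \<and> (\<forall>\<^sub>F s in nhds t. g' s = h s)" for t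
    using h[of t] by (elim exE conjE) (rule exI, rule conjI)
  then have "g' \<in> F" by (simp add: F_def)
  moreover have "(g has_vector_derivative g' t) (at t)" for t
    using h[of t] by (elim exE conjE)
  ultimately show "\<exists>g'\<in>F. \<forall>t. (g has_vector_derivative g' t) (at t)"
    by (intro bexI[of _ g'] allI)
qed

text \<open>
  Closure of smooth functions under products, compositions and inverses would need formulas for higher
  derivatives. They are avoided by closing the smooth functions under all these operations at once: by the rules
  for first derivatives, the resulting class is closed under derivatives, so it consists
  of smooth functions.
\<close>

inductive smooth_closure :: "(real \<Rightarrow> real) \<Rightarrow> bool" where
  smooth: "smooth_curve f \<Longrightarrow> smooth_closure f"
| add: "smooth_closure f \<Longrightarrow> smooth_closure g \<Longrightarrow> smooth_closure (\<lambda>t. f t + g t)"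
| mult: "smooth_closure f \<Longrightarrow> smooth_closure g \<Longrightarrow> smooth_closure (\<lambda>t. f t * g t)"
| comp: "smooth_curve f \<Longrightarrow> smooth_closure g \<Longrightarrow> smooth_closure (\<lambda>t. f (g t))"
| inv: "smooth_closure f \<Longrightarrow> (\<And>t. f t \<noteq> 0) \<Longrightarrow> smooth_closure (\<lambda>t. inverse (f t))"

lemma smooth_curve_const: "smooth_curve (\<lambda>t. c :: 'a::real_normed_vector)"
  unfolding smooth_curve_def
proof (intro exI[of _ "\<lambda>n t. if n = 0 then c else 0"] conjI allI)
  fix n :: nat and t :: real
  show "((\<lambda>t. if n = 0 then c else 0) has_vector_derivative (if Suc n = 0 then c else 0)) (at t)"
    by simp
qed simp

lemma smooth_curve_ident: "smooth_curve (\<lambda>t::real. t)"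
  unfolding smooth_curve_def
proof (intro exI[of _ "\<lambda>n t. if n = 0 then t else if n = 1 then 1 else 0"] conjI allI)
  fix n :: nat and t :: real
  have "((\<lambda>t. t) has_vector_derivative 1) (at t)" by (rule has_vector_derivative_id)
  then show "((\<lambda>t. if n = 0 then t else if n = 1 then 1 else 0) has_vector_derivative
      (if Suc n = 0 then t else if Suc n = 1 then 1 else 0)) (at t)"
    by (cases n) auto
qed simp

lemma smooth_closure_const: "smooth_closure (\<lambda>t. c)"
  by (intro smooth_closure.smooth smooth_curve_const)

lemma smooth_closure_derivative:
  assumes "smooth_closure f"
  shows "\<exists>f'. smooth_closure f' \<and> (\<forall>t. (f has_real_derivative f' t) (at t))"
  using assms
proof induction
  case (smooth f)
  then show ?case
    by (metis smooth_curve_derivative smooth_closure.smooth has_real_derivative_iff_has_vector_derivative)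
next
  case (add f g)
  then obtain f' g' where "smooth_closure f'" "\<forall>t. (f has_real_derivative f' t) (at t)"
    "smooth_closure g'" "\<forall>t. (g has_real_derivative g' t) (at t)" by blast
  then show ?case
    by (intro exI[of _ "\<lambda>t. f' t + g' t"]) (auto intro!: smooth_closure.add DERIV_add)
next
  case (mult f g)
  then obtain f' g' where fg: "smooth_closure f'" "\<And>t. (f has_real_derivative f' t) (at t)"
    "smooth_closure g'" "\<And>t. (g has_real_derivative g' t) (at t)" by blast
  show ?case
    by (intro exI[of _ "\<lambda>t. f' t * g t + g' t * f t"] conjI allI)
       (auto intro!: smooth_closure.add smooth_closure.mult mult.hyps fg DERIV_mult)
next
  case (comp f g)
  then obtain g' where g': "smooth_closure g'" "\<And>t. (g has_real_derivative g' t) (at t)" by blast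
  obtain f' where f': "smooth_curve f'" "\<And>t. (f has_vector_derivative f' t) (at t)"
    using smooth_curve_derivative[OF comp.hyps(1)] by blast
  have "((\<lambda>t. f (g t)) has_real_derivative f' (g t) * g' t) (at t)" for t
    by (rule DERIV_chain2[OF f'(2)[folded has_real_derivative_iff_has_vector_derivative] g'(2)])
  moreover have "smooth_closure (\<lambda>t. f' (g t) * g' t)"
    by (rule smooth_closure.mult[OF smooth_closure.comp[OF f'(1) comp.hyps(2)] g'(1)])
  ultimately show ?case by blast
next
  case (inv f)
  then obtain f' where f': "smooth_closure f'" "\<And>t. (f has_real_derivative f' t) (at t)" by blast
  have *: "smooth_closure (\<lambda>t. inverse (f t))"
    by (rule smooth_closure.inv) (rule inv.hyps)+
  have "((\<lambda>t. inverse (f t)) has_real_derivative - 1 * (inverse (f t) * (f' t * inverse (f t)))) (at t)" for t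
    using DERIV_inverse'[OF f'(2), of t] inv.hyps(2)[of t] by (simp add: mult.assoc)
  moreover have "smooth_closure (\<lambda>t. - 1 * (inverse (f t) * (f' t * inverse (f t))))"
    by (rule smooth_closure.mult[OF smooth_closure_const smooth_closure.mult[OF *
          smooth_closure.mult[OF f'(1) *]]])
  ultimately show ?case by blast
qed

lemma smooth_closure_smooth:
  assumes "smooth_closure f" shows "smooth_curve f"
proof (rule smooth_curveI_class[where F = "Collect smooth_closure"])
  fix g :: "real \<Rightarrow> real" assume "g \<in> Collect smooth_closure"
  then show "\<exists>g'\<in>Collect smooth_closure. \<forall>t. (g has_vector_derivative g' t) (at t)"
    using smooth_closure_derivative[of g] by (auto simp: has_real_derivative_iff_has_vector_derivative)
qed (use assms in simp)

lemma
  fixes f g :: "real \<Rightarrow> real"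
  assumes f: "smooth_curve f"
  shows smooth_add: "smooth_curve g \<Longrightarrow> smooth_curve (\<lambda>t. f t + g t)"
    and smooth_mult: "smooth_curve g \<Longrightarrow> smooth_curve (\<lambda>t. f t * g t)"
    and smooth_compose: "smooth_curve g \<Longrightarrow> smooth_curve (\<lambda>t. f (g t))"
    and smooth_inverse: "(\<And>t. f t \<noteq> 0) \<Longrightarrow> smooth_curve (\<lambda>t. inverse (f t))"
proof -
  note sf = smooth_closure.smooth[OF f]
  show "smooth_curve (\<lambda>t. f t + g t)" if "smooth_curve g"
    by (rule smooth_closure_smooth[OF smooth_closure.add[OF sf smooth_closure.smooth[OF that]]])
  show "smooth_curve (\<lambda>t. f t * g t)" if "smooth_curve g"
    by (rule smooth_closure_smooth[OF smooth_closure.mult[OF sf smooth_closure.smooth[OF that]]])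
  show "smooth_curve (\<lambda>t. f (g t))" if "smooth_curve g"
    by (rule smooth_closure_smooth[OF smooth_closure.comp[OF f smooth_closure.smooth[OF that]]])
  show "smooth_curve (\<lambda>t. inverse (f t))" if "\<And>t. f t \<noteq> 0"
    by (rule smooth_closure_smooth[OF smooth_closure.inv[OF sf that]])
qed

lemma smooth_cmult: "smooth_curve f \<Longrightarrow> smooth_curve (\<lambda>t. c * f t)" for f :: "real \<Rightarrow> real"
  by (rule smooth_mult[OF smooth_curve_const])

lemma smooth_minus: "smooth_curve f \<Longrightarrow> smooth_curve (\<lambda>t. - f t)" for f :: "real \<Rightarrow> real"
  using smooth_cmult[of f "-1"] by simp

lemma smooth_diff: "smooth_curve f \<Longrightarrow> smooth_curve g \<Longrightarrow> smooth_curve (\<lambda>t. f t - g t)"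
  for f g :: "real \<Rightarrow> real"
  using smooth_add[of f "\<lambda>t. - g t"] smooth_minus[of g] by simp

lemma smooth_power: "smooth_curve f \<Longrightarrow> smooth_curve (\<lambda>t. f t ^ n)" for f :: "real \<Rightarrow> real"
proof (induction n)
  case (Suc n)
  then show ?case using smooth_mult[of f "\<lambda>t. f t ^ n"] by simp
qed (simp add: smooth_curve_const)

lemma smooth_sum:
  "(\<And>i. i \<in> I \<Longrightarrow> smooth_curve (f i)) \<Longrightarrow> smooth_curve (\<lambda>t. \<Sum>i\<in>I. f i t :: real)"
proof (induction I rule: infinite_finite_induct)
  case (insert i I)
  then show ?case using smooth_add[of "f i" "\<lambda>t. \<Sum>i\<in>I. f i t"] by simp
qed (simp_all add: smooth_curve_const)

lemma smooth_sin: "smooth_curve (sin :: real \<Rightarrow> real)"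
  and smooth_cos: "smooth_curve (cos :: real \<Rightarrow> real)"
proof -
  let ?F = "{sin, cos, \<lambda>t. - sin t, \<lambda>t. - cos t :: real}"
  have *: "\<exists>g'\<in>?F. \<forall>t. (g has_vector_derivative g' t) (at t)" if "g \<in> ?F" for g
  proof -
    have "(sin has_vector_derivative cos t) (at t)" "(cos has_vector_derivative - sin t) (at t)"
      "((\<lambda>t. - sin t) has_vector_derivative - cos t) (at t)"
      "((\<lambda>t. - cos t) has_vector_derivative sin t) (at t)" for t :: real
      unfolding has_real_derivative_iff_has_vector_derivative[symmetric]
      by (auto intro!: derivative_eq_intros)
    then show ?thesis using that by fast
  qed
  show "smooth_curve (sin :: real \<Rightarrow> real)" "smooth_curve (cos :: real \<Rightarrow> real)"
    by (rule smooth_curveI_class[OF *]; simp)+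
qed

lemmas smooth_intros = smooth_add smooth_diff smooth_minus smooth_mult smooth_power smooth_sum
  smooth_curve_const smooth_curve_ident smooth_compose[OF smooth_sin] smooth_compose[OF smooth_cos]

lemma smooth_Pair:
  fixes f :: "real \<Rightarrow> 'a::real_normed_vector" and g :: "real \<Rightarrow> 'b::real_normed_vector"
  assumes "smooth_curve f" "smooth_curve g"
  shows "smooth_curve (\<lambda>t. (f t, g t))"
proof -
  from assms obtain D E where "D 0 = f" "\<forall>n t. (D n has_vector_derivative D (Suc n) t) (at t)"
    "E 0 = g" "\<forall>n t. (E n has_vector_derivative E (Suc n) t) (at t)"
    unfolding smooth_curve_def by blast
  then show ?thesis unfolding smooth_curve_def
    by (intro exI[of _ "\<lambda>n t. (D n t, E n t)"]) (auto intro!: has_vector_derivative_Pair)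
qed

text \<open>The classical smooth function that vanishes exactly on the nonpositive reals. Its derivatives are
  polynomials in \<open>1 / t\<close> times \<open>exp (- 1 / t)\<close>; the class of all such functions is closed under
  derivatives because the exponential beats every power at 0.\<close>

definition flat_exp :: "real \<Rightarrow> real" where
  "flat_exp t = (if t > 0 then exp (- inverse t) else 0)"

lemma poly_times_exp_tendsto:
  "((\<lambda>t. poly p (inverse t) * exp (- inverse t)) \<longlongrightarrow> 0) (at_right (0::real))"
proof -
  have "((\<lambda>u. \<Sum>i\<le>degree p. coeff p i * (u ^ i / exp u)) \<longlongrightarrow> (\<Sum>i\<le>degree p. coeff p i * 0)) at_top"
    by (intro tendsto_sum tendsto_mult tendsto_const tendsto_power_div_exp_0)
  moreover have "poly p u * exp (- u) = (\<Sum>i\<le>degree p. coeff p i * (u ^ i / exp u))" for u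
    by (simp add: poly_altdef sum_distrib_right exp_minus divide_inverse mult.assoc)
  ultimately have "((\<lambda>u. poly p u * exp (- u)) \<longlongrightarrow> 0) at_top" by simp
  then show ?thesis
    by (rule filterlim_compose[OF _ filterlim_inverse_at_top_right])
qed

lemma poly_times_flat_exp_derivative:
  fixes p :: "real poly"
  defines "g \<equiv> \<lambda>p t. if t > 0 then poly p (inverse t) * exp (- inverse t) else (0::real)"
  shows "(g p has_real_derivative g (monom 1 2 * (p - pderiv p)) t) (at t)"
proof -
  consider "t > 0" | "t < 0" | "t = 0" by linarith
  then show ?thesis
  proof cases
    case 1
    have "((\<lambda>t. poly p (inverse t) * exp (- inverse t)) has_real_derivative
        g (monom 1 2 * (p - pderiv p)) t) (at t)"
      using 1 unfolding g_def
      by (auto intro!: derivative_eq_intros DERIV_chain2[OF poly_DERIV]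
               simp: poly_monom algebra_simps power2_eq_square)
    moreover have "\<forall>\<^sub>F s in nhds t. g p s = poly p (inverse s) * exp (- inverse s)"
      using eventually_nhds_in_open[of "{0<..}" t] 1 by (auto elim!: eventually_mono simp: g_def)
    ultimately show ?thesis by (subst DERIV_cong_ev[OF refl _ refl])
  next
    case 2
    have "\<forall>\<^sub>F s in nhds t. g p s = 0"
      using eventually_nhds_in_open[of "{..<0}" t] 2 by (auto elim!: eventually_mono simp: g_def)
    then show ?thesis using 2 by (subst DERIV_cong_ev[OF refl _ refl]) (auto simp: g_def)
  next
    case 3
    have "((\<lambda>h. g p h / h) \<longlongrightarrow> 0) (at_left 0)"
      by (rule tendsto_eventually) (auto simp: eventually_at_filter g_def)
    moreover have "((\<lambda>h. g p h / h) \<longlongrightarrow> 0) (at_right 0)"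
    proof (rule Lim_transform_eventually[OF poly_times_exp_tendsto[of "pCons 0 p"]])
      show "\<forall>\<^sub>F t in at_right 0. poly (pCons 0 p) (inverse t) * exp (- inverse t) = g p t / t"
        by (auto simp: eventually_at_filter g_def divide_inverse)
    qed
    ultimately have "((\<lambda>h. g p h / h) \<longlongrightarrow> 0) (at 0)" by (rule filterlim_split_at)
    then show ?thesis using 3 by (simp add: DERIV_def g_def cong: if_cong)
  qed
qed

lemma smooth_flat_exp: "smooth_curve flat_exp"
proof (rule smooth_curveI_class)
  let ?g = "\<lambda>p t. if t > 0 then poly p (inverse t) * exp (- inverse t) else (0::real)"
  show "flat_exp \<in> range ?g"
    by (rule image_eqI[of _ _ 1]) (auto simp: flat_exp_def)
  fix f assume "f \<in> range ?g"
  then show "\<exists>f'\<in>range ?g. \<forall>t. (f has_vector_derivative f' t) (at t)"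
    using poly_times_flat_exp_derivative
    by (fastforce simp: has_real_derivative_iff_has_vector_derivative)
qed

definition smooth_step :: "real \<Rightarrow> real" where
  "smooth_step t = flat_exp t * inverse (flat_exp t + flat_exp (1 - t))"

lemma flat_exp_nonneg: "flat_exp t \<ge> 0"
  and flat_exp_pos: "t > 0 \<Longrightarrow> flat_exp t > 0"
  and flat_exp_eq_0: "t \<le> 0 \<Longrightarrow> flat_exp t = 0"
  by (auto simp: flat_exp_def)

lemma flat_exp_denom_pos: "flat_exp t + flat_exp (1 - t) > 0"
  using flat_exp_nonneg[of t] flat_exp_nonneg[of "1 - t"] flat_exp_pos[of t] flat_exp_pos[of "1 - t"]
  by (cases "t > 0") auto

lemma flat_exp_less: "s < t \<Longrightarrow> t > 0 \<Longrightarrow> flat_exp s < flat_exp t"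
  by (auto simp: flat_exp_def)

lemma smooth_smooth_step: "smooth_curve smooth_step"
  unfolding smooth_step_def
  by (intro smooth_mult smooth_inverse smooth_add smooth_flat_exp
        smooth_compose[OF smooth_flat_exp] smooth_diff smooth_curve_const smooth_curve_ident)
     (use flat_exp_denom_pos in \<open>metis less_irrefl\<close>)

lemma smooth_step_0: "t \<le> 0 \<Longrightarrow> smooth_step t = 0"
  and smooth_step_1: "t \<ge> 1 \<Longrightarrow> smooth_step t = 1"
  and smooth_step_nonneg: "smooth_step t \<ge> 0"
  and smooth_step_le_1: "smooth_step t \<le> 1"
  and smooth_step_half: "smooth_step (1/2) = 1/2"
  and smooth_step_less_half: "t < 1/2 \<Longrightarrow> smooth_step t < 1/2"
  and smooth_step_greater_half: "t > 1/2 \<Longrightarrow> smooth_step t > 1/2"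
  using flat_exp_denom_pos[of t] flat_exp_nonneg[of t] flat_exp_nonneg[of "1-t"]
    flat_exp_pos[of t] flat_exp_pos[of "1-t"] flat_exp_less[of t "1-t"] flat_exp_less[of "1-t" t]
    flat_exp_pos[of "1/2"]
  by (auto simp: smooth_step_def flat_exp_eq_0 divide_simps split: if_splits)

text \<open>A positive slope in the middle of the step makes the crossings transverse.\<close>

lemma smooth_step_derivative_half:
  obtains D where "(smooth_step has_real_derivative D) (at (1/2))" "D > 0"
proof -
  have "(flat_exp has_real_derivative 4 * exp (-2)) (at (1/2))"
    using poly_times_flat_exp_derivative[of 1 "1/2"] by (simp add: flat_exp_def[abs_def] poly_monom cong: if_cong)
  then have d: "(flat_exp has_real_derivative 4 * exp (-2)) (at (1/2))"
    "((\<lambda>t. flat_exp (1 - t)) has_real_derivative 4 * exp (-2) * (-1)) (at (1/2))"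
    by (simp, intro DERIV_chain2[where f = flat_exp and g = "\<lambda>t. 1 - t"])
       (auto intro!: derivative_eq_intros)
  have "(smooth_step has_real_derivative 2) (at (1/2))"
    unfolding smooth_step_def[abs_def]
    by (rule derivative_eq_intros d refl | simp)+ (auto simp: flat_exp_def field_simps)
  then show ?thesis by (rule that) simp
qed

lemma smooth_step_deriv: "(smooth_step has_real_derivative deriv smooth_step t) (at t)"
  and smooth_deriv_smooth_step: "smooth_curve (deriv smooth_step)"
proof -
  obtain f' where f': "smooth_curve f'" "\<And>t. (smooth_step has_vector_derivative f' t) (at t)"
    using smooth_curve_derivative[OF smooth_smooth_step] by blast
  have "deriv smooth_step = f'"
    using f'(2) by (auto simp: DERIV_imp_deriv has_real_derivative_iff_has_vector_derivative)
  then show "(smooth_step has_real_derivative deriv smooth_step t) (at t)" "smooth_curve (deriv smooth_step)"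
    using f' by (auto simp: has_real_derivative_iff_has_vector_derivative)
qed

section \<open>Sweeping rulings along a word of crossings\<close>

text \<open>The effect of a crossing on the positions of strands.\<close>

definition sw :: "nat \<Rightarrow> nat \<Rightarrow> nat" where
  "sw i p = (if p = i then Suc i else if p = Suc i then i else p)"

text \<open>The position that meets position \<open>p\<close> in a cusp, at the left end as well as at the right end.\<close>

definition adj :: "nat \<Rightarrow> nat" where
  "adj p = (if even p then Suc p else p - 1)"

text \<open>Normality at a switch of the positions \<open>i\<close> and \<open>i + 1\<close>, where \<open>m\<close> maps a position to the other
  position of its disk. The two intervals are disjoint (first disjunct), or both partners lie on the
  same side of the switch, and then the intervals are nested iff the partners are in reverse order.\<close>

definition noncrossing_at :: "(nat \<Rightarrow> nat) \<Rightarrow> nat \<Rightarrow> bool" where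
  "noncrossing_at m i \<longleftrightarrow>
     m i < i \<and> Suc i < m (Suc i) \<or> (m i < i \<longleftrightarrow> m (Suc i) < i) \<and> m (Suc i) < m i"

text \<open>The generating function of the valid sets of switches by their number, computed from left to
  right. The state consists of the pairing \<open>m\<close> of positions by disks and the types \<open>ty\<close> of the
  strands in each position. If the two crossing positions bound the same
  disk, the disk would be pinched, so there is no ruling. Without a switch the ruling paths change
  positions; at a switch they keep them. The strands, and hence the types, are exchanged in either
  case.\<close>

fun ruling_sum :: "'a::comm_ring_1 \<Rightarrow> nat list \<Rightarrow> (nat \<Rightarrow> nat) \<Rightarrow> (nat \<Rightarrow> bool) \<Rightarrow> 'a" where
  "ruling_sum z [] m ty = (if m = adj then 1 else 0)"
| "ruling_sum z (i # W) m ty =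
    (if m i = Suc i then 0
     else ruling_sum z W (sw i \<circ> m \<circ> sw i) (ty \<circ> sw i)
        + (if ty i = ty (Suc i) \<and> noncrossing_at m i then z * ruling_sum z W m (ty \<circ> sw i) else 0))"

lemma sw_simps [simp]: "sw i i = Suc i" "sw i (Suc i) = i" "sw i (sw i p) = p"
  by (auto simp: sw_def)

lemma sw_other: "p \<noteq> i \<Longrightarrow> p \<noteq> Suc i \<Longrightarrow> sw i p = p"
  by (simp add: sw_def)

lemma sw_add: "sw (k + i) (k + p) = k + sw i p"
  by (auto simp: sw_def)

lemma adj_adj [simp]: "adj (adj p) = p"
  by (auto simp: adj_def)

text \<open>All the action happens in six consecutive positions, so states can be represented by lists of length six.
  Outside of the window the strands are paired as at the cusps.\<close>

definition window :: "nat \<Rightarrow> nat list \<Rightarrow> nat \<Rightarrow> nat" where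
  "window k w p = (if k \<le> p \<and> p < k + 6 then k + w ! (p - k) else adj p)"

definition type_window :: "nat \<Rightarrow> bool list \<Rightarrow> nat \<Rightarrow> bool" where
  "type_window k t p = (if k \<le> p \<and> p < k + 6 then t ! (p - k) else even p)"

definition list_sw :: "nat \<Rightarrow> 'a list \<Rightarrow> 'a list" where
  "list_sw i t = map (\<lambda>p. t ! sw i p) [0..<6]"

text \<open>The executable version of \<open>ruling_sum\<close> inside one window: the list of all final pairings, each with
  the number of switches.\<close>

fun window_rulings :: "nat list \<Rightarrow> nat list \<Rightarrow> bool list \<Rightarrow> (nat \<times> nat list) list" where
  "window_rulings [] w t = [(0, w)]"
| "window_rulings (i # V) w t =
    (if w ! i = Suc i then []
     else window_rulings V (map (sw i) (list_sw i w)) (list_sw i t)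
        @ (if t ! i = t ! Suc i \<and> noncrossing_at ((!) w) i
           then map (apfst Suc) (window_rulings V w (list_sw i t)) else []))"

definition window_perm :: "nat list \<Rightarrow> bool" where
  "window_perm w \<longleftrightarrow> length w = 6 \<and> set w \<subseteq> {..<6}"

lemma window_at: "i < 6 \<Longrightarrow> window k w (k + i) = k + w ! i"
  by (simp add: window_def)

lemma type_window_at: "i < 6 \<Longrightarrow> type_window k t (k + i) = t ! i"
  by (simp add: type_window_def)

lemma sw_less: "i < 5 \<Longrightarrow> p < 6 \<Longrightarrow> sw i p < 6"
  by (auto simp: sw_def)

lemma window_sw:
  assumes "i < 5" "window_perm w" "even k"
  shows "sw (k + i) \<circ> window k w \<circ> sw (k + i) = window k (map (sw i) (list_sw i w))"
proof
  fix p
  show "(sw (k + i) \<circ> window k w \<circ> sw (k + i)) p = window k (map (sw i) (list_sw i w)) p"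
  proof (cases "k \<le> p \<and> p < k + 6")
    case True
    then obtain r where r: "p = k + r" "r < 6" by (metis add_diff_inverse_nat add_less_cancel_left not_less)
    then show ?thesis
      using sw_less[OF assms(1) r(2)]
      by (simp add: sw_add window_at list_sw_def)
  next
    case False
    then have "sw (k + i) p = p" "sw (k + i) (adj p) = adj p"
      using assms(1,3) by (auto simp: sw_def adj_def elim!: evenE oddE; presburger)+
    then show ?thesis using False by (auto simp: window_def)
  qed
qed

lemma type_window_sw:
  assumes "i < 5"
  shows "type_window k t \<circ> sw (k + i) = type_window k (list_sw i t)"
proof
  fix p
  show "(type_window k t \<circ> sw (k + i)) p = type_window k (list_sw i t) p"
  proof (cases "k \<le> p \<and> p < k + 6")
    case True
    then obtain r where r: "p = k + r" "r < 6" by (metis add_diff_inverse_nat add_less_cancel_left not_less)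
    then show ?thesis
      using sw_less[OF assms(1) r(2)]
      by (simp add: sw_add type_window_at list_sw_def)
  next
    case False
    then have "sw (k + i) p = p" using assms by (auto simp: sw_def)
    then show ?thesis using False by (auto simp: type_window_def)
  qed
qed

lemma ruling_sum_window:
  assumes "even k" "window_perm w" "\<forall>i\<in>set V. i < 5"
  shows "ruling_sum z (map ((+) k) V @ R) (window k w) (type_window k t) =
    (\<Sum>(e, w')\<leftarrow>window_rulings V w t. z ^ e * ruling_sum z R (window k w') (type_window k (fold list_sw V t)))"
  using assms(2,3)
proof (induction V arbitrary: w t)
  case Nil
  then show ?case by simp
next
  case (Cons i V)
  have i: "i < 5" using Cons.prems by simp
  have perm: "window_perm (map (sw i) (list_sw i w))"
    using Cons.prems i unfolding window_perm_def list_sw_def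
    by (auto intro!: sw_less) (metis sw_less lessThan_iff nth_mem subsetD)
  have nc: "noncrossing_at (window k w) (k + i) = noncrossing_at ((!) w) i"
    using i window_at[of i k w] window_at[of "Suc i" k w] by (auto simp: noncrossing_at_def)
  have eq: "(window k w (k + i) = Suc (k + i)) = (w ! i = Suc i)"
    using i window_at[of i k w] by simp
  have ty: "(type_window k t (k + i) = type_window k t (Suc (k + i))) = (t ! i = t ! Suc i)"
    using i type_window_at[of i k t] type_window_at[of "Suc i" k t] by simp
  have *: "sum_list (map ((\<lambda>(e, w'). z ^ e * f w') \<circ> apfst Suc) xs) = z * (\<Sum>(e, w')\<leftarrow>xs. z ^ e * f w')" for xs f
    by (induction xs) (auto simp: algebra_simps)
  show ?case
    using Cons.IH[OF perm] Cons.IH[OF Cons.prems(1)] Cons.prems(2)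
    by (simp add: nc eq ty window_sw[OF i Cons.prems(1) assms(1)] type_window_sw[OF i] *)
qed

text \<open>This discards branches of the sweep: if an even position is no longer touched by the word
  and its partner lies below it but not directly below, then the final pairing cannot be that of the cusps.\<close>

lemma ruling_sum_dead:
  assumes "m p \<noteq> Suc p" "m p \<noteq> p" "m p \<ge> p" "even p" "\<forall>i\<in>set W. i > Suc p"
  shows "ruling_sum z W m ty = 0"
  using assms(1,2,3,5)
proof (induction W arbitrary: m ty)
  case Nil
  then show ?case using assms(4) by (auto simp: adj_def)
next
  case (Cons i W)
  have "(sw i \<circ> m \<circ> sw i) p \<noteq> Suc p" "(sw i \<circ> m \<circ> sw i) p \<noteq> p" "(sw i \<circ> m \<circ> sw i) p \<ge> p"
    using Cons.prems by (auto simp: sw_def)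
  then show ?case using Cons by simp
qed

text \<open>Both blocks carry four active strands and a new pair below them to a finished pair above four active
  strands. The words are chosen for their transition matrices computed below.\<close>

definition slip_block :: "nat list" where
  "slip_block = [3,2,1,0,4,3,2,2,1,3,2,2,1,3,3,2,1]"

definition weight_block :: "nat list" where
  "weight_block = [3,2,1,0,0,0,1,2,2,1,3,2,2,3,3,2,1]"

definition active_types :: "bool list" where
  "active_types = [True,True,False,False,True,False]"

text \<open>
  The two pairings of the active positions that matter. In both, the new pair in the positions 4 and 5
  is joined by its left cusp; the active strands of type U are paired with those of type L in the
  interleaved or in the nested way.
\<close>

definition undecided :: "nat list" where "undecided = [2,3,0,1,5,4]"
definition decided :: "nat list" where "decided = [3,2,1,0,5,4]"

text \<open>Only the rulings that pair the two topmost positions with each other can be completed, since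
  later blocks do not touch these positions. The results are again undecided or
  decided with respect to the window moved down by two positions: this is the matrix
  \<open>((z, z ^ 2), (0, z))\<close> of the slip block.\<close>

lemma slip_block_rulings:
  "filter (\<lambda>(e, w). w ! 0 = 1) (window_rulings slip_block undecided active_types) =
     [(1, [1,0,4,5,2,3]), (2, [1,0,5,4,3,2])]"
  "filter (\<lambda>(e, w). w ! 0 = 1) (window_rulings slip_block decided active_types) =
     [(1, [1,0,5,4,3,2])]"
  by code_simp+

text \<open>The weight block acts by the diagonal matrix \<open>(z ^ 3, z)\<close>.\<close>

lemma weight_block_rulings:
  "filter (\<lambda>(e, w). w ! 0 = 1) (window_rulings weight_block undecided active_types) =
     [(3, [1,0,4,5,2,3])]"
  "filter (\<lambda>(e, w). w ! 0 = 1) (window_rulings weight_block decided active_types) =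
     [(1, [1,0,5,4,3,2])]"
  by code_simp+

lemma block_types:
  "fold list_sw slip_block active_types = [True,False,True,True,False,False]"
  "fold list_sw weight_block active_types = [True,False,True,True,False,False]"
  by code_simp+

text \<open>Two final crossings bring the decided pairing to that of the right cusps and kill the undecided one.\<close>

lemma closing_rulings:
  "filter (\<lambda>(e, w). w = [1,0,3,2,5,4]) (window_rulings [0,1] undecided active_types) = []"
  "filter (\<lambda>(e, w). w = [1,0,3,2,5,4]) (window_rulings [0,1] decided active_types) = [(0, [1,0,3,2,5,4])]"
  by code_simp+

definition block :: "bool \<Rightarrow> nat list" where
  "block b = (if b then weight_block else slip_block)"

fun block_word :: "nat \<Rightarrow> bool list \<Rightarrow> nat list" where
  "block_word k [] = [k, Suc k]"
| "block_word k (b # bs) = map ((+) k) (block b) @ block_word (k + 2) bs"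

text \<open>The first crossing turns the types U, L, U, L of the four topmost strands into U, U, L, L, and the pairing
  of the left cusps into the undecided one.\<close>

definition front_word :: "bool list \<Rightarrow> nat list" where
  "front_word bs = 1 # block_word 0 bs"

lemma block_word_ge: "i \<in> set (block_word k bs) \<Longrightarrow> k \<le> i"
  by (induction bs arbitrary: k) force+

lemma block_word_less: "i \<in> set (block_word k bs) \<Longrightarrow> Suc i < k + 2 * (length bs + 2)"
  by (induction bs arbitrary: k) (force simp: block_def slip_block_def weight_block_def split: if_splits)+

lemma front_word_less: "i \<in> set (front_word bs) \<Longrightarrow> Suc i < 2 * (length bs + 2)"
  using block_word_less[of i 0 bs] by (auto simp: front_word_def)

lemma eight_cases: "(r::nat) < 8 \<Longrightarrow> r = 0 \<or> r = 1 \<or> r = 2 \<or> r = 3 \<or> r = 4 \<or> r = 5 \<or> r = 6 \<or> r = 7"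
  by arith

lemma six_cases: "(r::nat) < 6 \<Longrightarrow> r = 0 \<or> r = 1 \<or> r = 2 \<or> r = 3 \<or> r = 4 \<or> r = 5"
  by arith

lemma window_shift_eqI:
  assumes "even k" "\<And>r. r < 8 \<Longrightarrow> window k w (k + r) = window (k + 2) w' (k + r)"
  shows "window k w = window (k + 2) w'"
proof
  fix p show "window k w p = window (k + 2) w' p"
  proof (cases "k \<le> p \<and> p < k + 8")
    case True
    then obtain r where "p = k + r" "r < 8" by (metis add_diff_inverse_nat add_less_cancel_left not_less)
    then show ?thesis using assms by simp
  qed (auto simp: window_def)
qed

lemma window_shift:
  assumes "even k"
  shows "window k [1,0,4,5,2,3] = window (k + 2) undecided"
    and "window k [1,0,5,4,3,2] = window (k + 2) decided"
proof -
  show "window k [1,0,4,5,2,3] = window (k + 2) undecided"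
    by (rule window_shift_eqI[OF assms]) (use assms in
        \<open>auto dest!: eight_cases simp: window_def undecided_def adj_def\<close>)
  show "window k [1,0,5,4,3,2] = window (k + 2) decided"
    by (rule window_shift_eqI[OF assms]) (use assms in
        \<open>auto dest!: eight_cases simp: window_def decided_def adj_def\<close>)
qed

lemma type_window_shift:
  assumes "even k"
  shows "type_window k [True,False,True,True,False,False] = type_window (k + 2) active_types"
proof
  fix p show "type_window k [True,False,True,True,False,False] p = type_window (k + 2) active_types p"
  proof (cases "k \<le> p \<and> p < k + 8")
    case True
    then obtain r where "p = k + r" "r < 8" by (metis add_diff_inverse_nat add_less_cancel_left not_less)
    then show ?thesis using assms
      by (auto dest!: eight_cases simp: type_window_def active_types_def)
  qed (auto simp: type_window_def)
qed

lemma sum_list_filter_vanish: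
  assumes "\<And>x. x \<in> set xs \<Longrightarrow> \<not> P x \<Longrightarrow> f x = (0::'a::comm_monoid_add)"
  shows "sum_list (map f xs) = sum_list (map f (filter P xs))"
  using assms by (induction xs) auto

lemma window_rulings_range:
  assumes "(e, w') \<in> set (window_rulings V w t)" "\<forall>i\<in>set V. i < 5"
    "\<forall>p<6. w ! p < 6 \<and> w ! p \<noteq> p" "length w = 6" "p < 6"
  shows "w' ! p < 6 \<and> w' ! p \<noteq> p"
  using assms
proof (induction V arbitrary: w t e)
  case (Cons i V)
  have *: "\<forall>p<6. map (sw i) (list_sw i w) ! p < 6 \<and> map (sw i) (list_sw i w) ! p \<noteq> p"
  proof (intro allI impI)
    fix p :: nat assume "p < 6"
    then have p: "sw i p < 6" using Cons.prems(2) by (auto intro: sw_less)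
    then have "w ! sw i p < 6" "w ! sw i p \<noteq> sw i p" using Cons.prems(3) by auto
    then show "map (sw i) (list_sw i w) ! p < 6 \<and> map (sw i) (list_sw i w) ! p \<noteq> p"
      using \<open>p < 6\<close> Cons.prems(2) by (auto simp: list_sw_def intro!: sw_less) (metis sw_simps(3))
  qed
  show ?case
    using Cons.prems Cons.IH[OF _ _ *] Cons.IH[OF _ _ Cons.prems(3)]
    by (auto simp: list_sw_def split: if_splits)
qed auto

lemma block_less: "\<forall>i\<in>set (block b). i < 5"
  by (auto simp: block_def slip_block_def weight_block_def)

lemma active_perm:
  "window_perm undecided" "window_perm decided"
  "\<forall>p<6. undecided ! p < 6 \<and> undecided ! p \<noteq> p" "\<forall>p<6. decided ! p < 6 \<and> decided ! p \<noteq> p"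
  by (auto simp: window_perm_def undecided_def decided_def less_Suc_eq numeral_eq_Suc)

lemma ruling_sum_block:
  assumes "even k" "w = undecided \<or> w = decided"
  shows "ruling_sum z (block_word k (b # bs)) (window k w) (type_window k active_types) =
    (\<Sum>(e, w')\<leftarrow>filter (\<lambda>(e, w). w ! 0 = 1) (window_rulings (block b) w active_types).
       z ^ e * ruling_sum z (block_word (k + 2) bs) (window k w') (type_window (k + 2) active_types))"
proof -
  have w: "window_perm w" "\<forall>p<6. w ! p < 6 \<and> w ! p \<noteq> p"
    using assms(2) active_perm by auto
  have ty: "type_window k (fold list_sw (block b) active_types) = type_window (k + 2) active_types"
    using block_types type_window_shift[OF assms(1)] by (simp add: block_def)
  have "ruling_sum z (block_word k (b # bs)) (window k w) (type_window k active_types) =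
    (\<Sum>(e, w')\<leftarrow>window_rulings (block b) w active_types.
       z ^ e * ruling_sum z (block_word (k + 2) bs) (window k w') (type_window (k + 2) active_types))"
    unfolding block_word.simps ruling_sum_window[OF assms(1) w(1) block_less] ty ..
  also have "\<dots> = (\<Sum>(e, w')\<leftarrow>filter (\<lambda>(e, w). w ! 0 = 1) (window_rulings (block b) w active_types).
       z ^ e * ruling_sum z (block_word (k + 2) bs) (window k w') (type_window (k + 2) active_types))"
  proof (rule sum_list_filter_vanish, clarify)
    fix e w' assume e: "(e, w') \<in> set (window_rulings (block b) w active_types)" "w' ! 0 \<noteq> 1"
    have "w' ! 0 \<noteq> 0"
      using window_rulings_range[OF e(1) block_less w(2), of 0] w(1) by (simp add: window_perm_def)
    then have "ruling_sum z (block_word (k + 2) bs) (window k w') (type_window (k + 2) active_types) = 0"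
      using e(2) assms(1) window_at[of 0 k w'] block_word_ge[of _ "k + 2" bs]
      by (intro ruling_sum_dead[where p = k]) (auto simp: Suc_le_eq)
    then show "z ^ e * ruling_sum z (block_word (k + 2) bs) (window k w') (type_window (k + 2) active_types) = 0"
      by simp
  qed
  finally show ?thesis .
qed

lemma window_eq_adj:
  assumes "even k" "length w = 6"
  shows "window k w = adj \<longleftrightarrow> w = [1,0,3,2,5,4]"
proof
  assume eq: "window k w = adj"
  show "w = [1,0,3,2,5,4]"
  proof (rule nth_equalityI)
    fix i assume "i < length w"
    then have i: "i < 6" using assms by simp
    have "k + w ! i = adj (k + i)" using window_at[OF i, of k w] eq by simp
    also have "\<dots> = k + adj i" using assms by (auto simp: adj_def elim!: oddE)
    finally show "w ! i = [1,0,3,2,5,4] ! i"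
      using i by (auto dest!: six_cases simp: adj_def)
  qed (use assms in simp)
next
  assume w: "w = [1,0,3,2,5,4]"
  show "window k w = adj"
  proof
    fix p show "window k w p = adj p"
    proof (cases "k \<le> p \<and> p < k + 6")
      case True
      then obtain r where "p = k + r" "r < 6" by (metis add_diff_inverse_nat add_less_cancel_left not_less)
      then show ?thesis using assms(1) w
        by (auto dest!: six_cases simp: window_def adj_def)
    qed (auto simp: window_def)
  qed
qed

lemma window_rulings_length:
  "(e, w') \<in> set (window_rulings V w t) \<Longrightarrow> length w = 6 \<Longrightarrow> length w' = 6"
  by (induction V arbitrary: e w t) (fastforce simp: list_sw_def split: if_splits)+

lemma ruling_sum_closing:
  assumes "even k" "w = undecided \<or> w = decided"
  shows "ruling_sum z (block_word k []) (window k w) (type_window k active_types) =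
    (\<Sum>(e, w')\<leftarrow>filter (\<lambda>(e, w). w = [1,0,3,2,5,4]) (window_rulings [0,1] w active_types). z ^ e)"
proof -
  have w: "window_perm w" using assms(2) active_perm by auto
  have "ruling_sum z (map ((+) k) [0,1] @ []) (window k w) (type_window k active_types) =
    (\<Sum>(e, w')\<leftarrow>window_rulings [0,1] w active_types.
       z ^ e * ruling_sum z [] (window k w') (type_window k (fold list_sw [0,1] active_types)))"
    by (rule ruling_sum_window[OF assms(1) w]) simp
  also have "\<dots> = (\<Sum>(e, w')\<leftarrow>window_rulings [0,1] w active_types. z ^ e * (if w' = [1,0,3,2,5,4] then 1 else 0))"
    using window_rulings_length[of _ _ "[0,1]" w active_types] w window_eq_adj[OF assms(1)]
    by (intro arg_cong[where f = sum_list] map_cong refl) (force simp: window_perm_def simp del: window_rulings.simps)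
  also have "\<dots> = (\<Sum>(e, w')\<leftarrow>filter (\<lambda>(e, w). w = [1,0,3,2,5,4]) (window_rulings [0,1] w active_types). z ^ e * (if w' = [1,0,3,2,5,4] then 1 else 0))"
    by (rule sum_list_filter_vanish) auto
  also have "\<dots> = (\<Sum>(e, w')\<leftarrow>filter (\<lambda>(e, w). w = [1,0,3,2,5,4]) (window_rulings [0,1] w active_types). z ^ e)"
    by (intro arg_cong[where f = sum_list] map_cong) auto
  finally show ?thesis by simp
qed

lemmas closing_sums =
  ruling_sum_closing[OF _ disjI1[OF refl]] ruling_sum_closing[OF _ disjI2[OF refl]]

lemmas block_sums =
  ruling_sum_block[OF _ disjI1[OF refl]] ruling_sum_block[OF _ disjI2[OF refl]]

text \<open>The generating function of the slip block at which the state becomes decided: it is weighted by \<open>z\<^sup>2\<close>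
  for every weight block (\<open>True\<close>) to its left.\<close>

fun slip_sum :: "'a::comm_ring_1 \<Rightarrow> bool list \<Rightarrow> 'a" where
  "slip_sum z [] = 0"
| "slip_sum z (False # bs) = 1 + slip_sum z bs"
| "slip_sum z (True # bs) = z\<^sup>2 * slip_sum z bs"

lemma ruling_sum_decided:
  "even k \<Longrightarrow> ruling_sum z (block_word k bs) (window k decided) (type_window k active_types) = z ^ length bs"
proof (induction bs arbitrary: k)
  case Nil
  then show ?case by (simp only: closing_sums closing_rulings) simp
next
  case (Cons b bs)
  then have "even (k + 2)" by simp
  note * = block_sums[OF Cons.prems] window_shift[OF Cons.prems] Cons.IH[OF this]
  show ?case
    by (cases b) (simp_all only: * block_def if_True if_False slip_block_rulings weight_block_rulings
        list.map case_prod_conv sum_list.Cons sum_list.Nil, simp_all)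
qed

text \<open>Each block contributes a factor \<open>z\<close>, and slipping one more; the additional factor \<open>z\<^sup>2\<close> of a
  weight block only occurs before the slip.\<close>

lemma ruling_sum_undecided:
  "even k \<Longrightarrow> ruling_sum z (block_word k bs) (window k undecided) (type_window k active_types) =
    z ^ Suc (length bs) * slip_sum z bs"
proof (induction bs arbitrary: k)
  case Nil
  then show ?case by (simp only: closing_sums closing_rulings) simp
next
  case (Cons b bs)
  then have k: "even (k + 2)" by simp
  note * = block_sums[OF Cons.prems] window_shift[OF Cons.prems] Cons.IH[OF k] ruling_sum_decided[OF k]
  show ?case
    by (cases b) (simp_all only: * block_def if_True if_False slip_block_rulings weight_block_rulings
        list.map case_prod_conv sum_list.Cons sum_list.Nil,
        simp_all add: power2_eq_square power3_eq_cube algebra_simps)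
qed

lemma ruling_sum_front_word:
  "ruling_sum z (front_word bs) adj even = z ^ Suc (length bs) * slip_sum z bs"
proof -
  have "sw 1 \<circ> adj \<circ> sw 1 = window 0 undecided"
  proof
    fix p show "(sw 1 \<circ> adj \<circ> sw 1) p = window 0 undecided p"
    proof (cases "p < 6")
      case True
      then show ?thesis by (auto dest!: six_cases simp: window_def sw_def adj_def undecided_def)
    qed (auto simp: window_def sw_def adj_def; presburger)
  qed
  moreover have "even \<circ> sw 1 = type_window 0 active_types"
  proof
    fix p show "(even \<circ> sw 1) p = type_window 0 active_types p"
    proof (cases "p < 6")
      case True
      then show ?thesis by (auto dest!: six_cases simp: type_window_def sw_def active_types_def)
    qed (auto simp: type_window_def sw_def)
  qed
  ultimately show ?thesis
    using ruling_sum_undecided[of 0 z bs] by (simp add: front_word_def adj_def)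
qed

lemma slip_sum_append:
  "slip_sum z (bs @ cs) = slip_sum z bs + z ^ (2 * count_list bs True) * slip_sum z cs"
  by (induction z bs rule: slip_sum.induct) (simp_all add: algebra_simps power2_eq_square)

fun coefficient_blocks :: "(nat \<Rightarrow> nat) \<Rightarrow> nat \<Rightarrow> bool list" where
  "coefficient_blocks a 0 = replicate (a 0) False"
| "coefficient_blocks a (Suc n) = coefficient_blocks a n @ True # replicate (a (Suc n)) False"

lemma slip_sum_replicate: "slip_sum z (replicate n False) = of_nat n"
  by (induction n) auto

lemma slip_sum_coefficient_blocks:
  "slip_sum z (coefficient_blocks a n) = (\<Sum>k\<le>n. of_nat (a k) * z ^ (2 * k))"
proof -
  have c: "count_list (replicate j False) True = 0" for j by (induction j) auto
  have "count_list (coefficient_blocks a n) True = n"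
    by (induction n) (auto simp: c)
  then show ?thesis
    by (induction n) (auto simp: slip_sum_append slip_sum_replicate c algebra_simps power2_eq_square)
qed

section \<open>Strands of a plat front\<close>

text \<open>
  The position after \<open>j\<close> crossings of the ruling path that starts in position \<open>p\<close>, if \<open>S\<close> is the set of
  switches; \<open>untrack\<close> is its inverse for fixed \<open>j\<close>. For \<open>S = {}\<close> one obtains the strands
  themselves: \<open>pos\<close> is the position of a strand and \<open>lab\<close> the strand in a position, where strands
  are numbered by their positions at the left end.
\<close>

fun track :: "nat list \<Rightarrow> nat set \<Rightarrow> nat \<Rightarrow> nat \<Rightarrow> nat" where
  "track W S 0 p = p"
| "track W S (Suc j) p = (if j \<in> S then track W S j p else sw (W ! j) (track W S j p))"

fun untrack :: "nat list \<Rightarrow> nat set \<Rightarrow> nat \<Rightarrow> nat \<Rightarrow> nat" where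
  "untrack W S 0 i = i"
| "untrack W S (Suc j) i = untrack W S j (if j \<in> S then i else sw (W ! j) i)"

lemma untrack_track [simp]: "untrack W S j (track W S j p) = p"
  by (induction j) auto

lemma track_untrack [simp]: "track W S j (untrack W S j i) = i"
  by (induction j arbitrary: i) auto

lemma track_eq_iff [simp]: "track W S j p = track W S j q \<longleftrightarrow> p = q"
  by (metis untrack_track)

abbreviation pos :: "nat list \<Rightarrow> nat \<Rightarrow> nat \<Rightarrow> nat" where "pos W \<equiv> track W {}"
abbreviation lab :: "nat list \<Rightarrow> nat \<Rightarrow> nat \<Rightarrow> nat" where "lab W \<equiv> untrack W {}"

lemma sw_less_iff: "Suc i < n \<Longrightarrow> sw i p < n \<longleftrightarrow> p < n"
  by (auto simp: sw_def)

lemma sw_order: "a < b \<Longrightarrow> sw i a < sw i b \<or> (a = i \<and> b = Suc i)"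
  by (auto simp: sw_def)

text \<open>The last assumption says that a strand ends in a position of the parity in which it starts, so
  that upper branches of left cusps are also upper branches of right cusps. It is this that makes the
  parity a Maslov potential.\<close>

locale plat_front =
  fixes W :: "nat list" and d :: nat
  assumes W_less: "i \<in> set W \<Longrightarrow> Suc i < 2 * d"
    and d_pos: "d > 0"
    and even_final: "p < 2 * d \<Longrightarrow> even (pos W (length W) p) \<longleftrightarrow> even p"
begin

abbreviation "K \<equiv> length W"

definition "half_width = real K / 2 + 1"

lemma half_width_pos: "half_width > 0" by (simp add: half_width_def add_nonneg_pos)

lemma track_less_iff: "j \<le> K \<Longrightarrow> track W S j p < 2 * d \<longleftrightarrow> p < 2 * d"
  by (induction j) (auto simp: sw_less_iff W_less)

lemma untrack_less_iff: "j \<le> K \<Longrightarrow> untrack W S j p < 2 * d \<longleftrightarrow> p < 2 * d"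
  using track_less_iff[of j S "untrack W S j p"] by simp

text \<open>The front lives over \<open>-1 \<le> x \<le> K + 1\<close>. The crossing number \<open>j\<close> takes place between
  \<open>x = j\<close> and \<open>x = j + 1\<close>, with the actual double point over \<open>x = j + 1/2\<close>; outside of \<open>0 \<le> x \<le> K\<close>
  the height is constant.\<close>

definition height :: "nat \<Rightarrow> real \<Rightarrow> real" where
  "height p x = - real p - (\<Sum>j<K. (real (pos W (Suc j) p) - real (pos W j p)) * smooth_step (x - real j))"

definition height' :: "nat \<Rightarrow> real \<Rightarrow> real" where
  "height' p x = - (\<Sum>j<K. (real (pos W (Suc j) p) - real (pos W j p)) * deriv smooth_step (x - real j))"

definition cutoff :: "real \<Rightarrow> real" where
  "cutoff x = smooth_step (2 * x + 1) * smooth_step (2 * (real K - x) + 1)"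

definition cutoff' :: "real \<Rightarrow> real" where
  "cutoff' x = 2 * deriv smooth_step (2 * x + 1) * smooth_step (2 * (real K - x) + 1)
             - 2 * smooth_step (2 * x + 1) * deriv smooth_step (2 * (real K - x) + 1)"

definition side :: "nat \<Rightarrow> real" where "side p = (if even p then 1 else - 1)"

text \<open>With \<open>x = K / 2 - half_width * cos \<theta>\<close>, these are \<open>cos \<theta>\<close> and \<open>sin \<theta>\<close> for \<open>0 \<le> \<theta> \<le> pi\<close>.\<close>

definition cosine :: "real \<Rightarrow> real" where "cosine x = (real K / 2 - x) / half_width"

definition sine :: "real \<Rightarrow> real" where "sine x = sqrt (1 - (cosine x)\<^sup>2)"

text \<open>Height and slope of strand \<open>p\<close> as functions of \<open>x\<close> and \<open>w = sin \<theta>\<close>. For \<open>0 \<le> x \<le> K\<close> the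
  cutoff is 1 and only \<open>height\<close> remains. Near the ends the cutoff is 0, and the value is a
  constant plus \<open>w ^ 3 / 2\<close>, where the two strands of a cusp differ only in the sign of \<open>w\<close>:
  a semicubical cusp. The slope \<open>yval\<close> is the derivative of the height along the curve, with \<open>dw / dx\<close> computed
  from \<open>w\<^sup>2 + cos \<theta>\<^sup>2 = 1\<close>; the division by \<open>w\<close> cancels because of the cube.\<close>

definition zval :: "nat \<Rightarrow> real \<Rightarrow> real \<Rightarrow> real" where
  "zval p x w = height p x - (1 - cutoff x) / 2 * (side p - w ^ 3)"

definition yval :: "nat \<Rightarrow> real \<Rightarrow> real \<Rightarrow> real" where
  "yval p x w = height' p x + cutoff' x / 2 * (side p - w ^ 3)
     + 3 / (2 * half_width) * (1 - cutoff x) * w * cosine x"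

definition Z :: "nat \<Rightarrow> real \<Rightarrow> real" where "Z p x = zval p x (side p * sine x)"
definition Y :: "nat \<Rightarrow> real \<Rightarrow> real" where "Y p x = yval p x (side p * sine x)"
definition strand_point :: "nat \<Rightarrow> real \<Rightarrow> real \<times> real \<times> real" where
  "strand_point p x = (x, Y p x, Z p x)"

lemma side_simps [simp]: "side p * side p = 1" "side p ^ 3 = side p" "\<bar>side p\<bar> = 1"
  by (auto simp: side_def)

lemma deriv_smooth_step_0: "t < 0 \<or> t > 1 \<Longrightarrow> deriv smooth_step t = 0"
proof (elim disjE)
  assume "t < 0"
  then have "\<forall>\<^sub>F s in nhds t. smooth_step s = 0"
    using eventually_nhds_in_open[of "{..<0}" t] by (auto elim!: eventually_mono intro: smooth_step_0)
  then show ?thesis using deriv_cong_ev[of smooth_step "\<lambda>_. 0" t t] by simp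
next
  assume "t > 1"
  then have "\<forall>\<^sub>F s in nhds t. smooth_step s = 1"
    using eventually_nhds_in_open[of "{1<..}" t] by (auto elim!: eventually_mono intro: smooth_step_1)
  then show ?thesis using deriv_cong_ev[of smooth_step "\<lambda>_. 1" t t] by simp
qed

lemma height_level:
  assumes "j \<le> K" "real j \<le> x \<or> j = 0" "x \<le> real j + 1 \<or> j = K"
  shows "height p x = - real (pos W j p)
    - (if j < K then (real (pos W (Suc j) p) - real (pos W j p)) * smooth_step (x - real j) else 0)"
proof -
  let ?f = "\<lambda>i. (real (pos W (Suc i) p) - real (pos W i p)) * smooth_step (x - real i)"
  have "(\<Sum>i<j. ?f i) = (\<Sum>i<j. real (pos W (Suc i) p) - real (pos W i p))"
    using assms(2) by (intro sum.cong) (auto simp: smooth_step_1)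
  also have "\<dots> = real (pos W j p) - real p"
    using sum_lessThan_telescope[of "\<lambda>i. real (pos W i p)" j] by simp
  finally have 1: "(\<Sum>i<j. ?f i) = real (pos W j p) - real p" .
  have 2: "(\<Sum>i\<in>{j..<K}. ?f i) = (if j < K then ?f j else 0)"
  proof (cases "j < K")
    case True
    then have "(\<Sum>i\<in>{j..<K}. ?f i) = ?f j + (\<Sum>i\<in>{Suc j..<K}. ?f i)"
      by (simp add: sum.atLeast_Suc_lessThan)
    also have "(\<Sum>i\<in>{Suc j..<K}. ?f i) = 0"
      using assms(3) True by (intro sum.neutral) (auto simp: smooth_step_0)
    finally show ?thesis using True by simp
  qed simp
  have "(\<Sum>i<K. ?f i) = (\<Sum>i<j. ?f i) + (\<Sum>i\<in>{j..<K}. ?f i)"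
    using assms(1) by (simp add: sum.atLeastLessThan_concat lessThan_atLeast0)
  then show ?thesis unfolding height_def 1 2 by simp
qed

lemma height_left: "x \<le> 0 \<Longrightarrow> height p x = - real p"
  using height_level[of 0 x p] by (simp add: smooth_step_0)

lemma height_right: "x \<ge> real K \<Longrightarrow> height p x = - real (pos W K p)"
  using height_level[of K x p] by simp

lemma height'_outside: "x < 0 \<or> x > real K \<Longrightarrow> height' p x = 0"
  unfolding height'_def by (subst sum.neutral) (auto simp: deriv_smooth_step_0)

lemma cutoff_1: "0 \<le> x \<Longrightarrow> x \<le> real K \<Longrightarrow> cutoff x = 1"
  by (simp add: cutoff_def smooth_step_1)

lemma cutoff_0: "x \<le> - (1/2) \<or> x \<ge> real K + 1/2 \<Longrightarrow> cutoff x = 0"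
  by (auto simp: cutoff_def smooth_step_0)

lemma cutoff_nonneg: "cutoff x \<ge> 0" and cutoff_le_1: "cutoff x \<le> 1"
  by (auto simp: cutoff_def smooth_step_nonneg smooth_step_le_1 mult_le_one)

lemma cutoff'_0: "x < - (1/2) \<or> x > real K + 1/2 \<or> 0 < x \<and> x < real K \<Longrightarrow> cutoff' x = 0"
  unfolding cutoff'_def by (auto simp: smooth_step_0 deriv_smooth_step_0)

lemma cosine_bounds: "-1 \<le> x \<Longrightarrow> x \<le> real K + 1 \<Longrightarrow> \<bar>cosine x\<bar> \<le> 1"
  using half_width_pos by (auto simp: cosine_def half_width_def abs_le_iff field_simps)

lemma cosine_strict: "-1 < x \<Longrightarrow> x < real K + 1 \<Longrightarrow> \<bar>cosine x\<bar> < 1"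
  using half_width_pos by (auto simp: cosine_def half_width_def abs_less_iff field_simps)

lemma cosine_ends: "cosine (-1) = 1" "cosine (real K + 1) = -1"
  using half_width_pos by (auto simp: cosine_def half_width_def field_simps)

lemma sine_nonneg: "-1 \<le> x \<Longrightarrow> x \<le> real K + 1 \<Longrightarrow> sine x \<ge> 0"
  using cosine_bounds[of x] by (simp add: sine_def abs_square_le_1)

lemma sine_pos: "-1 < x \<Longrightarrow> x < real K + 1 \<Longrightarrow> sine x > 0"
  using cosine_strict[of x] by (simp add: sine_def abs_square_less_1)

lemma sine_le_1: "-1 \<le> x \<Longrightarrow> x \<le> real K + 1 \<Longrightarrow> sine x \<le> 1"
  by (simp add: sine_def)

lemma sine_ends [simp]: "sine (-1) = 0" "sine (real K + 1) = 0"
  by (simp_all add: sine_def cosine_ends)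

text \<open>The amount by which both strands of a pair are moved towards each other near the ends. As it stays below
  1/2 in the interior, strands meet only at the ends, where it equals 1/2.\<close>

definition pinch :: "real \<Rightarrow> real" where "pinch x = (1 - cutoff x) / 2 * (1 - sine x ^ 3)"

lemma Z_pinch: "Z p x = height p x - side p * pinch x"
  by (cases "even p") (simp_all add: Z_def zval_def pinch_def side_def algebra_simps)

lemma pinch_0: "0 \<le> x \<Longrightarrow> x \<le> real K \<Longrightarrow> pinch x = 0"
  by (simp add: pinch_def cutoff_1)

lemma pinch_ends: "pinch (-1) = 1/2" "pinch (real K + 1) = 1/2"
  by (simp_all add: pinch_def cutoff_0)

lemma pinch_bounds:
  assumes "-1 \<le> x" "x \<le> real K + 1"
  shows "0 \<le> pinch x" "pinch x \<le> 1/2"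
proof -
  have *: "0 \<le> sine x ^ 3" "sine x ^ 3 \<le> 1"
    using sine_nonneg[OF assms] sine_le_1[OF assms] by (auto simp: power_le_one)
  then show "0 \<le> pinch x"
    unfolding pinch_def using cutoff_le_1[of x] by (intro mult_nonneg_nonneg) auto
  have "(1 - cutoff x) * (1 - sine x ^ 3) \<le> 1"
    using * cutoff_nonneg[of x] cutoff_le_1[of x] by (intro mult_le_one) auto
  then show "pinch x \<le> 1/2" by (simp add: pinch_def)
qed

lemma pinch_less:
  assumes "-1 < x" "x < real K + 1"
  shows "pinch x < 1/2"
proof -
  have "0 < sine x ^ 3" "sine x ^ 3 \<le> 1"
    using sine_pos[OF assms] sine_le_1[of x] assms by (auto simp: power_le_one)
  then have "(1 - cutoff x) * (1 - sine x ^ 3) \<le> 1 * (1 - sine x ^ 3)"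
    using cutoff_nonneg[of x] by (intro mult_right_mono) auto
  also have "\<dots> < 1" using \<open>0 < sine x ^ 3\<close> by simp
  finally show ?thesis by (simp add: pinch_def)
qed

text \<open>Between the vertical lines through \<open>lo j\<close> and \<open>hi j\<close>, which pass through neighbouring crossings or
  the cusps, the order of the strands is that of their positions after \<open>j\<close> crossings.\<close>

definition lo :: "nat \<Rightarrow> real" where "lo j = (if j = 0 then -1 else real j - 1/2)"
definition hi :: "nat \<Rightarrow> real" where "hi j = (if j = K then real K + 1 else real j + 1/2)"

text \<open>During a crossing, heights are convex combinations of the positions before and after it. Only the two strands
  that cross can lose their order, and not before the midpoint.\<close>

lemma convex_order:
  fixes t :: real
  assumes "a < b" "0 \<le> t" "t \<le> 1" "t < 1/2 \<or> \<not> (a = i \<and> b = Suc i)"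
  shows "(1 - t) * real a + t * real (sw i a) < (1 - t) * real b + t * real (sw i b)"
proof (cases "a = i \<and> b = Suc i")
  case True
  then show ?thesis using assms by (simp add: algebra_simps)
next
  case False
  then have "real (sw i a) + 1 \<le> real (sw i b)" "real a + 1 \<le> real b"
    using sw_order[OF assms(1), of i] assms(1) by linarith+
  then have "(1 - t) * (real a + 1) + t * (real (sw i a) + 1) \<le> (1 - t) * real b + t * real (sw i b)"
    using assms by (intro add_mono mult_left_mono) auto
  then show ?thesis by (simp add: algebra_simps)
qed

text \<open>Left of 0 and right of \<open>K\<close> the positions are integers apart and the pinch is less than 1/2. In between
  either the crossing \<open>j\<close> has begun but not reached its midpoint, or the crossing \<open>j - 1\<close>
  is past its midpoint; the second case is the first one with time reversed.\<close>

lemma Z_order: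
  assumes j: "j \<le> K" and x: "lo j < x" "x < hi j" and p: "p < 2 * d" "q < 2 * d" and less: "pos W j p < pos W j q"
  shows "Z q x < Z p x"
proof -
  have side_order: "- real q - side q * c < - real p - side p * c"
    if "p < q" "0 \<le> c" "c < 1/2" for p q :: nat and c :: real
  proof -
    have "real p + 1 \<le> real q" using that by linarith
    then show ?thesis using that by (auto simp: side_def)
  qed
  consider "x < 0" | "x > real K" | "0 \<le> x" "x \<le> real K" by linarith
  then show ?thesis
  proof cases
    case 1
    then have "j = 0" using x by (auto simp: lo_def split: if_splits)
    then show ?thesis
      using 1 x less pinch_bounds[of x] pinch_less[of x] side_order[of p q "pinch x"]
      by (simp add: Z_pinch height_left lo_def)
  next
    case 2
    then have "j = K" using x j by (auto simp: hi_def split: if_splits)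
    moreover have "side (pos W K p) = side p" "side (pos W K q) = side q"
      using even_final p by (simp_all add: side_def)
    ultimately show ?thesis
      using 2 x less pinch_bounds[of x] pinch_less[of x] side_order[of "pos W K p" "pos W K q" "pinch x"]
      by (simp add: Z_pinch height_right hi_def)
  next
    case 3
    then have Z: "Z r x = height r x" for r by (simp add: Z_pinch pinch_0)
    show ?thesis
    proof (cases "real j \<le> x")
      case True
      show ?thesis
      proof (cases "j = K")
        case True
        then show ?thesis using 3 less \<open>real j \<le> x\<close> by (simp add: Z height_right)
      next
        case False
        then have jK: "j < K" using j by simp
        have "smooth_step (x - real j) < 1/2"
          using x False by (intro smooth_step_less_half) (auto simp: hi_def)
        then show ?thesis
          using convex_order[OF less smooth_step_nonneg smooth_step_le_1, of "x - real j" "W ! j"]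
            height_level[of j x p] height_level[of j x q] True x jK
          by (simp add: Z hi_def algebra_simps)
      qed
    next
      case False
      then obtain i where i: "j = Suc i" using x 3 by (cases j) auto
      then have jK: "i < K" using j by simp
      have x': "real i \<le> x" "x \<le> real i + 1" "x - real i > 1/2" using False x i by (auto simp: lo_def)
      have t: "smooth_step (x - real i) > 1/2" using smooth_step_greater_half x'(3) by blast
      have "(1 - (1 - smooth_step (x - real i))) * real (pos W j p) + (1 - smooth_step (x - real i)) * real (sw (W ! i) (pos W j p))
        < (1 - (1 - smooth_step (x - real i))) * real (pos W j q) + (1 - smooth_step (x - real i)) * real (sw (W ! i) (pos W j q))"
        using t smooth_step_le_1[of "x - real i"] by (intro convex_order less) auto
      then show ?thesis
        using height_level[of i x p] height_level[of i x q] x' jK i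
        by (simp add: Z algebra_simps)
    qed
  qed
qed

lemma Z_crossing:
  assumes "j < K"
  shows "Z p (real j + 1/2) = - (real (pos W j p) + real (pos W (Suc j) p)) / 2"
proof -
  have "height p (real j + 1/2) =
      - real (pos W j p) - (real (pos W (Suc j) p) - real (pos W j p)) * (1/2)"
    using height_level[of j "real j + 1/2" p] assms smooth_step_half by (simp del: track.simps)
  moreover have "pinch (real j + 1/2) = 0" using assms by (intro pinch_0) linarith+
  ultimately show ?thesis unfolding Z_pinch by (simp add: field_simps del: track.simps)
qed

lemma Z_crossing_order:
  assumes "j < K" "pos W j p < pos W j q" "\<not> (pos W j p = W ! j \<and> pos W j q = Suc (W ! j))"
  shows "Z q (real j + 1/2) < Z p (real j + 1/2)"
  using convex_order[of "pos W j p" "pos W j q" "1/2" "W ! j"] assms(2,3)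
  unfolding Z_crossing[OF assms(1)] by (simp add: field_simps)

lemma Z_crossing_eq:
  assumes "j < K" "pos W j p = W ! j" "pos W j q = Suc (W ! j)"
  shows "Z q (real j + 1/2) = Z p (real j + 1/2)"
  using assms by (simp add: Z_crossing)

lemma Z_left_end: "Z p (-1) = - real p - side p / 2"
  by (simp add: Z_pinch pinch_ends height_left)

lemma Z_right_end: "Z p (real K + 1) = - real (pos W K p) - side p / 2"
  by (simp add: Z_pinch pinch_ends height_right)

lemma cusp_value_eq_iff: "real p + side p / 2 = real q + side q / 2 \<longleftrightarrow> q = p \<or> q = adj p"
proof -
  have "real p + side p / 2 = real q + side q / 2 \<longleftrightarrow>
    2 * int p + (if even p then 1 else -1) = 2 * int q + (if even q then 1 else -1)"
    by (auto simp: side_def field_simps)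
  also have "\<dots> \<longleftrightarrow> q = p \<or> q = adj p" by (auto simp: adj_def; presburger)
  finally show ?thesis .
qed

lemma Z_left_end_eq_iff: "Z p (-1) = Z q (-1) \<longleftrightarrow> q = p \<or> q = adj p"
  using cusp_value_eq_iff[of p q] by (auto simp: Z_left_end)

lemma Z_right_end_eq_iff:
  assumes "p < 2 * d" "q < 2 * d"
  shows "Z p (real K + 1) = Z q (real K + 1) \<longleftrightarrow> q = p \<or> pos W K q = adj (pos W K p)"
proof -
  have "side (pos W K p) = side p" "side (pos W K q) = side q"
    using even_final assms by (simp_all add: side_def)
  then show ?thesis
    using cusp_value_eq_iff[of "pos W K p" "pos W K q"] by (auto simp: Z_right_end)
qed

lemma Y_crossing:
  assumes "j < K"
  shows "Y p (real j + 1/2) = (real (pos W j p) - real (pos W (Suc j) p)) * deriv smooth_step (1/2)"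
proof -
  have "(\<Sum>i<K. (real (pos W (Suc i) p) - real (pos W i p)) * deriv smooth_step (real j + 1/2 - real i))
      = (\<Sum>i\<in>{j}. (real (pos W (Suc i) p) - real (pos W i p)) * deriv smooth_step (real j + 1/2 - real i))"
  proof (rule sum.mono_neutral_right)
    show "\<forall>i\<in>{..<K} - {j}. (real (pos W (Suc i) p) - real (pos W i p)) * deriv smooth_step (real j + 1/2 - real i) = 0"
    proof
      fix i assume "i \<in> {..<K} - {j}"
      then have "real i + 1 \<le> real j \<or> real j + 1 \<le> real i" by (simp, linarith)
      then have "deriv smooth_step (real j + 1/2 - real i) = 0" by (intro deriv_smooth_step_0) auto
      then show "(real (pos W (Suc i) p) - real (pos W i p)) * deriv smooth_step (real j + 1/2 - real i) = 0" by simp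
    qed
  qed (use assms in auto)
  then show ?thesis
    using assms by (simp add: Y_def yval_def height'_def cutoff_1 cutoff'_0 algebra_simps del: track.simps)
qed

lemma deriv_smooth_step_half: "deriv smooth_step (1/2) > 0"
  using smooth_step_derivative_half DERIV_imp_deriv by metis

lemma Y_crossing_neq:
  assumes "j < K" "pos W j p = W ! j" "pos W j q = Suc (W ! j)"
  shows "Y p (real j + 1/2) \<noteq> Y q (real j + 1/2)"
  using assms deriv_smooth_step_half by (simp add: Y_crossing algebra_simps)

text \<open>The number of crossings to the left of \<open>x\<close>, including the one at \<open>x\<close>.\<close>

definition level :: "real \<Rightarrow> nat" where
  "level x = min K (nat \<lfloor>x + 1/2\<rfloor>)"

lemma level_cases:
  assumes "-1 \<le> x" "x \<le> real K + 1"
  obtains "x = -1" | "x = real K + 1" | j where "j \<le> K" "lo j < x" "x < hi j"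
    | j where "j < K" "x = real j + 1/2"
proof -
  consider "x = -1" | "x = real K + 1" | "-1 < x" "x < 1/2" | "1/2 \<le> x" "x < real K + 1/2" | "real K + 1/2 \<le> x" "x < real K + 1"
    using assms by linarith
  then show thesis
  proof cases
    case 3
    show ?thesis
      using 3 that(3)[of 0] by (auto simp: lo_def hi_def)
  next
    case 4
    define j where "j = nat \<lfloor>x + 1/2\<rfloor>"
    have j: "real j \<le> x + 1/2" "x + 1/2 < real j + 1" "j \<ge> 1" using 4 by (auto simp: j_def; linarith)+
    have "j \<le> K" using j 4 by linarith
    show ?thesis
    proof (cases "x = real j - 1/2")
      case True
      then show ?thesis using that(4)[of "j - 1"] j \<open>j \<le> K\<close> by (auto simp: of_nat_diff)
    next
      case False
      then show ?thesis using that(3)[of j] j \<open>j \<le> K\<close> 4 by (auto simp: lo_def hi_def)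
    qed
  next
    case 5
    then show ?thesis
      using that(3)[of K] that(4)[of "K - 1"] by (cases "x = real K + 1/2") (auto simp: lo_def hi_def)
  qed (use that in auto)
qed

lemma strand_point_eq:
  assumes x: "-1 \<le> x" "x \<le> real K + 1" and p: "p < 2 * d" "q < 2 * d" and eq: "strand_point p x = strand_point q x"
  shows "q = p \<or> x = -1 \<and> q = adj p \<or> x = real K + 1 \<and> pos W K q = adj (pos W K p)"
proof -
  have Z: "Z p x = Z q x" and Y: "Y p x = Y q x" using eq by (auto simp: strand_point_def)
  show ?thesis
    using x
  proof (cases rule: level_cases)
    case 1
    then show ?thesis using Z Z_left_end_eq_iff by simp
  next
    case 2
    then show ?thesis using Z Z_right_end_eq_iff[OF p] by simp
  next
    case (3 j)
    then show ?thesis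
      using Z_order[of j x p q] Z_order[of j x q p] Z p track_eq_iff[of W "{}" j p q]
      by (metis less_irrefl linorder_neqE_nat)
  next
    case (4 j)
    show ?thesis
    proof (rule ccontr)
      assume "\<not> ?thesis"
      then have "p \<noteq> q" by auto
      then consider "pos W j p < pos W j q" | "pos W j q < pos W j p"
        using track_eq_iff[of W "{}" j p q] by linarith
      then show False
        using Z_crossing_order[of j p q] Z_crossing_order[of j q p] Y_crossing_neq[of j p q] Y_crossing_neq[of j q p]
          Z Y 4 by cases auto
    qed
  qed
qed

end

section \<open>The Legendrian knot\<close>

text \<open>The cyclic order in which the knot runs through the strands. Even entries run from left to right and are strands
  of type U, odd entries run back along strands of type L. An even entry and its successor share a
  right cusp, an odd entry and its successor share a left cusp.\<close>

locale plat_knot = plat_front +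
  fixes e :: "nat \<Rightarrow> nat"
  assumes e_bij: "bij_betw e {..<2 * d} {..<2 * d}"
    and e_parity: "k < 2 * d \<Longrightarrow> even (e k) \<longleftrightarrow> even k"
    and e_right: "k < 2 * d \<Longrightarrow> even k \<Longrightarrow> pos W K (e (Suc k)) = Suc (pos W K (e k))"
    and e_left: "k < 2 * d \<Longrightarrow> odd k \<Longrightarrow> e k = Suc (e (Suc k mod (2 * d)))"
begin

text \<open>At time \<open>s\<close>, the knot is on the strand number \<open>\<lfloor>s\<rfloor>\<close> of the cycle; integer times are cusps, at the
  left end for even and at the right end for odd integers. The identity
  \<open>side p * sine x = sin (pi * s)\<close> (\<open>side_sine\<close>) turns the two branches at a cusp into one smooth chart.\<close>

definition arc :: "real \<Rightarrow> nat" where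
  "arc s = e (nat (\<lfloor>s\<rfloor> mod int (2 * d)))"

definition xcoord :: "real \<Rightarrow> real" where
  "xcoord s = real K / 2 - half_width * cos (pi * s)"

definition chart :: "nat \<Rightarrow> real \<Rightarrow> real \<times> real \<times> real" where
  "chart p s = (xcoord s, yval p (xcoord s) (sin (pi * s)), zval p (xcoord s) (sin (pi * s)))"

definition lifted :: "real \<Rightarrow> real \<times> real \<times> real" where
  "lifted s = strand_point (arc s) (xcoord s)"

definition knot :: "real \<Rightarrow> real \<times> real \<times> real" where
  "knot t = lifted (real (2 * d) * t)"

lemma arc_less: "arc s < 2 * d"
proof -
  have "nat (\<lfloor>s\<rfloor> mod int (2 * d)) < 2 * d" using d_pos by (simp add: nat_less_iff)
  then show ?thesis using e_bij by (auto simp: arc_def bij_betw_def)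
qed

lemma even_arc: "even (arc s) \<longleftrightarrow> even \<lfloor>s\<rfloor>"
proof -
  have "nat (\<lfloor>s\<rfloor> mod int (2 * d)) < 2 * d" using d_pos by (simp add: nat_less_iff)
  then have "even (arc s) \<longleftrightarrow> even (nat (\<lfloor>s\<rfloor> mod int (2 * d)))"
    unfolding arc_def by (rule e_parity)
  also have "\<dots> \<longleftrightarrow> even (\<lfloor>s\<rfloor> mod int (2 * d))" using d_pos by (simp add: even_nat_iff)
  also have "\<dots> \<longleftrightarrow> even \<lfloor>s\<rfloor>" by (simp add: dvd_mod_iff)
  finally show ?thesis .
qed

lemma xcoord_bounds: "-1 \<le> xcoord s" "xcoord s \<le> real K + 1"
proof -
  have "\<bar>half_width * cos (pi * s)\<bar> \<le> half_width"
    using half_width_pos by (simp add: abs_mult)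
  moreover have "half_width = real K / 2 + 1" by (rule half_width_def)
  ultimately show "-1 \<le> xcoord s" "xcoord s \<le> real K + 1"
    unfolding xcoord_def abs_le_iff by linarith+
qed

lemma cosine_xcoord: "cosine (xcoord s) = cos (pi * s)"
  using half_width_pos by (simp add: cosine_def xcoord_def)

lemma sine_xcoord: "sine (xcoord s) = \<bar>sin (pi * s)\<bar>"
  by (simp add: sine_def cosine_xcoord sin_squared_eq[symmetric] cos_squared_eq)

lemma sin_pi_floor: "sin (pi * s) = (if even \<lfloor>s\<rfloor> then 1 else -1) * sin (pi * frac s)"
proof -
  have "pi * s = pi * frac s + of_int \<lfloor>s\<rfloor> * pi" by (simp add: frac_def algebra_simps)
  then have "sin (pi * s) = sin (pi * frac s) * cos (of_int \<lfloor>s\<rfloor> * pi) + cos (pi * frac s) * sin (of_int \<lfloor>s\<rfloor> * pi)"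
    by (metis sin_add)
  then show ?thesis by (simp add: mult.commute[of _ pi] cos_npi_int sin_npi_int)
qed

lemma side_sine: "side (arc s) * sine (xcoord s) = sin (pi * s)"
proof -
  have "0 \<le> sin (pi * frac s)"
    by (rule sin_ge_zero) (auto simp: frac_ge_0 frac_lt_1 less_imp_le mult_left_le)
  then show ?thesis
    unfolding sine_xcoord side_def even_arc using sin_pi_floor[of s] by auto
qed

lemma lifted_chart: "lifted s = chart (arc s) s"
  by (simp add: lifted_def chart_def strand_point_def Y_def Z_def side_sine)

lemma chart_left:
  assumes "xcoord s < - (1/2)"
  shows "chart p s = (xcoord s, 3 / (2 * half_width) * sin (pi * s) * cos (pi * s),
    - real p - side p / 2 + sin (pi * s) ^ 3 / 2)"
  using assms
  by (simp add: chart_def yval_def zval_def height'_outside cutoff'_0 cutoff_0 height_left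
      cosine_xcoord field_simps)

lemma chart_right:
  assumes "xcoord s > real K + 1/2"
  shows "chart p s = (xcoord s, 3 / (2 * half_width) * sin (pi * s) * cos (pi * s),
    - real (pos W K p) - side p / 2 + sin (pi * s) ^ 3 / 2)"
  using assms
  by (simp add: chart_def yval_def zval_def height'_outside cutoff'_0 cutoff_0 height_right
      cosine_xcoord field_simps)

text \<open>The strands \<open>q\<close> and \<open>p\<close> before and after the integer time \<open>k\<close>.\<close>

lemma cusp_partner:
  fixes k :: int
  defines "p \<equiv> e (nat (k mod int (2 * d)))" and "q \<equiv> e (nat ((k - 1) mod int (2 * d)))"
  shows "even k \<Longrightarrow> q = Suc p" "odd k \<Longrightarrow> pos W K p = Suc (pos W K q)"
    and "even p \<longleftrightarrow> even k" "even q \<longleftrightarrow> odd k"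
proof -
  define i where "i = nat ((k - 1) mod int (2 * d))"
  have i: "i < 2 * d" "int i = (k - 1) mod int (2 * d)"
    using d_pos by (auto simp: i_def nat_less_iff)
  have k: "nat (k mod int (2 * d)) = Suc i mod (2 * d)"
  proof -
    have "int (Suc i mod (2 * d)) = (int i + 1) mod int (2 * d)" by (simp add: zmod_int add.commute)
    also have "\<dots> = k mod int (2 * d)" unfolding i(2) by (simp add: mod_add_left_eq)
    finally show ?thesis by simp
  qed
  have "even i \<longleftrightarrow> even (int i)" by simp
  also have "\<dots> \<longleftrightarrow> odd k" unfolding i(2) by (simp add: dvd_mod_iff)
  finally have ev: "even i \<longleftrightarrow> odd k" .
  have j: "Suc i mod (2 * d) < 2 * d" using d_pos by simp
  show "even k \<Longrightarrow> q = Suc p"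
    using e_left[OF i(1)] ev unfolding p_def q_def k i_def[symmetric] by simp
  show "odd k \<Longrightarrow> pos W K p = Suc (pos W K q)"
  proof -
    assume "odd k"
    then have "even i" using ev by simp
    then have "Suc i < 2 * d" using i(1) by presburger
    then show ?thesis
      using e_right[OF i(1) \<open>even i\<close>] unfolding p_def q_def k i_def[symmetric] by simp
  qed
  have "even (Suc i mod (2 * d)) \<longleftrightarrow> odd i" by (simp add: dvd_mod_iff)
  then show "even p \<longleftrightarrow> even k" using e_parity[OF j] ev unfolding p_def k by simp
  show "even q \<longleftrightarrow> odd k" using e_parity[OF i(1)] ev unfolding q_def i_def[symmetric] by simp
qed

lemma continuous_xcoord: "continuous (at s) xcoord"
  unfolding xcoord_def by (intro continuous_intros)

lemma xcoord_int: "xcoord (of_int k) = (if even k then - 1 else real K + 1)"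
  using half_width_pos by (simp add: xcoord_def cos_npi_int mult.commute[of _ pi] half_width_def)

text \<open>The charts of the two strands that meet at a cusp coincide near the cusp, since there the height is
  \<open>- p - side p / 2\<close> up to \<open>sin (pi * s) ^ 3 / 2\<close>, and the two constants agree. Hence one chart
  describes the knot on both sides of an integer time.\<close>

lemma lifted_eventually_chart: "\<forall>\<^sub>F r in nhds s. lifted r = chart (arc s) r"
proof (cases "s \<in> \<int>")
  case False
  then have "of_int \<lfloor>s\<rfloor> \<noteq> s" by (metis Ints_of_int)
  then have "of_int \<lfloor>s\<rfloor> < s" "s < of_int \<lfloor>s\<rfloor> + 1"
    by linarith+
  then have "\<forall>\<^sub>F r in nhds s. r \<in> {of_int \<lfloor>s\<rfloor><..<of_int \<lfloor>s\<rfloor> + 1}"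
    by (intro eventually_nhds_in_open) auto
  then show ?thesis
  proof eventually_elim
    case (elim r)
    then have "\<lfloor>r\<rfloor> = \<lfloor>s\<rfloor>" by (auto simp: floor_unique)
    then show ?case by (simp add: lifted_chart arc_def)
  qed
next
  case True
  then obtain k where k: "s = of_int k" by (auto elim: Ints_cases)
  have "\<forall>\<^sub>F r in nhds s. r \<in> {of_int k - 1<..<of_int k + 1}"
    by (intro eventually_nhds_in_open) (auto simp: k)
  moreover have "\<forall>\<^sub>F r in nhds s. if even k then xcoord r < - (1/2) else xcoord r > real K + 1/2"
  proof -
    have t: "(xcoord \<longlongrightarrow> xcoord s) (nhds s)"
      using continuous_xcoord[of s] by (simp add: continuous_at tendsto_at_iff_tendsto_nhds)
    show ?thesis
      using order_tendstoD(2)[OF t, of "- (1/2)"] order_tendstoD(1)[OF t, of "real K + 1/2"]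
      by (cases "even k") (simp_all add: k xcoord_int)
  qed
  ultimately show ?thesis
  proof eventually_elim
    case (elim r)
    show ?case
    proof (cases "r \<ge> of_int k")
      case True
      then have "\<lfloor>r\<rfloor> = k" using elim by (auto simp: floor_unique)
      then show ?thesis by (simp add: lifted_chart k arc_def)
    next
      case False
      then have "\<lfloor>r\<rfloor> = k - 1" using elim by (auto simp: floor_unique)
      then show ?thesis
        using cusp_partner[of k] elim(2)
        by (cases "even k") (simp_all add: lifted_chart k arc_def chart_left chart_right side_def)
    qed
  qed
qed

lemma xcoord_deriv: "(xcoord has_real_derivative half_width * pi * sin (pi * s)) (at s)"
  unfolding xcoord_def by (auto intro!: derivative_eq_intros)

lemma height_deriv: "(height p has_real_derivative height' p x) (at x)"
  unfolding height_def[abs_def] height'_def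
  by (rule derivative_eq_intros DERIV_chain2[OF smooth_step_deriv] refl | simp add: mult.commute)+

lemma cutoff_deriv: "(cutoff has_real_derivative cutoff' x) (at x)"
  unfolding cutoff_def[abs_def] cutoff'_def
  by (rule derivative_eq_intros DERIV_chain2[OF smooth_step_deriv] refl | simp)+

lemma legendrian_chart:
  "((\<lambda>s. zval p (xcoord s) (sin (pi * s))) has_real_derivative
     yval p (xcoord s) (sin (pi * s)) * (half_width * pi * sin (pi * s))) (at s)"
  unfolding zval_def yval_def
  using half_width_pos
  by (auto intro!: derivative_eq_intros DERIV_chain2[OF height_deriv] DERIV_chain2[OF cutoff_deriv] xcoord_deriv
      simp: cosine_xcoord field_simps power2_eq_square power3_eq_cube)

lemma smooth_height: "smooth_curve (height p)" and smooth_height': "smooth_curve (height' p)"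
  and smooth_cutoff: "smooth_curve cutoff" and smooth_cutoff': "smooth_curve cutoff'"
  unfolding height_def[abs_def] height'_def[abs_def] cutoff_def[abs_def] cutoff'_def[abs_def]
  by (intro smooth_intros smooth_compose[OF smooth_smooth_step] smooth_compose[OF smooth_deriv_smooth_step])+

lemma eventually_knot_chart:
  "\<forall>\<^sub>F r in nhds t. knot r = chart (arc (real (2 * d) * t)) (real (2 * d) * r)"
proof -
  have "filterlim (\<lambda>t. real (2 * d) * t) (nhds (real (2 * d) * t)) (nhds t)"
    by (intro tendsto_intros) (rule filterlim_ident)
  then show ?thesis
    unfolding knot_def using lifted_eventually_chart[of "real (2 * d) * t"]
    by (rule eventually_compose_filterlim[rotated])
qed

lemma smooth_knot: "smooth_curve knot"
proof (rule smooth_curve_local)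
  fix t
  have "smooth_curve (\<lambda>r. chart (arc (real (2 * d) * t)) (real (2 * d) * r))"
    unfolding chart_def xcoord_def zval_def yval_def cosine_def divide_inverse
    by (intro smooth_Pair smooth_intros smooth_compose[OF smooth_height] smooth_compose[OF smooth_height']
        smooth_compose[OF smooth_cutoff] smooth_compose[OF smooth_cutoff'])
  with eventually_knot_chart[of t] show "\<exists>g. smooth_curve g \<and> (\<forall>\<^sub>F r in nhds t. knot r = g r)" by blast
qed

lemma xc_knot: "xc (knot t) = xcoord (real (2 * d) * t)"
  by (simp add: xc_def knot_def lifted_def strand_point_def)

lemma xc_knot_deriv:
  "((xc \<circ> knot) has_real_derivative real (2 * d) * half_width * pi * sin (pi * (real (2 * d) * t))) (at t)"
  unfolding comp_def xc_knot xcoord_def by (auto intro!: derivative_eq_intros)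

lemma deriv_xc_knot:
  "deriv (xc \<circ> knot) t = real (2 * d) * half_width * pi * sin (pi * (real (2 * d) * t))"
  by (rule DERIV_imp_deriv[OF xc_knot_deriv])

lemma deriv_deriv_xc_knot:
  "deriv (deriv (xc \<circ> knot)) t = (real (2 * d) * pi)\<^sup>2 * half_width * cos (pi * (real (2 * d) * t))"
  unfolding deriv_xc_knot[abs_def]
  by (rule DERIV_imp_deriv) (auto intro!: derivative_eq_intros simp: power2_eq_square)

lemma zc_knot_deriv:
  "((zc \<circ> knot) has_real_derivative yc (knot t) * deriv (xc \<circ> knot) t) (at t)"
proof -
  let ?N = "real (2 * d)" and ?p = "arc (real (2 * d) * t)"
  have ev: "\<forall>\<^sub>F r in nhds t. (zc \<circ> knot) r = zval ?p (xcoord (?N * r)) (sin (pi * (?N * r)))"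
    using eventually_knot_chart[of t] by eventually_elim (simp add: zc_def chart_def)
  have "((\<lambda>r. zval ?p (xcoord (?N * r)) (sin (pi * (?N * r)))) has_real_derivative
      yval ?p (xcoord (?N * t)) (sin (pi * (?N * t))) * (half_width * pi * sin (pi * (?N * t))) * ?N) (at t)"
    by (rule DERIV_chain2[OF legendrian_chart]) (auto intro!: derivative_eq_intros)
  moreover have "yc (knot t) = yval ?p (xcoord (?N * t)) (sin (pi * (?N * t)))"
    using eventually_nhds_x_imp_x[OF eventually_knot_chart[of t]] by (simp add: yc_def chart_def)
  ultimately show ?thesis
    unfolding deriv_xc_knot by (subst DERIV_cong_ev[OF refl ev refl]) (simp add: mult_ac)
qed

lemma knot_periodic: "knot (t + 1) = knot t"
proof -
  have "\<lfloor>real (2 * d) * t + real (2 * d)\<rfloor> = \<lfloor>real (2 * d) * t\<rfloor> + int (2 * d)"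
    by (metis floor_add_int of_int_of_nat_eq)
  then have "arc (real (2 * d) * (t + 1)) = arc (real (2 * d) * t)"
    by (simp add: arc_def algebra_simps del: of_nat_mult)
  moreover have "cos (pi * (real (2 * d) * (t + 1))) = cos (pi * (real (2 * d) * t))"
    using cos_add[of "pi * (real (2 * d) * t)" "2 * real d * pi"] cos_2npi[of d] sin_2npi[of d]
    by (simp add: algebra_simps)
  ultimately show ?thesis by (simp add: knot_def lifted_def xcoord_def)
qed

lemma cos_pi_floor: "cos (pi * s) = (if even \<lfloor>s\<rfloor> then 1 else -1) * cos (pi * frac s)"
proof -
  have "pi * s = pi * frac s + of_int \<lfloor>s\<rfloor> * pi" by (simp add: frac_def algebra_simps)
  then have "cos (pi * s) = cos (pi * frac s) * cos (of_int \<lfloor>s\<rfloor> * pi) - sin (pi * frac s) * sin (of_int \<lfloor>s\<rfloor> * pi)"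
    by (metis cos_add)
  then show ?thesis by (simp add: mult.commute[of _ pi] cos_npi_int sin_npi_int)
qed

lemma cos_pi_frac: "cos (pi * frac s) > -1"
proof -
  have "cos pi < cos (pi * frac s)"
    by (rule cos_monotone_0_pi) (auto simp: frac_ge_0 frac_lt_1)
  then show ?thesis by simp
qed

lemma xcoord_end_floor:
  "xcoord s = -1 \<Longrightarrow> even \<lfloor>s\<rfloor>" "xcoord s = real K + 1 \<Longrightarrow> odd \<lfloor>s\<rfloor>"
proof -
  assume "xcoord s = -1"
  then have "cos (pi * s) = 1" using cosine_xcoord[of s] cosine_ends by simp
  then show "even \<lfloor>s\<rfloor>" using cos_pi_floor[of s] cos_pi_frac[of s] by (auto split: if_splits)
next
  assume "xcoord s = real K + 1"
  then have "cos (pi * s) = -1" using cosine_xcoord[of s] cosine_ends by simp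
  then show "odd \<lfloor>s\<rfloor>" using cos_pi_floor[of s] cos_pi_frac[of s] by (auto split: if_splits)
qed

text \<open>Every strand is run through for exactly one value of \<open>\<lfloor>s\<rfloor>\<close>, and over each \<open>x\<close> between the
  end lines the points of different strands differ in height or slope. On the end lines, the two
  strands of a cusp have a common end point, but by parity the knot is there
  only on one of them.\<close>

lemma inj_knot: "inj_on knot {0..<1}"
proof (rule inj_onI)
  fix t t' assume t: "t \<in> {0..<1}" "t' \<in> {0..<1}" and eq: "knot t = knot t'"
  define s s' where "s = real (2 * d) * t" and "s' = real (2 * d) * t'"
  have s: "0 \<le> s" "s < real (2 * d)" "0 \<le> s'" "s' < real (2 * d)"
    using t d_pos by (auto simp: s_def s'_def)
  have lift: "lifted s = lifted s'" using eq by (simp add: knot_def s_def s'_def)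
  then have x: "xcoord s' = xcoord s" by (simp add: lifted_def strand_point_def)
  have "strand_point (arc s) (xcoord s) = strand_point (arc s') (xcoord s)"
    using lift x by (simp add: lifted_def)
  from strand_point_eq[OF xcoord_bounds arc_less arc_less this]
  have "arc s' = arc s"
  proof (elim disjE conjE)
    assume *: "xcoord s = -1" "arc s' = adj (arc s)"
    then have "even (arc s)" "even (arc s')" using xcoord_end_floor(1) x even_arc by metis+
    then show ?thesis using * by (auto simp: adj_def)
  next
    assume *: "xcoord s = real K + 1" "pos W K (arc s') = adj (pos W K (arc s))"
    then have "odd (arc s)" "odd (arc s')" using xcoord_end_floor(2) x even_arc by metis+
    then have "odd (pos W K (arc s))" "odd (pos W K (arc s'))" using even_final arc_less by blast+
    then show ?thesis using * by (auto simp: adj_def split: if_splits)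
  qed
  have fl: "0 \<le> \<lfloor>s\<rfloor>" "\<lfloor>s\<rfloor> < int (2 * d)" "0 \<le> \<lfloor>s'\<rfloor>" "\<lfloor>s'\<rfloor> < int (2 * d)"
    using s by (auto simp: floor_less_iff)
  have "nat \<lfloor>s'\<rfloor> = nat \<lfloor>s\<rfloor>"
    using \<open>arc s' = arc s\<close> fl e_bij unfolding arc_def bij_betw_def
    by (auto simp: nat_less_iff dest!: inj_onD)
  then have f: "\<lfloor>s'\<rfloor> = \<lfloor>s\<rfloor>" using fl eq_nat_nat_iff by blast
  have "cos (pi * s') = cos (pi * s)" using x cosine_xcoord by metis
  then have "cos (pi * frac s') = cos (pi * frac s)"
    using cos_pi_floor[of s] cos_pi_floor[of s'] f by (auto split: if_splits)
  then have "pi * frac s' = pi * frac s"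
    by (rule cos_inj_pi[rotated 4]) (auto simp: frac_ge_0 frac_lt_1 less_imp_le mult_left_le)
  then have "frac s' = frac s" by simp
  then have "s' = s" using f by (simp add: frac_def)
  then show "t = t'" using d_pos by (simp add: s_def s'_def)
qed

text \<open>Away from cusps the derivative of \<open>x\<close> does not vanish; at a cusp the slope is locally a positive multiple of
  \<open>sin (pi * s) * cos (pi * s)\<close> and so has nonvanishing derivative.\<close>

lemma knot_immersed: "vector_derivative knot (at t) \<noteq> 0"
proof
  assume 0: "vector_derivative knot (at t) = 0"
  let ?N = "real (2 * d)"
  obtain v where v: "(knot has_vector_derivative v) (at t)"
    using smooth_curve_derivative[OF smooth_knot] by metis
  then have "v = 0" using 0 vector_derivative_at by metis
  have bl: "bounded_linear xc" "bounded_linear yc"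
    unfolding xc_def[abs_def] yc_def[abs_def]
    by (auto intro: bounded_linear_compose bounded_linear_fst bounded_linear_snd)
  have "((xc \<circ> knot) has_vector_derivative xc v) (at t)" "((yc \<circ> knot) has_vector_derivative yc v) (at t)"
    using bounded_linear.has_vector_derivative[OF bl(1) v] bounded_linear.has_vector_derivative[OF bl(2) v]
    by (simp_all add: comp_def)
  then have dx: "((xc \<circ> knot) has_real_derivative 0) (at t)" and dy: "((yc \<circ> knot) has_real_derivative 0) (at t)"
    unfolding \<open>v = 0\<close> by (simp_all add: has_real_derivative_iff_has_vector_derivative xc_def yc_def)
  have "sin (pi * (?N * t)) = 0"
    using DERIV_unique[OF dx xc_knot_deriv] d_pos half_width_pos by (simp add: less_imp_neq)
  then obtain k where "pi * (?N * t) = of_int k * pi" by (auto simp: sin_zero_iff_int2)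
  then have k: "?N * t = of_int k" by (metis mult.commute mult_cancel_left pi_neq_zero)
  have ev: "\<forall>\<^sub>F r in nhds t. (yc \<circ> knot) r = 3 / (2 * half_width) * sin (pi * (?N * r)) * cos (pi * (?N * r))"
  proof -
    have lim: "((\<lambda>r. xcoord (?N * r)) \<longlongrightarrow> xcoord (of_int k)) (nhds t)"
      unfolding k[symmetric]
      unfolding xcoord_def by (intro tendsto_intros) (rule filterlim_ident)
    then have "\<forall>\<^sub>F r in nhds t. xcoord (?N * r) < - (1/2) \<or> xcoord (?N * r) > real K + 1/2"
      using order_tendstoD(2)[OF lim, of "- (1/2)"] order_tendstoD(1)[OF lim, of "real K + 1/2"]
      by (cases "even k") (auto simp: xcoord_int elim!: eventually_mono)
    with eventually_knot_chart[of t] show ?thesis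
      by eventually_elim (auto simp: yc_def chart_left chart_right)
  qed
  have "((\<lambda>r. 3 / (2 * half_width) * sin (pi * (?N * r)) * cos (pi * (?N * r))) has_real_derivative
      3 / (2 * half_width) * (pi * ?N) * (cos (pi * (?N * t)))\<^sup>2) (at t)"
    using \<open>sin (pi * (?N * t)) = 0\<close> half_width_pos
    by (auto intro!: derivative_eq_intros simp: power2_eq_square)
  then have "((yc \<circ> knot) has_real_derivative 3 / (2 * half_width) * (pi * ?N) * (cos (pi * (?N * t)))\<^sup>2) (at t)"
    by (subst DERIV_cong_ev[OF refl ev refl])
  from DERIV_unique[OF dy this] have "(cos (pi * (?N * t)))\<^sup>2 = 0"
    using d_pos half_width_pos by simp
  then show False using \<open>sin (pi * (?N * t)) = 0\<close> sin_cos_squared_add[of "pi * (?N * t)"] by simp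
qed

lemma legendrian_knot_knot: "legendrian_knot knot"
  unfolding legendrian_knot_def
  using smooth_knot knot_periodic inj_knot knot_immersed DERIV_imp_deriv[OF zc_knot_deriv] by simp

lemma Y_ends: "Y p (-1) = 0" "Y p (real K + 1) = 0"
  by (simp_all add: Y_def yval_def height'_outside cutoff'_0)

lemma sin_pi_zero_iff: "sin (pi * s) = 0 \<longleftrightarrow> s \<in> \<int>"
proof -
  have "pi * s = of_int k * pi \<longleftrightarrow> s = of_int k" for k :: int
    by (metis mult.commute mult_cancel_left pi_neq_zero)
  then show ?thesis by (auto simp: sin_zero_iff_int2 Ints_def)
qed

lemma range_knot: "range knot = range lifted"
proof -
  have "lifted s = knot (s / real (2 * d))" for s
    using d_pos by (simp add: knot_def del: of_nat_mult)
  then have "lifted s \<in> range knot" for s by (metis rangeI)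
  moreover have "knot t \<in> range lifted" for t by (simp add: knot_def del: of_nat_mult)
  ultimately show ?thesis by auto
qed

lemma obtain_arc:
  assumes "p < 2 * d"
  obtains i where "i < 2 * d" "p = e i" "even i \<longleftrightarrow> even p" "\<And>s. \<lfloor>s\<rfloor> = int i \<Longrightarrow> arc s = p"
proof -
  obtain i where i: "i < 2 * d" "p = e i" using e_bij assms unfolding bij_betw_def by blast
  have "arc s = p" if "\<lfloor>s\<rfloor> = int i" for s using i that by (simp add: arc_def nat_mod_distrib del: of_nat_mult)
  then show ?thesis using that[OF i] e_parity[OF i(1)] i(2) by metis
qed

text \<open>Both strands of a left cusp end in the same point, but the knot passes it at an even time, which belongs to the strand of
  type U; hence the detour through that strand. Similarly, right cusps belong to strands of type L.\<close>

lemma left_end_lifted: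
  assumes "p < 2 * d"
  shows "\<exists>k::int. even k \<and> strand_point p (-1) = lifted (of_int k)"
proof -
  define q where "q = (if even p then p else p - 1)"
  have q: "q < 2 * d" "even q" "q = p \<or> q = adj p" using assms by (auto simp: q_def adj_def)
  obtain i where i: "even i" "\<And>s. \<lfloor>s\<rfloor> = int i \<Longrightarrow> arc s = q" using obtain_arc[OF q(1)] q(2) by metis
  have "lifted (of_int (int i)) = strand_point q (-1)"
    unfolding lifted_def using i(2)[of "of_int (int i)"] xcoord_int[of "int i"] i(1) by simp
  also have "\<dots> = strand_point p (-1)"
    using Z_left_end_eq_iff[of p q] q(3) by (simp add: strand_point_def Y_ends)
  finally show ?thesis using i(1) by (intro exI[of _ "int i"]) simp
qed

lemma right_end_lifted:
  assumes "p < 2 * d"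
  shows "\<exists>k::int. odd k \<and> strand_point p (real K + 1) = lifted (of_int k)"
proof -
  obtain i where i: "i < 2 * d" "p = e i" "even i \<longleftrightarrow> even p" using obtain_arc[OF assms] by metis
  define k where "k = (if even i then Suc i else i)"
  have "odd k" by (simp add: k_def)
  moreover have "k < 2 * d" using i(1) unfolding k_def by (cases "even i") (simp_all, presburger)
  ultimately have k: "k < 2 * d" "odd k" by simp_all
  have "pos W K (e k) = adj (pos W K p) \<or> e k = p"
    using e_right[OF i(1)] i even_final[OF assms] by (auto simp: k_def adj_def)
  moreover have "e k < 2 * d" using e_bij k(1) by (auto simp: bij_betw_def)
  ultimately have "Z (e k) (real K + 1) = Z p (real K + 1)"
    using Z_right_end_eq_iff[of p "e k"] assms by auto
  moreover have "arc (of_int (int k)) = e k" using k by (simp add: arc_def nat_mod_distrib del: of_nat_mult)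
  ultimately have "lifted (of_int (int k)) = strand_point p (real K + 1)"
    using xcoord_int[of "int k"] k(2) by (simp add: lifted_def strand_point_def Y_ends)
  then show ?thesis using k(2) by (intro exI[of _ "int k"]) simp
qed

lemma lifted_int:
  "even k \<Longrightarrow> lifted (of_int k) = strand_point (arc (of_int k)) (-1)"
  "odd k \<Longrightarrow> lifted (of_int k) = strand_point (arc (of_int k)) (real K + 1)"
  by (simp_all add: lifted_def xcoord_int)

lemma interior_lifted:
  assumes "p < 2 * d" "-1 < x" "x < real K + 1"
  shows "\<exists>s. strand_point p x = lifted s"
proof -
  obtain i where i: "even i \<longleftrightarrow> even p" "\<And>s. \<lfloor>s\<rfloor> = int i \<Longrightarrow> arc s = p"
    using obtain_arc[OF assms(1)] by metis
  define c where "c = (if even i then 1 else -1) * cosine x"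
  have c: "\<bar>c\<bar> < 1" using cosine_strict[OF assms(2,3)] by (simp add: c_def)
  define u where "u = arccos c / pi"
  have ac: "0 < arccos c" "arccos c < pi" using arccos_lt_bounded[of c] c by auto
  have u: "0 \<le> u" "u < 1" using ac by (auto simp: u_def)
  define s where "s = of_int (int i) + u"
  have fl: "\<lfloor>s\<rfloor> = int i" using u by (auto simp: s_def floor_unique)
  have "frac s = u" by (simp add: frac_def fl) (simp add: s_def)
  then have "cos (pi * frac s) = c" using c by (simp add: u_def cos_arccos_abs)
  then have "cos (pi * s) = cosine x" using cos_pi_floor[of s] fl by (simp add: c_def)
  then have "xcoord s = x" using half_width_pos by (simp add: xcoord_def cosine_def)
  then show ?thesis using i(2)[OF fl] by (auto simp: lifted_def)
qed

lemma link_set_knot: "link_set [knot] = {strand_point p x | p x. p < 2 * d \<and> -1 \<le> x \<and> x \<le> real K + 1}"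
proof -
  have "lifted s \<in> {strand_point p x | p x. p < 2 * d \<and> -1 \<le> x \<and> x \<le> real K + 1}" for s
    unfolding lifted_def using arc_less xcoord_bounds by blast
  moreover have "strand_point p x \<in> range lifted" if "p < 2 * d" "-1 \<le> x" "x \<le> real K + 1" for p x
    using that left_end_lifted[of p] right_end_lifted[of p] interior_lifted[of p x]
    by (cases "x = -1"; cases "x = real K + 1") force+
  ultimately show ?thesis unfolding link_set_def by (auto simp: range_knot)
qed

lemma cusp_param:
  "deriv (xc \<circ> knot) t = 0 \<longleftrightarrow> real (2 * d) * t \<in> \<int>"
  unfolding deriv_xc_knot using d_pos half_width_pos sin_pi_zero_iff[of "real (2 * d) * t"] by simp

lemma deriv_deriv_xc_knot_cusp:
  assumes "real (2 * d) * t = of_int k"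
  shows "deriv (deriv (xc \<circ> knot)) t > 0 \<longleftrightarrow> even k" "deriv (deriv (xc \<circ> knot)) t < 0 \<longleftrightarrow> odd k"
proof -
  define A where "A = (real (2 * d) * pi)\<^sup>2 * half_width"
  have "A > 0" using d_pos half_width_pos by (simp add: A_def)
  moreover have "deriv (deriv (xc \<circ> knot)) t = A * (if even k then 1 else -1)"
    unfolding deriv_deriv_xc_knot assms A_def by (simp add: cos_npi_int)
  ultimately show "deriv (deriv (xc \<circ> knot)) t > 0 \<longleftrightarrow> even k" "deriv (deriv (xc \<circ> knot)) t < 0 \<longleftrightarrow> odd k"
    by auto
qed

lemma cusp_lifted: "deriv (xc \<circ> knot) t = 0 \<Longrightarrow> \<exists>k. real (2 * d) * t = of_int k \<and> knot t = lifted (of_int k)"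
  unfolding cusp_param knot_def by (metis Ints_cases)

lemma lifted_cusp:
  obtains t where "real (2 * d) * t = of_int k" "knot t = lifted (of_int k)" "deriv (xc \<circ> knot) t = 0"
proof (rule that)
  show *: "real (2 * d) * (of_int k / real (2 * d)) = of_int k" using d_pos by simp
  then show "knot (of_int k / real (2 * d)) = lifted (of_int k)" unfolding knot_def by (rule arg_cong)
  show "deriv (xc \<circ> knot) (of_int k / real (2 * d)) = 0" unfolding cusp_param * by simp
qed

lemma cusp_points:
  assumes "\<And>t k. real (2 * d) * t = of_int k \<Longrightarrow> P t \<longleftrightarrow> Q k"
  shows "{knot t | t. deriv (xc \<circ> knot) t = 0 \<and> P t} = {lifted (of_int k) | k. Q k}"
proof (intro equalityI subsetI)
  fix q assume "q \<in> {knot t | t. deriv (xc \<circ> knot) t = 0 \<and> P t}"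
  then obtain t where t: "q = knot t" "deriv (xc \<circ> knot) t = 0" "P t" by blast
  obtain k where "real (2 * d) * t = of_int k" "knot t = lifted (of_int k)" using cusp_lifted[OF t(2)] by blast
  then show "q \<in> {lifted (of_int k) | k. Q k}" using t assms by blast
next
  fix q assume "q \<in> {lifted (of_int k) | k. Q k}"
  then obtain k where k: "q = lifted (of_int k)" "Q k" by blast
  obtain t where t: "real (2 * d) * t = of_int k" "knot t = lifted (of_int k)" "deriv (xc \<circ> knot) t = 0"
    by (rule lifted_cusp)
  then have "P t" using k assms by blast
  then show "q \<in> {knot t | t. deriv (xc \<circ> knot) t = 0 \<and> P t}" using k t by force
qed

lemma left_cusps_knot: "left_cusps [knot] = {strand_point p (-1) | p. p < 2 * d}"
proof -
  have "left_cusps [knot] = {knot t | t. deriv (xc \<circ> knot) t = 0 \<and> deriv (deriv (xc \<circ> knot)) t > 0}"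
    by (simp add: left_cusps_def)
  also have "\<dots> = {lifted (of_int k) | k. even k}" by (rule cusp_points[OF deriv_deriv_xc_knot_cusp(1)])
  also have "\<dots> = {strand_point p (-1) | p. p < 2 * d}"
    using lifted_int(1) arc_less left_end_lifted by (intro equalityI subsetI; elim CollectE exE conjE; metis (mono_tags, lifting) mem_Collect_eq)
  finally show ?thesis .
qed

lemma right_cusps_knot: "right_cusps [knot] = {strand_point p (real K + 1) | p. p < 2 * d}"
proof -
  have "right_cusps [knot] = {knot t | t. deriv (xc \<circ> knot) t = 0 \<and> deriv (deriv (xc \<circ> knot)) t < 0}"
    by (simp add: right_cusps_def)
  also have "\<dots> = {lifted (of_int k) | k. odd k}" by (rule cusp_points[OF deriv_deriv_xc_knot_cusp(2)])
  also have "\<dots> = {strand_point p (real K + 1) | p. p < 2 * d}"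
    using lifted_int(2) arc_less right_end_lifted by (intro equalityI subsetI; elim CollectE exE conjE; metis (mono_tags, lifting) mem_Collect_eq)
  finally show ?thesis .
qed

lemma cusps_knot: "cusps [knot] = left_cusps [knot] \<union> right_cusps [knot]"
proof -
  have nz: "deriv (deriv (xc \<circ> knot)) t \<noteq> 0" if "deriv (xc \<circ> knot) t = 0" for t
    using that d_pos half_width_pos sin_cos_squared_add[of "pi * (real (2 * d) * t)"]
    unfolding deriv_xc_knot deriv_deriv_xc_knot by auto
  show ?thesis unfolding cusps_def left_cusps_def right_cusps_def using nz by force
qed

end

section \<open>Crossings and Maslov potential\<close>

context plat_knot begin

definition crossing_point :: "nat \<Rightarrow> real \<times> real" where
  "crossing_point j = (real j + 1/2, Z (lab W j (W ! j)) (real j + 1/2))"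

lemma Z_eq_cases:
  assumes x: "-1 \<le> x" "x \<le> real K + 1" and p: "p < 2 * d" "q < 2 * d" and eq: "Z p x = Z q x" and "p \<noteq> q"
  shows "x = -1 \<and> q = adj p \<or> x = real K + 1 \<and> pos W K q = adj (pos W K p) \<or>
    (\<exists>j<K. x = real j + 1/2 \<and>
      (pos W j p = W ! j \<and> pos W j q = Suc (W ! j) \<or> pos W j q = W ! j \<and> pos W j p = Suc (W ! j)))"
  using x
proof (cases rule: level_cases)
  case 1
  then show ?thesis using eq Z_left_end_eq_iff \<open>p \<noteq> q\<close> by simp
next
  case 2
  then show ?thesis using eq Z_right_end_eq_iff[OF p] \<open>p \<noteq> q\<close> by simp
next
  case (3 j)
  then show ?thesis
    using Z_order[of j x p q] Z_order[of j x q p] eq p track_eq_iff[of W "{}" j p q] \<open>p \<noteq> q\<close>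
    by (metis less_irrefl linorder_neqE_nat)
next
  case (4 j)
  have "pos W j p \<noteq> pos W j q" using \<open>p \<noteq> q\<close> by simp
  then have "pos W j p = W ! j \<and> pos W j q = Suc (W ! j) \<or> pos W j q = W ! j \<and> pos W j p = Suc (W ! j)"
    using Z_crossing_order[OF 4(1), of p q] Z_crossing_order[OF 4(1), of q p] eq 4(2)
    by (metis less_irrefl linorder_neqE_nat)
  then show ?thesis using 4 by blast
qed

lemma front_proj_strand: "front_proj (strand_point p x) = (x, Z p x)"
  by (simp add: front_proj_def strand_point_def xc_def zc_def)

lemma front_knot: "front [knot] = {(x, Z p x) | p x. p < 2 * d \<and> -1 \<le> x \<and> x \<le> real K + 1}"
proof -
  note pr = front_proj_strand
  show ?thesis
  proof (intro equalityI subsetI)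
    fix v assume "v \<in> front [knot]"
    then obtain p x where "v = front_proj (strand_point p x)" "p < 2 * d" "-1 \<le> x" "x \<le> real K + 1"
      unfolding front_def link_set_knot by (elim imageE CollectE exE conjE) simp
    then show "v \<in> {(x, Z p x) | p x. p < 2 * d \<and> -1 \<le> x \<and> x \<le> real K + 1}"
      unfolding pr by (intro CollectI exI[of _ p] exI[of _ x]) simp
  next
    fix v assume "v \<in> {(x, Z p x) | p x. p < 2 * d \<and> -1 \<le> x \<and> x \<le> real K + 1}"
    then obtain p x where "v = front_proj (strand_point p x)" "p < 2 * d" "-1 \<le> x" "x \<le> real K + 1"
      unfolding pr by (elim CollectE exE conjE) simp
    then show "v \<in> front [knot]"
      unfolding front_def link_set_knot by (intro image_eqI[of _ _ "strand_point p x"] CollectI exI[of _ p] exI[of _ x]) simp_all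
  qed
qed

lemma slopes_knot: "slopes [knot] (x, z) = {Y p x | p. p < 2 * d \<and> -1 \<le> x \<and> x \<le> real K + 1 \<and> Z p x = z}"
proof (intro equalityI subsetI)
  fix y assume "y \<in> slopes [knot] (x, z)"
  then obtain p x' where "(x, y, z) = strand_point p x'" "p < 2 * d" "-1 \<le> x'" "x' \<le> real K + 1"
    unfolding slopes_def link_set_knot by (elim CollectE exE conjE) simp
  then show "y \<in> {Y p x | p. p < 2 * d \<and> -1 \<le> x \<and> x \<le> real K + 1 \<and> Z p x = z}"
    by (intro CollectI exI[of _ p]) (simp add: strand_point_def)
next
  fix y assume "y \<in> {Y p x | p. p < 2 * d \<and> -1 \<le> x \<and> x \<le> real K + 1 \<and> Z p x = z}"
  then obtain p where p: "y = Y p x" "p < 2 * d" "-1 \<le> x" "x \<le> real K + 1" "Z p x = z" by blast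
  show "y \<in> slopes [knot] (x, z)"
    unfolding slopes_def link_set_knot
    by (intro CollectI exI[of _ p] exI[of _ x]) (simp add: strand_point_def p)
qed

lemma finite_slopes: "finite (slopes [knot] v)"
proof -
  have "slopes [knot] v \<subseteq> (\<lambda>p. Y p (fst v)) ` {..<2 * d}"
    by (cases v) (auto simp: slopes_knot)
  then show ?thesis by (rule finite_subset) simp
qed

abbreviation upper_strand :: "nat \<Rightarrow> nat" where "upper_strand j \<equiv> lab W j (W ! j)"
abbreviation lower_strand :: "nat \<Rightarrow> nat" where "lower_strand j \<equiv> lab W j (Suc (W ! j))"

lemma crossing_strands:
  assumes "j < K"
  shows "upper_strand j < 2 * d" "lower_strand j < 2 * d" "upper_strand j \<noteq> lower_strand j"
    "Z (lower_strand j) (real j + 1/2) = Z (upper_strand j) (real j + 1/2)"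
    "Y (upper_strand j) (real j + 1/2) \<noteq> Y (lower_strand j) (real j + 1/2)"
proof -
  have "Suc (W ! j) < 2 * d" using W_less assms by simp
  then show "upper_strand j < 2 * d" "lower_strand j < 2 * d"
    using untrack_less_iff[of j] assms by auto
  show "upper_strand j \<noteq> lower_strand j" by (metis n_not_Suc_n track_untrack)
  show "Z (lower_strand j) (real j + 1/2) = Z (upper_strand j) (real j + 1/2)"
    by (rule Z_crossing_eq[OF assms]) simp_all
  show "Y (upper_strand j) (real j + 1/2) \<noteq> Y (lower_strand j) (real j + 1/2)"
    by (rule Y_crossing_neq[OF assms]) simp_all
qed

lemma slopes_crossing_point:
  assumes "j < K"
  shows "slopes [knot] (crossing_point j) =
    {Y (upper_strand j) (real j + 1/2), Y (lower_strand j) (real j + 1/2)}"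
proof -
  have x: "-1 \<le> real j + 1/2" "real j + 1/2 \<le> real K + 1" using assms by auto
  have "q = upper_strand j \<or> q = lower_strand j"
    if q: "q < 2 * d" "Z q (real j + 1/2) = Z (upper_strand j) (real j + 1/2)" for q
  proof (rule ccontr)
    assume *: "\<not> ?thesis"
    then obtain i where i: "i < K" "real j + 1/2 = real i + 1/2"
      "pos W i q = W ! i \<or> pos W i q = Suc (W ! i)"
      using Z_eq_cases[OF x q(1) crossing_strands(1)[OF assms] q(2)] assms by auto
    then have "i = j" by simp
    then show False using * i(3) by (metis untrack_track)
  qed
  then show ?thesis
    unfolding crossing_point_def slopes_knot using crossing_strands[OF assms] x by auto
qed

text \<open>Off the crossings only the branches of a cusp meet, and they have a common slope 0 there.\<close>

lemma card_slopes_other: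
  assumes "\<And>j. j < K \<Longrightarrow> v \<noteq> crossing_point j"
  shows "card (slopes [knot] v) \<le> 1"
proof -
  obtain x z where v: "v = (x, z)" by (cases v)
  have "Y p x = Y q x" if *: "p < 2 * d" "q < 2 * d" "-1 \<le> x" "x \<le> real K + 1" "Z p x = z" "Z q x = z" for p q
  proof (rule ccontr)
    assume ne: "Y p x \<noteq> Y q x"
    then have "p \<noteq> q" by auto
    from Z_eq_cases[OF *(3,4,1,2) _ this] *(5,6) ne obtain j where j: "j < K" "x = real j + 1/2"
      "pos W j p = W ! j \<or> pos W j q = W ! j" by (auto simp: Y_ends)
    then have "upper_strand j = p \<or> upper_strand j = q" by (metis untrack_track)
    then have "v = crossing_point j" using * j by (auto simp: v crossing_point_def)
    then show False using assms j by simp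
  qed
  then have "\<forall>a\<in>slopes [knot] v. \<forall>b\<in>slopes [knot] v. a = b"
    unfolding v slopes_knot by blast
  then show ?thesis using card_le_Suc0_iff_eq[OF finite_slopes, of v] by simp
qed

lemma crossings_knot: "crossings [knot] = crossing_point ` {..<K}"
proof (intro equalityI subsetI)
  fix v assume "v \<in> crossings [knot]"
  then have "\<not> card (slopes [knot] v) \<le> 1" by (simp add: crossings_def)
  then show "v \<in> crossing_point ` {..<K}" using card_slopes_other[of v] by blast
next
  fix v assume "v \<in> crossing_point ` {..<K}"
  then show "v \<in> crossings [knot]"
    using crossing_strands(5) by (auto simp: crossings_def slopes_crossing_point)
qed

lemma generic_front_knot: "generic_front [knot]"
  unfolding generic_front_def
proof (intro conjI allI ballI)
  show "cusps [knot] = left_cusps [knot] \<union> right_cusps [knot]" by (rule cusps_knot)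
  show "finite (slopes [knot] v)" for v by (rule finite_slopes)
  show "card (slopes [knot] v) \<le> 2" for v
    using card_slopes_other[of v] slopes_crossing_point crossing_strands(5) by force
  show "front_proj p \<notin> crossings [knot]" if "p \<in> cusps [knot]" for p
  proof
    assume "front_proj p \<in> crossings [knot]"
    then obtain j where "j < K" "front_proj p = crossing_point j" unfolding crossings_knot by auto
    moreover have "fst (front_proj p) = -1 \<or> fst (front_proj p) = real K + 1"
      using that unfolding cusps_knot left_cusps_knot right_cusps_knot
      by (auto simp: front_proj_def strand_point_def xc_def)
    ultimately show False by (auto simp: crossing_point_def)
  qed
  show "inj_on fst (crossings [knot])"
    unfolding crossings_knot by (auto simp: inj_on_def crossing_point_def)
qed

text \<open>The strands of type U are exactly the upper branches of the cusps.\<close>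

definition potential :: "real \<times> real \<times> real \<Rightarrow> int" where
  "potential v = (if \<exists>p x. p < 2 * d \<and> even p \<and> -1 \<le> x \<and> x \<le> real K + 1 \<and> v = strand_point p x then 1 else 0)"

lemma potential_strand:
  assumes "p < 2 * d" "-1 < x" "x < real K + 1"
  shows "potential (strand_point p x) = (if even p then 1 else 0)"
proof -
  have uniq: "q = p" if "q < 2 * d" "strand_point p x = strand_point q y" for q y
  proof -
    have "y = x" using that by (simp add: strand_point_def)
    then show ?thesis using strand_point_eq[of x p q] that assms by auto
  qed
  have "(\<exists>q y. q < 2 * d \<and> even q \<and> -1 \<le> y \<and> y \<le> real K + 1 \<and> strand_point p x = strand_point q y) \<longleftrightarrow> even p"
  proof
    assume "\<exists>q y. q < 2 * d \<and> even q \<and> -1 \<le> y \<and> y \<le> real K + 1 \<and> strand_point p x = strand_point q y"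
    then obtain q y where "q < 2 * d" "even q" "strand_point p x = strand_point q y" by blast
    then show "even p" using uniq[of q y] by simp
  next
    assume "even p"
    then show "\<exists>q y. q < 2 * d \<and> even q \<and> -1 \<le> y \<and> y \<le> real K + 1 \<and> strand_point p x = strand_point q y"
      using assms by (intro exI[of _ p] exI[of _ x]) simp
  qed
  then show ?thesis unfolding potential_def by simp
qed

lemma isCont_smooth: "smooth_curve f \<Longrightarrow> isCont f x" for f :: "real \<Rightarrow> real"
  by (metis smooth_curve_derivative has_vector_derivative_continuous)

lemma continuous_on_smooth: "smooth_curve f \<Longrightarrow> continuous_on S f" for f :: "real \<Rightarrow> real"
  by (intro continuous_at_imp_continuous_on ballI isCont_smooth)

lemma continuous_on_cosine: "continuous_on S cosine"
  unfolding cosine_def using half_width_pos by (intro continuous_intros) auto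

lemma continuous_on_sine: "continuous_on S sine"
  unfolding sine_def by (intro continuous_intros continuous_on_cosine)

lemma continuous_Z: "continuous_on S (Z p)"
  and continuous_Y: "continuous_on S (Y p)"
proof -
  note c = continuous_on_smooth[OF smooth_height, of S p] continuous_on_smooth[OF smooth_height', of S p]
    continuous_on_smooth[OF smooth_cutoff, of S] continuous_on_smooth[OF smooth_cutoff', of S]
    continuous_on_cosine continuous_on_sine
  show "continuous_on S (Z p)"
    unfolding Z_def zval_def by (intro continuous_intros c) auto
  show "continuous_on S (Y p)"
    unfolding Y_def yval_def by (intro continuous_intros c) auto
qed

lemma continuous_strand_point: "continuous_on S (strand_point p)"
  unfolding strand_point_def[abs_def]
  by (intro continuous_on_Pair continuous_on_id continuous_Z continuous_Y)

text \<open>The union of the strands of one type is compact, so near a point of the link off the cusps there are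
  only points of the same type. This makes the potential locally constant.\<close>

lemma closed_strands:
  "closed {strand_point p x | p x. p < 2 * d \<and> P p \<and> -1 \<le> x \<and> x \<le> real K + 1}" (is "closed ?A")
proof -
  have "?A = (\<Union>p\<in>{p. p < 2 * d \<and> P p}. strand_point p ` {-1..real K + 1})"
  proof (intro equalityI subsetI)
    fix v assume "v \<in> ?A"
    then obtain p x where "v = strand_point p x" "p < 2 * d" "P p" "-1 \<le> x" "x \<le> real K + 1" by blast
    then show "v \<in> (\<Union>p\<in>{p. p < 2 * d \<and> P p}. strand_point p ` {-1..real K + 1})"
      by (intro UN_I[of p] image_eqI[of _ _ x]) auto
  next
    fix v assume "v \<in> (\<Union>p\<in>{p. p < 2 * d \<and> P p}. strand_point p ` {-1..real K + 1})"
    then obtain p x where "v = strand_point p x" "p < 2 * d" "P p" "x \<in> {-1..real K + 1}" by (elim UN_E imageE) simp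
    then show "v \<in> ?A" by (intro CollectI exI[of _ p] exI[of _ x]) simp
  qed
  moreover have "compact \<dots>"
    by (intro compact_UN compact_continuous_image continuous_strand_point) auto
  ultimately show ?thesis by (simp add: compact_imp_closed)
qed

lemma cusps_strand: "cusps [knot] = {strand_point p x | p x. p < 2 * d \<and> (x = -1 \<or> x = real K + 1)}"
  unfolding cusps_knot left_cusps_knot right_cusps_knot by (intro set_eqI; simp; metis)

text \<open>Cusps of different pairs are 2 apart in height, and near the ends each strand stays within 1/2 of its cusp; so
  within distance 1 of a cusp there are only the two strands that meet in it.\<close>

lemma near_cusp_value:
  assumes "0 \<le> c" "c \<le> 1/2" "\<bar>(- real b - side b * c) - (- real a - side a * (1/2))\<bar> < 1"
  shows "b = a \<or> b = adj a"
proof -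
  have val: "\<bar>(- real p - side p * t) - (- 2 * real (p div 2) - 1/2)\<bar> \<le> 1/2" if "0 \<le> t" "t \<le> 1/2" for p t
  proof (cases "even p")
    case True
    then have "real p = 2 * real (p div 2)" by (auto elim!: evenE)
    then show ?thesis using that True by (simp add: side_def abs_le_iff)
  next
    case False
    then have "real p = 2 * real (p div 2) + 1" by (auto elim!: oddE)
    then show ?thesis using that False by (simp add: side_def abs_le_iff)
  qed
  have half: "- real a - side a * (1/2) = - 2 * real (a div 2) - 1/2"
    by (cases "even a") (auto simp: side_def elim!: evenE oddE)
  have "\<bar>2 * real (b div 2) - 2 * real (a div 2)\<bar> < 2"
    using val[OF assms(1,2), of b] assms(3) unfolding half by linarith
  then have "b div 2 = a div 2" by linarith
  then show ?thesis by (auto simp: adj_def; presburger)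
qed

lemma maslov_potential_knot: "maslov_potential [knot] potential"
  unfolding maslov_potential_def
proof (intro conjI ballI)
  fix v assume "v \<in> link_set [knot] - cusps [knot]"
  then obtain p x where v: "v = strand_point p x" "p < 2 * d" "-1 < x" "x < real K + 1"
    unfolding link_set_knot cusps_strand by force
  let ?B = "{strand_point q y | q y. q < 2 * d \<and> (even q \<noteq> even p) \<and> -1 \<le> y \<and> y \<le> real K + 1}"
  have "v \<notin> ?B"
  proof
    assume "v \<in> ?B"
    then obtain q y where q: "q < 2 * d" "even q \<noteq> even p" "v = strand_point q y" by auto
    then have "y = x" using v by (simp add: strand_point_def)
    then show False using strand_point_eq[of x p q] v q by auto
  qed
  then have "\<forall>\<^sub>F w in nhds v. w \<in> - ?B"
    using closed_strands[of "\<lambda>q. even q \<noteq> even p"] by (intro eventually_nhds_in_open) auto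
  then have "\<forall>\<^sub>F w in nhds v. w \<in> link_set [knot] - cusps [knot] \<longrightarrow> potential w = potential v"
  proof eventually_elim
    case (elim w)
    show ?case
    proof
      assume "w \<in> link_set [knot] - cusps [knot]"
      then obtain q y where w: "w = strand_point q y" "q < 2 * d" "-1 < y" "y < real K + 1"
        unfolding link_set_knot cusps_strand by force
      then have "even q = even p" using elim by force
      then show "potential w = potential v" using v w by (simp add: potential_strand)
    qed
  qed
  then show "\<forall>\<^sub>F w in at v within link_set [knot] - cusps [knot]. potential w = potential v"
    unfolding eventually_at_filter by eventually_elim auto
next
  fix k assume "k \<in> cusps [knot]"
  then obtain p where p: "p < 2 * d" and k: "k = strand_point p (-1) \<or> k = strand_point p (real K + 1)"
    unfolding cusps_strand by auto
  have open_slab: "open {v :: real \<times> real \<times> real. a < fst v \<and> fst v < b \<and> \<bar>snd (snd v) - c\<bar> < 1}" for a b c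
    by (intro open_Collect_conj open_Collect_less continuous_intros)
  have order: "potential (strand_point r x) = potential (strand_point q x) + 1"
    if "q < 2 * d" "r < 2 * d" "-1 < x" "x < real K + 1" "x < 0 \<and> (q = r \<or> q = adj r) \<or> x > real K \<and> (q = r \<or> pos W K q = adj (pos W K r))"
      "Z q x < Z r x" for q r x
  proof -
    have "q \<noteq> r" using that by auto
    have "even r \<and> odd q"
      using that(5)
    proof (elim disjE conjE)
      assume x: "x < 0" "q = adj r"
      have "lo 0 < x" "x < hi 0" using x(1) that(3) by (simp_all add: lo_def hi_def)
      then have "\<not> r > q" using Z_order[of 0 x q r] that(1,2,6) by force
      then show ?thesis using x(2) odd_pos[of r] by (cases "even r") (simp_all add: adj_def)
    next
      assume x: "x > real K" "pos W K q = adj (pos W K r)"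
      have "lo K < x" "x < hi K" using x(1) that(3,4) by (simp_all add: lo_def hi_def)
      then have "\<not> pos W K r > pos W K q" using Z_order[OF le_refl, of x q r] that(1,2,6) by fastforce
      then have "even (pos W K r) \<and> odd (pos W K q)"
        using x(2) odd_pos[of "pos W K r"] by (cases "even (pos W K r)") (simp_all add: adj_def)
      then show ?thesis using even_final[OF that(1)] even_final[OF that(2)] by simp
    qed (use \<open>q \<noteq> r\<close> in auto)
    then show ?thesis using that by (simp add: potential_strand)
  qed
  from k show "\<exists>U. open U \<and> k \<in> U \<and> (\<forall>v\<in>link_set [knot] \<inter> U. \<forall>w\<in>link_set [knot] \<inter> U.
      xc v = xc w \<and> zc v < zc w \<longrightarrow> potential w = potential v + 1)"
  proof
    assume k: "k = strand_point p (-1)"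
    define c where "c = Z p (-1)"
    let ?U = "{v :: real \<times> real \<times> real. -2 < fst v \<and> fst v < 0 \<and> \<bar>snd (snd v) - c\<bar> < 1}"
    have near: "r = p \<or> r = adj p" if "-1 \<le> x" "x < 0" "\<bar>Z r x - c\<bar> < 1" for r x
      using that near_cusp_value[of "pinch x" r p] pinch_bounds[of x]
      by (simp add: Z_pinch height_left c_def pinch_ends)
    show ?thesis
    proof (intro exI[of _ ?U] conjI ballI impI)
      show "open ?U" by (rule open_slab)
      show "k \<in> ?U" by (simp add: k c_def strand_point_def)
      fix v w assume mem: "v \<in> link_set [knot] \<inter> ?U" "w \<in> link_set [knot] \<inter> ?U" and vw: "xc v = xc w \<and> zc v < zc w"
      have strand: "\<exists>q x. v = strand_point q x \<and> q < 2 * d \<and> -1 \<le> x \<and> x < 0 \<and> \<bar>Z q x - c\<bar> < 1"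
        if m: "v \<in> link_set [knot] \<inter> ?U" for v
      proof -
        obtain q x where "v = strand_point q x" "q < 2 * d" "-1 \<le> x"
          using m unfolding link_set_knot by blast
        then show ?thesis using m by (intro exI[of _ q] exI[of _ x]) (simp add: strand_point_def)
      qed
      obtain q x where v: "v = strand_point q x" "q < 2 * d" "-1 \<le> x" "x < 0" "\<bar>Z q x - c\<bar> < 1"
        using strand[OF mem(1)] by blast
      obtain r y where w: "w = strand_point r y" "r < 2 * d" "-1 \<le> y" "y < 0" "\<bar>Z r y - c\<bar> < 1"
        using strand[OF mem(2)] by blast
      have y: "y = x" and Z: "Z q x < Z r x" using vw v(1) w(1) by (auto simp: strand_point_def xc_def zc_def)
      have qr: "q = r \<or> q = adj r" using near[OF v(3,4,5)] near[OF w(3,4,5)] by auto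
      then have "x \<noteq> -1" using Z Z_left_end_eq_iff[of r q] by auto
      then show "potential w = potential v + 1"
        using order[OF v(2) w(2), of x] v w(1) y qr Z by simp
    qed
  next
    assume k: "k = strand_point p (real K + 1)"
    define c where "c = Z p (real K + 1)"
    let ?U = "{v :: real \<times> real \<times> real. real K < fst v \<and> fst v < real K + 2 \<and> \<bar>snd (snd v) - c\<bar> < 1}"
    have side: "side r = side (pos W K r)" if "r < 2 * d" for r using even_final[OF that] by (simp add: side_def)
    have near: "pos W K r = pos W K p \<or> pos W K r = adj (pos W K p)"
      if "x > real K" "x \<le> real K + 1" "\<bar>Z r x - c\<bar> < 1" "r < 2 * d" for r x
      using that near_cusp_value[of "pinch x" "pos W K r" "pos W K p"] pinch_bounds[of x] side[of r] side[OF p]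
      by (simp add: Z_pinch height_right c_def pinch_ends)
    show ?thesis
    proof (intro exI[of _ ?U] conjI ballI impI)
      show "open ?U" by (rule open_slab)
      show "k \<in> ?U" by (simp add: k c_def strand_point_def)
      fix v w assume mem: "v \<in> link_set [knot] \<inter> ?U" "w \<in> link_set [knot] \<inter> ?U" and vw: "xc v = xc w \<and> zc v < zc w"
      have strand: "\<exists>q x. v = strand_point q x \<and> q < 2 * d \<and> x > real K \<and> x \<le> real K + 1 \<and> \<bar>Z q x - c\<bar> < 1"
        if m: "v \<in> link_set [knot] \<inter> ?U" for v
      proof -
        obtain q x where "v = strand_point q x" "q < 2 * d" "x \<le> real K + 1"
          using m unfolding link_set_knot by blast
        then show ?thesis using m by (intro exI[of _ q] exI[of _ x]) (simp add: strand_point_def)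
      qed
      obtain q x where v: "v = strand_point q x" "q < 2 * d" "x > real K" "x \<le> real K + 1" "\<bar>Z q x - c\<bar> < 1"
        using strand[OF mem(1)] by blast
      obtain r y where w: "w = strand_point r y" "r < 2 * d" "y > real K" "y \<le> real K + 1" "\<bar>Z r y - c\<bar> < 1"
        using strand[OF mem(2)] by blast
      have y: "y = x" and Z: "Z q x < Z r x" using vw v(1) w(1) by (auto simp: strand_point_def xc_def zc_def)
      have qr: "q = r \<or> pos W K q = adj (pos W K r)"
        using near[OF v(3,4,5,2)] near[OF w(3,4,5,2)] by (metis adj_adj track_eq_iff)
      then have "x \<noteq> real K + 1" using Z Z_right_end_eq_iff[OF w(2) v(2)] by auto
      then show "potential w = potential v + 1"
        using order[OF v(2) w(2), of x] v w(1) y qr Z by simp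
    qed
  qed
qed

lemma crossing_degree_knot:
  assumes "j < K"
  shows "crossing_degree [knot] potential (crossing_point j) = 0 \<longleftrightarrow> even (upper_strand j) = even (lower_strand j)"
proof -
  let ?x = "real j + 1/2"
  have x: "-1 < ?x" "?x < real K + 1" using assms by auto
  have u: "potential (?x, Y (upper_strand j) ?x, Z (upper_strand j) ?x) = (if even (upper_strand j) then 1 else 0)"
    using potential_strand[OF crossing_strands(1)[OF assms] x] by (simp add: strand_point_def)
  have l: "potential (?x, Y (lower_strand j) ?x, Z (upper_strand j) ?x) = (if even (lower_strand j) then 1 else 0)"
    using potential_strand[OF crossing_strands(2)[OF assms] x] crossing_strands(4)[OF assms] by (simp add: strand_point_def)
  show ?thesis
    using u l unfolding crossing_degree_def slopes_crossing_point[OF assms]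
    by (cases "Y (upper_strand j) ?x < Y (lower_strand j) ?x")
       (auto simp: crossing_point_def min_def max_def)
qed

lemma card_components_knot: "card (components (link_set [knot])) = 1"
proof -
  have "connected (link_set [knot])"
  proof -
    obtain f' where "\<And>t. (knot has_vector_derivative f' t) (at t)"
      using smooth_curve_derivative[OF smooth_knot] by blast
    then have "continuous_on UNIV knot"
      by (intro continuous_at_imp_continuous_on ballI has_vector_derivative_continuous)
    then have "connected (range knot)" by (rule connected_continuous_image) (rule connected_UNIV)
    then show ?thesis by (simp add: link_set_def)
  qed
  moreover have "link_set [knot] \<noteq> {}" by (auto simp: link_set_def)
  ultimately have "components (link_set [knot]) = {link_set [knot]}" by (simp add: components_eq_sing_iff)
  then show ?thesis by simp
qed

lemma legendrian_link_knot: "legendrian_link [knot]"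
  using legendrian_knot_knot by (simp add: legendrian_link_def)

end

section \<open>Ruling paths are sequences of positions\<close>

context plat_knot begin

text \<open>A path in the front is encoded by the positions \<open>t j\<close> that it occupies between consecutive
  crossings. It is legal if at each crossing it keeps its position or follows its strand.\<close>

definition pos_fun :: "nat \<Rightarrow> nat \<Rightarrow> real \<Rightarrow> real" where
  "pos_fun j i = Z (lab W j i)"

definition legal :: "(nat \<Rightarrow> nat) \<Rightarrow> bool" where
  "legal t \<longleftrightarrow> (\<forall>j\<le>K. t j < 2 * d) \<and> (\<forall>j<K. t (Suc j) = t j \<or> t (Suc j) = sw (W ! j) (t j))"

definition path_fun :: "(nat \<Rightarrow> nat) \<Rightarrow> real \<Rightarrow> real" where
  "path_fun t x = pos_fun (level x) (t (level x)) x"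

definition path :: "(nat \<Rightarrow> nat) \<Rightarrow> (real \<times> real) set" where
  "path t = (\<lambda>x. (x, path_fun t x)) ` {-1..real K + 1}"

lemma legal_less: "legal t \<Longrightarrow> j \<le> K \<Longrightarrow> t j < 2 * d"
  by (simp add: legal_def)

lemma pos_fun_order:
  assumes "j \<le> K" "lo j < x" "x < hi j" "p < 2 * d" "q < 2 * d" "p < q"
  shows "pos_fun j q x < pos_fun j p x"
  unfolding pos_fun_def using assms by (intro Z_order[OF assms(1-3)]) (simp_all add: untrack_less_iff)

lemma pos_fun_eq_iff:
  assumes "j \<le> K" "lo j < x" "x < hi j" "p < 2 * d" "q < 2 * d"
  shows "pos_fun j p x = pos_fun j q x \<longleftrightarrow> p = q"
  using pos_fun_order[OF assms] pos_fun_order[OF assms(1-3,5,4)] by (cases p q rule: linorder_cases) auto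

lemma pos_fun_order_iff:
  assumes "j \<le> K" "lo j < x" "x < hi j" "p < 2 * d" "q < 2 * d"
  shows "pos_fun j q x < pos_fun j p x \<longleftrightarrow> p < q"
  using pos_fun_order[OF assms] pos_fun_order[OF assms(1-3,5,4)] by (cases p q rule: linorder_cases) auto

lemma pos_fun_crossing_order:
  assumes "j < K" "p < q" "\<not> (p = W ! j \<and> q = Suc (W ! j))"
  shows "pos_fun j q (real j + 1/2) < pos_fun j p (real j + 1/2)"
  unfolding pos_fun_def by (rule Z_crossing_order) (use assms in simp_all)

lemma pos_fun_crossing_sw:
  assumes "j < K"
  shows "pos_fun j (sw (W ! j) p) (real j + 1/2) = pos_fun j p (real j + 1/2)"
  using crossing_strands(4)[OF assms] by (simp add: sw_def pos_fun_def)

lemma pos_fun_crossing_eq_iff: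
  assumes "j < K"
  shows "pos_fun j p (real j + 1/2) = pos_fun j q (real j + 1/2) \<longleftrightarrow> q = p \<or> q = sw (W ! j) p"
proof
  assume eq: "pos_fun j p (real j + 1/2) = pos_fun j q (real j + 1/2)"
  show "q = p \<or> q = sw (W ! j) p"
  proof (cases p q rule: linorder_cases)
    case less
    then show ?thesis using pos_fun_crossing_order[OF assms less] eq by (auto simp: sw_def)
  next
    case greater
    then show ?thesis using pos_fun_crossing_order[OF assms greater] eq by (auto simp: sw_def)
  qed simp
qed (use pos_fun_crossing_sw[OF assms] in auto)

lemma pos_fun_Suc_sw: "pos_fun (Suc j) (sw (W ! j) p) = pos_fun j p"
  by (simp add: pos_fun_def)

lemma pos_fun_Suc_crossing: "j < K \<Longrightarrow> pos_fun (Suc j) p (real j + 1/2) = pos_fun j p (real j + 1/2)"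
  using pos_fun_Suc_sw[of j "sw (W ! j) p"] pos_fun_crossing_sw[of j p] by simp

lemma pos_fun_left: "pos_fun 0 p (-1) = pos_fun 0 q (-1) \<longleftrightarrow> q = p \<or> q = adj p"
  by (simp add: pos_fun_def Z_left_end_eq_iff)

lemma pos_fun_right:
  "p < 2 * d \<Longrightarrow> q < 2 * d \<Longrightarrow> pos_fun K p (real K + 1) = pos_fun K q (real K + 1) \<longleftrightarrow> q = p \<or> q = adj p"
  by (simp add: pos_fun_def Z_right_end_eq_iff untrack_less_iff) (metis track_untrack)

lemma lo_less_hi: "j \<le> K \<Longrightarrow> lo j < hi j"
  by (auto simp: lo_def hi_def)

lemma slab_bounds: "j \<le> K \<Longrightarrow> -1 \<le> lo j" "j \<le> K \<Longrightarrow> hi j \<le> real K + 1"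
  by (auto simp: lo_def hi_def)

lemma lo_Suc: "lo (Suc j) = real j + 1/2" and hi_less_K: "j < K \<Longrightarrow> hi j = real j + 1/2"
  by (auto simp: lo_def hi_def)

lemma level_le: "level x \<le> K" by (simp add: level_def)

lemma level_slab:
  assumes "-1 \<le> x" "x \<le> real K + 1"
  shows "lo (level x) \<le> x" "x \<le> hi (level x)"
proof -
  define m where "m = \<lfloor>x + 1/2\<rfloor>"
  have m: "of_int m \<le> x + 1/2" "x + 1/2 < of_int m + 1" by (auto simp: m_def)
  have lev: "level x = min K (nat m)" by (simp add: level_def m_def)
  consider "m \<le> 0" | "0 < m" "m < int K" | "int K \<le> m" "0 < m" by linarith
  then have "lo (level x) \<le> x \<and> x \<le> hi (level x)"
  proof cases
    case 1
    then have "level x = 0" by (simp add: lev)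
    then show ?thesis using 1 m assms by (auto simp: lo_def hi_def)
  next
    case 2
    then have "level x = nat m" "real (nat m) = of_int m" "nat m \<noteq> 0" "nat m \<noteq> K" by (auto simp: lev)
    then show ?thesis using m by (auto simp: lo_def hi_def)
  next
    case 3
    then have "level x = K" by (auto simp: lev)
    then show ?thesis using 3 m assms by (auto simp: lo_def hi_def)
  qed
  then show "lo (level x) \<le> x" "x \<le> hi (level x)" by auto
qed

lemma slab_overlap:
  assumes "j \<le> K" "k \<le> K" "j < k" "x \<le> hi j" "lo k \<le> x"
  shows "k = Suc j" "x = real j + 1/2"
proof -
  have "real k - 1/2 \<le> real j + 1/2" using assms by (auto simp: lo_def hi_def)
  then show k: "k = Suc j" using assms(3) by linarith
  show "x = real j + 1/2" using assms unfolding k by (auto simp: lo_def hi_def)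
qed

lemma legal_crossing:
  assumes "legal t" "j < K"
  shows "pos_fun (Suc j) (t (Suc j)) (real j + 1/2) = pos_fun j (t j) (real j + 1/2)"
proof -
  have "t (Suc j) = t j \<or> t (Suc j) = sw (W ! j) (t j)" using assms by (simp add: legal_def)
  then show ?thesis
    using pos_fun_Suc_crossing[OF assms(2)] pos_fun_crossing_sw[OF assms(2)] by auto
qed

text \<open>Over a crossing, \<open>level\<close> prefers the slab to the right, but a legal path has the same value in both.\<close>

lemma path_fun_slab:
  assumes "legal t" "j \<le> K" "lo j \<le> x" "x \<le> hi j"
  shows "path_fun t x = pos_fun j (t j) x"
proof -
  have I: "-1 \<le> x" "x \<le> real K + 1" using slab_bounds[OF assms(2)] assms(3,4) by linarith+
  note lev = level_le[of x] level_slab[OF I]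
  show ?thesis
  proof (cases j "level x" rule: linorder_cases)
    case less
    note k = slab_overlap[OF assms(2) lev(1) less assms(4) lev(2)]
    have "j < K" using less lev(1) by simp
    then show ?thesis using legal_crossing[OF assms(1)] k by (simp add: path_fun_def)
  next
    case equal
    then show ?thesis by (simp add: path_fun_def)
  next
    case greater
    note k = slab_overlap[OF lev(1) assms(2) greater lev(3) assms(3)]
    have "level x < K" using greater assms(2) by simp
    then show ?thesis using legal_crossing[OF assms(1), of "level x"] k by (simp add: path_fun_def)
  qed
qed

lemma I_slabs: "{-1..real K + 1} = (\<Union>j\<in>{..K}. {lo j..hi j})"
proof (intro equalityI subsetI)
  fix x assume "x \<in> {-1..real K + 1}"
  then show "x \<in> (\<Union>j\<in>{..K}. {lo j..hi j})"
    using level_slab[of x] level_le[of x] by (intro UN_I[of "level x"]) auto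
next
  fix x assume "x \<in> (\<Union>j\<in>{..K}. {lo j..hi j})"
  then obtain j where "j \<le> K" "lo j \<le> x" "x \<le> hi j" by auto
  then show "x \<in> {-1..real K + 1}" using slab_bounds[of j] by simp
qed

lemma continuous_pos_fun: "continuous_on S (pos_fun j p)"
  unfolding pos_fun_def by (rule continuous_Z)

lemma continuous_path_fun:
  assumes "legal t"
  shows "continuous_on {-1..real K + 1} (path_fun t)"
  unfolding I_slabs
proof (rule continuous_on_closed_Union)
  fix j assume j: "j \<in> {..K}"
  have "continuous_on {lo j..hi j} (pos_fun j (t j))" by (rule continuous_pos_fun)
  then show "continuous_on {lo j..hi j} (path_fun t)"
    by (rule continuous_on_eq) (use path_fun_slab[OF assms, of j] j in auto)
qed auto

lemma front_pos_fun:
  assumes "j \<le> K" "lo j \<le> x" "x \<le> hi j"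
  shows "(x, z) \<in> front [knot] \<longleftrightarrow> (\<exists>p<2 * d. z = pos_fun j p x)"
proof -
  have x: "-1 \<le> x" "x \<le> real K + 1" using slab_bounds[OF assms(1)] assms(2,3) by linarith+
  have "(x, z) \<in> front [knot] \<longleftrightarrow> (\<exists>p<2 * d. z = Z p x)"
    unfolding front_knot using x by auto
  also have "\<dots> \<longleftrightarrow> (\<exists>p<2 * d. z = pos_fun j p x)"
  proof
    assume "\<exists>p<2 * d. z = Z p x"
    then obtain p where "p < 2 * d" "z = Z p x" by blast
    then show "\<exists>p<2 * d. z = pos_fun j p x"
      using track_less_iff[OF assms(1)] by (intro exI[of _ "pos W j p"]) (simp add: pos_fun_def)
  next
    assume "\<exists>p<2 * d. z = pos_fun j p x"
    then obtain p where "p < 2 * d" "z = pos_fun j p x" by blast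
    then show "\<exists>p<2 * d. z = Z p x"
      using untrack_less_iff[OF assms(1)] by (intro exI[of _ "lab W j p"]) (simp add: pos_fun_def)
  qed
  finally show ?thesis .
qed

lemma path_subset_front: "legal t \<Longrightarrow> path t \<subseteq> front [knot]"
proof
  fix v assume t: "legal t" and "v \<in> path t"
  then obtain x where x: "-1 \<le> x" "x \<le> real K + 1" "v = (x, path_fun t x)" by (auto simp: path_def)
  show "v \<in> front [knot]"
    unfolding x(3) front_pos_fun[OF level_le level_slab[OF x(1,2)]]
    using legal_less[OF t level_le] by (auto simp: path_fun_def)
qed

text \<open>
  A continuous function with graph in the front stays in one position between two crossings: the sets
  where it agrees with the strand in a given position are closed, disjoint and finite in
  number, and the slab is connected.
\<close>

lemma slab_position:
  assumes j: "j \<le> K" and cont: "continuous_on {lo j<..<hi j} f"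
    and front: "\<And>x. lo j < x \<Longrightarrow> x < hi j \<Longrightarrow> (x, f x) \<in> front [knot]"
  shows "\<exists>p<2 * d. \<forall>x. lo j < x \<longrightarrow> x < hi j \<longrightarrow> f x = pos_fun j p x"
proof -
  let ?J = "{lo j<..<hi j}"
  define A where "A p = {x \<in> ?J. f x - pos_fun j p x = 0}" for p
  have closed: "closedin (top_of_set ?J) (A p)" for p
  proof -
    have "closedin (top_of_set ?J) (?J \<inter> (\<lambda>x. f x - pos_fun j p x) -` {0})"
      by (intro continuous_closedin_preimage continuous_on_diff cont continuous_pos_fun) simp
    moreover have "?J \<inter> (\<lambda>x. f x - pos_fun j p x) -` {0} = A p" by (auto simp: A_def)
    ultimately show ?thesis by simp
  qed
  have cover: "\<exists>p<2 * d. x \<in> A p" if x: "x \<in> ?J" for x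
  proof -
    have "(x, f x) \<in> front [knot]" using front x by simp
    then obtain p where "p < 2 * d" "f x = pos_fun j p x" using front_pos_fun[OF j, of x "f x"] x by auto
    then show ?thesis using x by (intro exI[of _ p]) (simp add: A_def)
  qed
  have uniq: "p = q" if "x \<in> A p" "x \<in> A q" "p < 2 * d" "q < 2 * d" for x p q
    using that pos_fun_eq_iff[OF j _ _ that(3,4), of x] by (auto simp: A_def)
  define x0 where "x0 = (lo j + hi j) / 2"
  have x0: "x0 \<in> ?J" using lo_less_hi[OF j] by (simp add: x0_def)
  then obtain p where p: "p < 2 * d" "x0 \<in> A p" using cover by blast
  have "?J - A p = (\<Union>q\<in>{..<2 * d} - {p}. A q)"
  proof (intro equalityI subsetI)
    fix x assume x: "x \<in> ?J - A p"
    then obtain q where "q < 2 * d" "x \<in> A q" using cover by blast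
    then show "x \<in> (\<Union>q\<in>{..<2 * d} - {p}. A q)" using x by (intro UN_I[of q]) auto
  next
    fix x assume "x \<in> (\<Union>q\<in>{..<2 * d} - {p}. A q)"
    then obtain q where "q < 2 * d" "q \<noteq> p" "x \<in> A q" by auto
    then show "x \<in> ?J - A p" using uniq[of x p q] p(1) by (auto simp: A_def)
  qed
  moreover have "closedin (top_of_set ?J) (\<Union>q\<in>{..<2 * d} - {p}. A q)"
    by (intro closedin_Union) (auto intro: closed)
  ultimately have "closedin (top_of_set ?J) (?J - A p)" by simp
  then have "openin (top_of_set ?J) (A p)"
    unfolding openin_closedin_eq by (auto simp: A_def)
  moreover have "connected ?J" by simp
  ultimately have "A p = {} \<or> A p = ?J"
    using closed[of p] unfolding connected_clopen by blast
  then have eq: "A p = ?J" using p(2) by blast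
  have "f x = pos_fun j p x" if "lo j < x" "x < hi j" for x
  proof -
    have "x \<in> A p" unfolding eq using that by simp
    then show ?thesis by (simp add: A_def)
  qed
  then show ?thesis using p(1) by blast
qed

text \<open>Letting \<open>x\<close> tend to the crossing from both sides shows that the sequence of positions is legal.\<close>

lemma obtain_track:
  assumes cont: "continuous_on {-1..real K + 1} f"
    and front: "(\<lambda>x. (x, f x)) ` {-1..real K + 1} \<subseteq> front [knot]"
  obtains t where "legal t" "\<And>x. -1 \<le> x \<Longrightarrow> x \<le> real K + 1 \<Longrightarrow> f x = path_fun t x"
proof -
  have "\<exists>p<2 * d. \<forall>x. lo j \<le> x \<longrightarrow> x \<le> hi j \<longrightarrow> f x = pos_fun j p x" if j: "j \<le> K" for j
  proof -
    have sub: "{lo j..hi j} \<subseteq> {-1..real K + 1}" using slab_bounds[OF j] by auto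
    have "\<exists>p<2 * d. \<forall>x. lo j < x \<longrightarrow> x < hi j \<longrightarrow> f x = pos_fun j p x"
    proof (rule slab_position[OF j])
      show "continuous_on {lo j<..<hi j} f"
        by (rule continuous_on_subset[OF cont]) (use sub in auto)
      show "(x, f x) \<in> front [knot]" if "lo j < x" "x < hi j" for x
        using front sub that by (auto simp: image_subset_iff)
    qed
    then obtain p where p: "p < 2 * d" "\<And>x. lo j < x \<Longrightarrow> x < hi j \<Longrightarrow> f x = pos_fun j p x" by blast
    have cl: "closure {lo j<..<hi j} = {lo j..hi j}" using lo_less_hi[OF j] by simp
    have c: "continuous_on (closure {lo j<..<hi j}) (\<lambda>x. f x - pos_fun j p x)"
      unfolding cl by (intro continuous_on_diff continuous_on_subset[OF cont sub] continuous_pos_fun)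
    have "f x = pos_fun j p x" if "lo j \<le> x" "x \<le> hi j" for x
      using continuous_constant_on_closure[OF c, of 0 x] p(2) that unfolding cl by simp
    then show ?thesis using p(1) by (intro exI[of _ p]) simp
  qed
  then obtain t where t: "\<And>j. j \<le> K \<Longrightarrow> t j < 2 * d"
    "\<And>j x. j \<le> K \<Longrightarrow> lo j \<le> x \<Longrightarrow> x \<le> hi j \<Longrightarrow> f x = pos_fun j (t j) x" by metis
  have lt: "legal t"
    unfolding legal_def
  proof (intro conjI allI impI)
    fix j assume j: "j < K"
    have "pos_fun j (t j) (real j + 1/2) = f (real j + 1/2)"
      using t(2)[of j "real j + 1/2"] j lo_less_hi[of j] by (simp add: hi_less_K)
    also have "\<dots> = pos_fun (Suc j) (t (Suc j)) (real j + 1/2)"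
      using t(2)[of "Suc j" "real j + 1/2"] j lo_less_hi[of "Suc j"] by (simp add: lo_Suc)
    also have "\<dots> = pos_fun j (t (Suc j)) (real j + 1/2)" by (rule pos_fun_Suc_crossing[OF j])
    finally show "t (Suc j) = t j \<or> t (Suc j) = sw (W ! j) (t j)"
      unfolding pos_fun_crossing_eq_iff[OF j] .
  qed (use t(1) in simp)
  have tx: "f x = path_fun t x" if I: "-1 \<le> x" "x \<le> real K + 1" for x
    unfolding path_fun_def by (rule t(2)[OF level_le level_slab[OF I]])
  show thesis by (rule that[OF lt tx])
qed

lemma mem_path: "(x, z) \<in> path t \<longleftrightarrow> -1 \<le> x \<and> x \<le> real K + 1 \<and> z = path_fun t x"
  unfolding path_def image_iff Bex_def atLeastAtMost_iff prod.inject by blast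

lemma path_eqD:
  assumes "legal t" "legal s" "path t = path s" "j \<le> K"
  shows "t j = s j"
proof -
  define x where "x = (lo j + hi j) / 2"
  have x: "lo j < x" "x < hi j" using lo_less_hi[OF assms(4)] by (auto simp: x_def)
  have "(x, path_fun t x) \<in> path s"
    unfolding assms(3)[symmetric] mem_path using slab_bounds[OF assms(4)] x by simp
  then have "path_fun t x = path_fun s x" by (simp add: mem_path)
  then show ?thesis
    using path_fun_slab[OF assms(1,4)] path_fun_slab[OF assms(2,4)] x
      pos_fun_eq_iff[OF assms(4) x legal_less[OF assms(1,4)] legal_less[OF assms(2,4)]] by simp
qed

text \<open>Ruling disks in terms of positions: the last clause excludes that the boundary paths of the disk
  meet at a crossing.\<close>

definition disk_tracks :: "disk \<Rightarrow> (nat \<Rightarrow> nat) \<Rightarrow> (nat \<Rightarrow> nat) \<Rightarrow> bool" where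
  "disk_tracks R u l \<longleftrightarrow> R = (path u, path l) \<and> legal u \<and> legal l \<and> l 0 = adj (u 0) \<and> l K = adj (u K) \<and>
     (\<forall>j\<le>K. u j < l j) \<and> (\<forall>j<K. \<not> (u j = W ! j \<and> l j = Suc (W ! j)))"

lemma left_cusp_front: "(x, z) \<in> front_proj ` left_cusps [knot] \<longleftrightarrow> x = -1 \<and> (\<exists>p<2 * d. z = pos_fun 0 p (-1))"
proof -
  have "left_cusps [knot] = (\<lambda>p. strand_point p (-1)) ` {p. p < 2 * d}"
    unfolding left_cusps_knot image_def Bex_def mem_Collect_eq by (rule Collect_cong) blast
  then have "front_proj ` left_cusps [knot] = (\<lambda>p. (-1, pos_fun 0 p (-1))) ` {p. p < 2 * d}"
    by (simp add: image_image front_proj_strand pos_fun_def)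
  then show ?thesis by auto
qed

lemma right_cusp_front: "(x, z) \<in> front_proj ` right_cusps [knot] \<longleftrightarrow> x = real K + 1 \<and> (\<exists>p<2 * d. z = Z p (real K + 1))"
proof -
  have "right_cusps [knot] = (\<lambda>p. strand_point p (real K + 1)) ` {p. p < 2 * d}"
    unfolding right_cusps_knot image_def Bex_def mem_Collect_eq by (rule Collect_cong) blast
  then have "front_proj ` right_cusps [knot] = (\<lambda>p. (real K + 1, Z p (real K + 1))) ` {p. p < 2 * d}"
    by (simp add: image_image front_proj_strand pos_fun_def)
  then show ?thesis by auto
qed

lemma ruling_disk_tracks:
  assumes "ruling_disk [knot] R"
  obtains u l where "disk_tracks R u l"
proof -
  obtain a b f g where cont: "continuous_on {a..b} f" "continuous_on {a..b} g"
    and R: "fst R = (\<lambda>x. (x, f x)) ` {a..b}" "snd R = (\<lambda>x. (x, g x)) ` {a..b}" "boundary R \<subseteq> front [knot]"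
    and ends: "f a = g a" "(a, f a) \<in> front_proj ` left_cusps [knot]" "f b = g b" "(b, f b) \<in> front_proj ` right_cusps [knot]"
    and fg: "\<forall>x. a < x \<and> x < b \<longrightarrow> g x < f x"
    using assms unfolding ruling_disk_def by (elim exE conjE) (rule that; assumption)
  have less: "g x < f x" if "a < x" "x < b" for x using fg that by simp
  have a: "a = -1" using ends(2) by (simp add: left_cusp_front)
  have b: "b = real K + 1" using ends(4) by (simp add: right_cusp_front)
  have front: "(\<lambda>x. (x, f x)) ` {-1..real K + 1} \<subseteq> front [knot]" "(\<lambda>x. (x, g x)) ` {-1..real K + 1} \<subseteq> front [knot]"
    using R unfolding boundary_def a b by auto
  obtain u where u: "legal u" "\<And>x. -1 \<le> x \<Longrightarrow> x \<le> real K + 1 \<Longrightarrow> f x = path_fun u x"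
    using obtain_track[OF cont(1)[unfolded a b] front(1)] by blast
  obtain l where l: "legal l" "\<And>x. -1 \<le> x \<Longrightarrow> x \<le> real K + 1 \<Longrightarrow> g x = path_fun l x"
    using obtain_track[OF cont(2)[unfolded a b] front(2)] by blast
  have "fst R = path u" "snd R = path l"
    unfolding R(1,2) path_def a b using u(2) l(2) by (intro image_cong; simp)+
  then have "R = (path u, path l)" by (simp add: prod_eq_iff)
  moreover have ul: "u j < l j" if j: "j \<le> K" for j
  proof -
    define x where "x = (lo j + hi j) / 2"
    have x: "lo j < x" "x < hi j" using lo_less_hi[OF j] by (auto simp: x_def)
    then have "g x < f x" using less[of x] slab_bounds[OF j] a b by simp
    then show ?thesis
      using u(2)[of x] l(2)[of x] x slab_bounds[OF j] path_fun_slab[OF u(1) j, of x] path_fun_slab[OF l(1) j, of x]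
        pos_fun_order_iff[OF j x legal_less[OF u(1) j] legal_less[OF l(1) j]] by simp
  qed
  moreover have "l 0 = adj (u 0)"
  proof -
    have "path_fun u (-1) = path_fun l (-1)" using ends(1) u(2)[of "-1"] l(2)[of "-1"] a by simp
    moreover have "lo 0 = -1" "-1 \<le> hi 0" by (auto simp: lo_def hi_def)
    ultimately have "pos_fun 0 (u 0) (-1) = pos_fun 0 (l 0) (-1)"
      using path_fun_slab[OF u(1), of 0 "-1"] path_fun_slab[OF l(1), of 0 "-1"] by simp
    then show ?thesis using pos_fun_left ul[of 0] by auto
  qed
  moreover have "l K = adj (u K)"
  proof -
    have "path_fun u (real K + 1) = path_fun l (real K + 1)" using ends(3) u(2)[of "real K + 1"] l(2)[of "real K + 1"] b by simp
    moreover have "hi K = real K + 1" "lo K \<le> real K + 1" by (auto simp: lo_def hi_def)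
    ultimately have "pos_fun K (u K) (real K + 1) = pos_fun K (l K) (real K + 1)"
      using path_fun_slab[OF u(1), of K "real K + 1"] path_fun_slab[OF l(1), of K "real K + 1"] by simp
    then show ?thesis using pos_fun_right[OF legal_less[OF u(1) le_refl] legal_less[OF l(1) le_refl]] ul[OF le_refl] by auto
  qed
  moreover have "\<not> (u j = W ! j \<and> l j = Suc (W ! j))" if j: "j < K" for j
  proof
    assume *: "u j = W ! j \<and> l j = Suc (W ! j)"
    have x: "lo j \<le> real j + 1/2" "real j + 1/2 \<le> hi j" using j lo_less_hi[of j] by (simp_all add: hi_less_K)
    have I: "-1 < real j + 1/2" "real j + 1/2 < real K + 1" using j by auto
    have "pos_fun j (u j) (real j + 1/2) = pos_fun j (l j) (real j + 1/2)"
      unfolding pos_fun_crossing_eq_iff[OF j] using * by simp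
    then have "f (real j + 1/2) = g (real j + 1/2)"
      using u(2)[of "real j + 1/2"] l(2)[of "real j + 1/2"] I path_fun_slab[OF u(1) _ x] path_fun_slab[OF l(1) _ x] j by simp
    then show False using less[of "real j + 1/2"] I a b by simp
  qed
  ultimately have "disk_tracks R u l" using u(1) l(1) by (simp add: disk_tracks_def)
  then show thesis by (rule that)
qed

lemma disk_tracks_less:
  assumes "disk_tracks R u l" "-1 < x" "x < real K + 1"
  shows "path_fun l x < path_fun u x"
proof -
  note R = assms(1)[unfolded disk_tracks_def]
  from assms(2,3) have "-1 \<le> x" "x \<le> real K + 1" by auto
  then show ?thesis
  proof (cases rule: level_cases)
    case (3 j)
    then show ?thesis
      using R path_fun_slab[of u j x] path_fun_slab[of l j x] pos_fun_order[OF 3, of "u j" "l j"] legal_less[of u j] legal_less[of l j]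
      by simp
  next
    case (4 j)
    have x: "lo j \<le> x" "x \<le> hi j" using 4 lo_less_hi[of j] by (simp_all add: hi_less_K)
    then show ?thesis
      using R path_fun_slab[of u j x] path_fun_slab[of l j x] pos_fun_crossing_order[OF 4(1), of "u j" "l j"] 4
      by simp
  qed (use assms in auto)
qed

lemma disk_tracks_ruling_disk:
  assumes "disk_tracks R u l"
  shows "ruling_disk [knot] R"
proof -
  note R = assms[unfolded disk_tracks_def]
  have lu: "legal u" "legal l" using R by auto
  have ends: "lo 0 = -1" "-1 \<le> hi 0" "hi K = real K + 1" "lo K \<le> real K + 1" by (auto simp: lo_def hi_def)
  have l0: "path_fun u (-1) = pos_fun 0 (u 0) (-1)" "path_fun l (-1) = pos_fun 0 (l 0) (-1)"
    using path_fun_slab[OF lu(1), of 0 "-1"] path_fun_slab[OF lu(2), of 0 "-1"] ends by simp_all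
  have r0: "path_fun u (real K + 1) = pos_fun K (u K) (real K + 1)" "path_fun l (real K + 1) = pos_fun K (l K) (real K + 1)"
    using path_fun_slab[OF lu(1), of K "real K + 1"] path_fun_slab[OF lu(2), of K "real K + 1"] ends by simp_all
  show ?thesis
    unfolding ruling_disk_def
  proof (rule exI[of _ "-1"], rule exI[of _ "real K + 1"], rule exI[of _ "path_fun u"],
      rule exI[of _ "path_fun l"], intro conjI allI impI)
    show "continuous_on {-1..real K + 1} (path_fun u)" "continuous_on {-1..real K + 1} (path_fun l)"
      by (rule continuous_path_fun[OF lu(1)], rule continuous_path_fun[OF lu(2)])
    show "fst R = (\<lambda>x. (x, path_fun u x)) ` {-1..real K + 1}" "snd R = (\<lambda>x. (x, path_fun l x)) ` {-1..real K + 1}"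
      using R by (simp_all add: path_def)
    show "boundary R \<subseteq> front [knot]"
      using R path_subset_front[OF lu(1)] path_subset_front[OF lu(2)] by (simp add: boundary_def)
    show "path_fun u (-1) = path_fun l (-1)" unfolding l0 pos_fun_left using R by simp
    show "(-1, path_fun u (-1)) \<in> front_proj ` left_cusps [knot]"
      unfolding left_cusp_front l0 using legal_less[OF lu(1), of 0] by (intro conjI refl exI[of _ "u 0"]) simp_all
    show "path_fun u (real K + 1) = path_fun l (real K + 1)"
      unfolding r0 using pos_fun_right[of "u K" "l K"] legal_less[OF lu(1), of K] legal_less[OF lu(2), of K] R by simp
    show "(real K + 1, path_fun u (real K + 1)) \<in> front_proj ` right_cusps [knot]"
      unfolding right_cusp_front r0 pos_fun_def using legal_less[OF lu(1), of K] untrack_less_iff[of K]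
      by (intro conjI refl exI[of _ "lab W K (u K)"]) simp_all
    show "path_fun l x < path_fun u x" if "-1 < x \<and> x < real K + 1" for x
      by (rule disk_tracks_less[OF assms]) (use that in auto)
  qed simp
qed

end

section \<open>The ruling of a set of switches\<close>

context plat_knot begin

text \<open>The other position of the disk that bounds position \<open>i\<close> after \<open>j\<close> crossings.\<close>

definition partner :: "nat set \<Rightarrow> nat \<Rightarrow> nat \<Rightarrow> nat" where
  "partner S j i = track W S j (adj (untrack W S j i))"

definition ruling_disk_of :: "nat set \<Rightarrow> nat \<Rightarrow> disk" where
  "ruling_disk_of S q = (path (\<lambda>j. track W S j (2 * q)), path (\<lambda>j. track W S j (Suc (2 * q))))"

definition ruling_of :: "nat set \<Rightarrow> disk set" where
  "ruling_of S = ruling_disk_of S ` {..<d}"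

text \<open>
  The clauses say, in this order, that no disk is pinched at a crossing, that switches have degree 0 and
  are normal, and that the two paths of each disk end in a common right cusp.
\<close>

definition valid_switches :: "nat set \<Rightarrow> bool" where
  "valid_switches S \<longleftrightarrow> S \<subseteq> {..<K} \<and> (\<forall>j<K. partner S j (W ! j) \<noteq> Suc (W ! j)) \<and>
     (\<forall>j\<in>S. (even (upper_strand j) \<longleftrightarrow> even (lower_strand j)) \<and> noncrossing_at (partner S j) (W ! j)) \<and>
     partner S K = adj"

lemma adj_less: "adj p < 2 * d \<longleftrightarrow> p < 2 * d"
  by (auto simp: adj_def; presburger)

lemma legal_track: "p < 2 * d \<Longrightarrow> legal (\<lambda>j. track W S j p)"
  by (auto simp: legal_def track_less_iff)

lemma track_outside: "j \<le> K \<Longrightarrow> \<not> p < 2 * d \<Longrightarrow> track W S j p = p"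
proof (induction j)
  case (Suc j)
  then have "Suc (W ! j) < 2 * d" using W_less by simp
  then show ?case using Suc by (auto simp: sw_def)
qed simp

lemma untrack_outside: "j \<le> K \<Longrightarrow> \<not> p < 2 * d \<Longrightarrow> untrack W S j p = p"
  using track_outside[of j p S] by (metis untrack_track)

lemma disk_tracks_of:
  assumes "valid_switches S" "q < d"
  shows "disk_tracks (ruling_disk_of S q) (\<lambda>j. track W S j (2 * q)) (\<lambda>j. track W S j (Suc (2 * q)))"
proof -
  have q: "2 * q < 2 * d" "Suc (2 * q) < 2 * d" "adj (2 * q) = Suc (2 * q)" using assms(2) by (auto simp: adj_def)
  have ne: "\<not> (track W S j (2 * q) = W ! j \<and> track W S j (Suc (2 * q)) = Suc (W ! j))" if "j < K" for j
  proof
    assume "track W S j (2 * q) = W ! j \<and> track W S j (Suc (2 * q)) = Suc (W ! j)"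
    then have "partner S j (W ! j) = Suc (W ! j)"
      unfolding partner_def using q(3) untrack_track[of W S j "2 * q"] by simp
    then show False using assms(1) that unfolding valid_switches_def by blast
  qed
  have less: "track W S j (2 * q) < track W S j (Suc (2 * q))" if "j \<le> K" for j
    using that
  proof (induction j)
    case (Suc j)
    then show ?case using ne[of j] sw_order[of "track W S j (2 * q)" "track W S j (Suc (2 * q))" "W ! j"] by auto
  qed simp
  have "track W S K (Suc (2 * q)) = adj (track W S K (2 * q))"
  proof -
    have "adj (track W S K (2 * q)) = partner S K (track W S K (2 * q))"
      using assms(1) by (simp add: valid_switches_def)
    then show ?thesis by (simp add: partner_def q(3))
  qed
  then show ?thesis
    unfolding disk_tracks_def ruling_disk_of_def
    using legal_track[OF q(1), of S] legal_track[OF q(2), of S] q(3) less ne by simp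
qed

lemma boundary_of:
  "boundary (ruling_disk_of S q) = path (\<lambda>j. track W S j (2 * q)) \<union> path (\<lambda>j. track W S j (Suc (2 * q)))"
  by (simp add: boundary_def ruling_disk_of_def)

lemma mem_boundary_of:
  "v \<in> boundary (ruling_disk_of S q) \<longleftrightarrow> (\<exists>r. r div 2 = q \<and> v \<in> path (\<lambda>j. track W S j r))"
proof -
  have "r div 2 = q \<longleftrightarrow> r = 2 * q \<or> r = Suc (2 * q)" for r :: nat by presburger
  then show ?thesis unfolding boundary_of by auto
qed

lemma path_at_crossing:
  assumes "legal t" "j < K"
  shows "crossing_point j \<in> path t \<longleftrightarrow> t j = W ! j \<or> t j = Suc (W ! j)"
proof -
  have x: "lo j \<le> real j + 1/2" "real j + 1/2 \<le> hi j" "j \<le> K" using assms(2) lo_less_hi[of j] by (simp_all add: hi_less_K)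
  have "crossing_point j \<in> path t \<longleftrightarrow> pos_fun j (W ! j) (real j + 1/2) = pos_fun j (t j) (real j + 1/2)"
    unfolding crossing_point_def mem_path path_fun_slab[OF assms(1) x(3,1,2)] using assms(2) by (simp add: pos_fun_def)
  also have "\<dots> \<longleftrightarrow> t j = W ! j \<or> t j = Suc (W ! j)"
    unfolding pos_fun_crossing_eq_iff[OF assms(2)] by simp
  finally show ?thesis .
qed

text \<open>Two paths that never share a position can only meet where different positions have the same height,
  which happens only at crossings and cusps.\<close>

lemma paths_meet:
  assumes "legal t" "legal s" "\<And>j. j \<le> K \<Longrightarrow> t j \<noteq> s j" "(x, z) \<in> path t" "(x, z) \<in> path s"
  shows "(x, z) \<in> crossings [knot] \<union> front_proj ` cusps [knot]"
proof -
  have x: "-1 \<le> x" "x \<le> real K + 1" and z: "z = path_fun t x" "z = path_fun s x"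
    using assms(4,5) by (auto simp: mem_path)
  from x show ?thesis
  proof (cases rule: level_cases)
    case 1
    have "(x, z) \<in> front [knot]" using path_subset_front[OF assms(1)] assms(4) by blast
    moreover have "lo 0 \<le> x" "x \<le> hi 0" using 1 by (simp_all add: lo_def hi_def)
    ultimately obtain p where "p < 2 * d" "z = pos_fun 0 p (-1)"
      using front_pos_fun[of 0 x z] 1 by auto
    then have "(x, z) \<in> front_proj ` left_cusps [knot]" using left_cusp_front 1 by blast
    then show ?thesis unfolding cusps_knot by blast
  next
    case 2
    have "(x, z) \<in> front [knot]" using path_subset_front[OF assms(1)] assms(4) by blast
    moreover have "lo K \<le> x" "x \<le> hi K" using 2 by (simp_all add: lo_def hi_def)
    ultimately obtain p where "p < 2 * d" "z = pos_fun K p (real K + 1)"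
      using front_pos_fun[of K x z] 2 by auto
    then have "(x, z) \<in> front_proj ` right_cusps [knot]"
      unfolding right_cusp_front using 2 untrack_less_iff[of K "{}" p] by (auto simp: pos_fun_def)
    then show ?thesis unfolding cusps_knot by blast
  next
    case (3 j)
    then have "t j = s j"
      using z path_fun_slab[OF assms(1), of j x] path_fun_slab[OF assms(2), of j x]
        pos_fun_eq_iff[OF 3 legal_less[OF assms(1) 3(1)] legal_less[OF assms(2) 3(1)]] by simp
    then show ?thesis using assms(3) 3 by blast
  next
    case (4 j)
    have sl: "lo j \<le> x" "x \<le> hi j" "j \<le> K" using 4 lo_less_hi[of j] by (simp_all add: hi_less_K)
    have "pos_fun j (t j) x = pos_fun j (s j) x"
      using z path_fun_slab[OF assms(1) sl(3,1,2)] path_fun_slab[OF assms(2) sl(3,1,2)] by simp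
    then have "s j = sw (W ! j) (t j)"
      using assms(3)[OF sl(3)] unfolding 4(2) pos_fun_crossing_eq_iff[OF 4(1)] by simp
    then have "t j = W ! j \<or> t j = Suc (W ! j)" using assms(3)[OF sl(3)] by (metis sw_other)
    then have "crossing_point j \<in> path t" using path_at_crossing[OF assms(1) 4(1)] by simp
    then have "(x, z) = crossing_point j" using z(1) 4(2) by (simp add: crossing_point_def mem_path)
    then show ?thesis unfolding crossings_knot using 4(1) by blast
  qed
qed

lemma Z_deriv:
  assumes "j < K"
  shows "(Z p has_real_derivative Y p (real j + 1/2)) (at (real j + 1/2))"
proof -
  let ?x = "real j + 1/2"
  have "\<forall>\<^sub>F x in nhds ?x. x \<in> {0<..<real K}" using assms by (intro eventually_nhds_in_open) auto
  then have ev: "\<forall>\<^sub>F x in nhds ?x. Z p x = height p x"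
    by eventually_elim (simp add: Z_pinch pinch_0)
  have "Y p ?x = height' p ?x"
    using assms by (simp add: Y_def yval_def cutoff_1 cutoff'_0)
  then show ?thesis using height_deriv[of p ?x] by (subst DERIV_cong_ev[OF refl ev refl]) simp
qed

lemma eventually_near_crossing:
  assumes "j < K"
  shows "\<forall>\<^sub>F x in nhds (real j + 1/2). lo j < x \<and> x < hi (Suc j)"
proof -
  have "real j + 1/2 \<in> {lo j<..<hi (Suc j)}"
    using assms lo_less_hi[of j] lo_less_hi[of "Suc j"] by (simp add: hi_less_K lo_Suc)
  then have "\<forall>\<^sub>F x in nhds (real j + 1/2). x \<in> {lo j<..<hi (Suc j)}" by (intro eventually_nhds_in_open) auto
  then show ?thesis by (rule eventually_mono) simp
qed

lemma path_fun_before: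
  assumes "legal t" "j < K" "lo j < x" "x \<le> real j + 1/2"
  shows "path_fun t x = Z (lab W j (t j)) x"
  using path_fun_slab[OF assms(1), of j x] assms(2-4) by (simp add: hi_less_K pos_fun_def)

lemma path_fun_after:
  assumes "legal t" "j < K" "real j + 1/2 \<le> x" "x < hi (Suc j)"
  shows "path_fun t x = Z (lab W j (sw (W ! j) (t (Suc j)))) x"
  using path_fun_slab[OF assms(1), of "Suc j" x] assms(2-4) by (simp add: lo_Suc pos_fun_def)

lemma has_derivative_within_unique:
  fixes f g :: "real \<Rightarrow> real"
  assumes "(f has_real_derivative D) (at a)" "(g has_real_derivative E) (at a)"
    and "\<forall>\<^sub>F x in at a within T. f x = g x" "f a = g a" and "at a within T \<noteq> bot"
  shows "D = E"
proof -
  have lim: "((\<lambda>x. (f x - f a) / (x - a)) \<longlongrightarrow> D) (at a within T)" "((\<lambda>x. (g x - g a) / (x - a)) \<longlongrightarrow> E) (at a within T)"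
    using assms(1,2)[THEN DERIV_subset[where t = T]] unfolding has_field_derivative_iff by auto
  have "\<forall>\<^sub>F x in at a within T. (f x - f a) / (x - a) = (g x - g a) / (x - a)"
    using assms(3) by eventually_elim (simp add: assms(4))
  then have "((\<lambda>x. (g x - g a) / (x - a)) \<longlongrightarrow> D) (at a within T)"
    using lim(1) by (rule Lim_transform_eventually[rotated])
  then show ?thesis using lim(2) by (rule tendsto_unique[OF assms(5)])
qed

text \<open>The one-sided slopes of a path at a crossing are the slopes of the strands that it follows before and
  after it. They agree iff the path stays on its strand, because the two strands
  of a crossing are transverse.\<close>

lemma path_smooth_iff:
  assumes t: "legal t" and j: "j < K" and tj: "t j = W ! j \<or> t j = Suc (W ! j)"
  shows "path_smooth_at (path t) (crossing_point j) \<longleftrightarrow> t (Suc j) = sw (W ! j) (t j)"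
proof
  let ?x = "real j + 1/2"
  assume "path_smooth_at (path t) (crossing_point j)"
  then obtain f where f: "f differentiable (at ?x)" "\<forall>\<^sub>F x in nhds ?x. (x, f x) \<in> path t"
    unfolding path_smooth_at_def by (auto simp: crossing_point_def)
  then obtain D where D: "(f has_real_derivative D) (at ?x)" by (auto simp: real_differentiable_def)
  have ev: "\<forall>\<^sub>F x in nhds ?x. f x = path_fun t x \<and> lo j < x \<and> x < hi (Suc j)"
    using f(2) eventually_near_crossing[OF j] by eventually_elim (simp add: mem_path)
  let ?p = "lab W j (t j)" and ?q = "lab W j (sw (W ! j) (t (Suc j)))"
  have at: "f ?x = path_fun t ?x" "lo j < ?x" "?x < hi (Suc j)" using eventually_nhds_x_imp_x[OF ev] by auto
  have "D = Y ?p ?x"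
  proof (rule has_derivative_within_unique[OF D Z_deriv[OF j]])
    have "\<forall>\<^sub>F x in at_left ?x. f x = path_fun t x \<and> lo j < x \<and> x < hi (Suc j)"
      using ev unfolding eventually_at_filter by eventually_elim auto
    moreover have "\<forall>\<^sub>F x in at_left ?x. x < ?x" by (simp add: eventually_at_filter)
    ultimately show "\<forall>\<^sub>F x in at_left ?x. f x = Z ?p x"
      by eventually_elim (simp add: path_fun_before[OF t j])
    show "f ?x = Z ?p ?x" using at path_fun_before[OF t j] by simp
    show "at_left ?x \<noteq> bot" by simp
  qed
  moreover have "D = Y ?q ?x"
  proof (rule has_derivative_within_unique[OF D Z_deriv[OF j]])
    have "\<forall>\<^sub>F x in at_right ?x. f x = path_fun t x \<and> lo j < x \<and> x < hi (Suc j)"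
      using ev unfolding eventually_at_filter by eventually_elim auto
    moreover have "\<forall>\<^sub>F x in at_right ?x. x > ?x" by (simp add: eventually_at_filter)
    ultimately show "\<forall>\<^sub>F x in at_right ?x. f x = Z ?q x"
      by eventually_elim (simp add: path_fun_after[OF t j])
    show "f ?x = Z ?q ?x" using at path_fun_after[OF t j] by simp
    show "at_right ?x \<noteq> bot" by simp
  qed
  ultimately have eq: "Y ?p ?x = Y ?q ?x" by simp
  show "t (Suc j) = sw (W ! j) (t j)"
  proof (rule ccontr)
    assume "t (Suc j) \<noteq> sw (W ! j) (t j)"
    then have "t (Suc j) = t j" using t j by (auto simp: legal_def)
    then show False using eq tj crossing_strands(5)[OF j] by auto
  qed
next
  let ?x = "real j + 1/2"
  assume sw: "t (Suc j) = sw (W ! j) (t j)"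
  let ?p = "lab W j (t j)"
  have "Z ?p differentiable (at ?x)" using Z_deriv[OF j] real_differentiable_def by blast
  moreover have "\<forall>\<^sub>F x in nhds ?x. (x, Z ?p x) \<in> path t"
    using eventually_near_crossing[OF j]
  proof eventually_elim
    case (elim x)
    then have I: "-1 \<le> x" "x \<le> real K + 1" using slab_bounds[of j] slab_bounds[of "Suc j"] j by auto
    show ?case
    proof (cases "x \<le> ?x")
      case True
      then show ?thesis using path_fun_before[OF t j] elim I by (simp add: mem_path)
    next
      case False
      then show ?thesis using path_fun_after[OF t j, of x] elim I sw by (simp add: mem_path)
    qed
  qed
  ultimately show "path_smooth_at (path t) (crossing_point j)"
    unfolding path_smooth_at_def by (auto simp: crossing_point_def)
qed

text \<open>Every switch in \<open>S\<close> is visible as a corner of some path, since the path in position \<open>W ! j\<close> passes through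
  the crossing.\<close>

lemma switches_of:
  assumes "S \<subseteq> {..<K}"
  shows "switches [knot] (ruling_of S) = crossing_point ` S"
proof (intro equalityI subsetI)
  fix v assume "v \<in> switches [knot] (ruling_of S)"
  then obtain j q P where j: "j < K" "v = crossing_point j" and q: "q < d"
    and P: "P = path (\<lambda>j. track W S j (2 * q)) \<or> P = path (\<lambda>j. track W S j (Suc (2 * q)))" "v \<in> P" "\<not> path_smooth_at P v"
    unfolding switches_def crossings_knot ruling_of_def ruling_disk_of_def by auto
  obtain r where r: "r < 2 * d" "P = path (\<lambda>j. track W S j r)"
    using P(1)
  proof
    assume "P = path (\<lambda>j. track W S j (2 * q))"
    then show thesis using q by (intro that[of "2 * q"]) simp_all
  next
    assume "P = path (\<lambda>j. track W S j (Suc (2 * q)))"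
    then show thesis using q by (intro that[of "Suc (2 * q)"]) simp_all
  qed
  have tj: "track W S j r = W ! j \<or> track W S j r = Suc (W ! j)"
    using P(2) unfolding r(2) j(2) path_at_crossing[OF legal_track[OF r(1)] j(1)] .
  have "track W S (Suc j) r \<noteq> sw (W ! j) (track W S j r)"
    using P(3) unfolding r(2) j(2) path_smooth_iff[OF legal_track[OF r(1)] j(1) tj] .
  then have "j \<in> S" by (auto split: if_splits)
  then show "v \<in> crossing_point ` S" using j(2) by blast
next
  fix v assume "v \<in> crossing_point ` S"
  then obtain j where j: "j \<in> S" "v = crossing_point j" by blast
  then have jK: "j < K" using assms by auto
  define r where "r = untrack W S j (W ! j)"
  have r: "r < 2 * d" using W_less jK untrack_less_iff[of j S "W ! j"] unfolding r_def by (metis Suc_lessD less_imp_le nth_mem)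
  have tj: "track W S j r = W ! j \<or> track W S j r = Suc (W ! j)" by (simp add: r_def)
  have mem: "v \<in> path (\<lambda>j. track W S j r)"
    unfolding j(2) path_at_crossing[OF legal_track[OF r] jK] by (rule tj)
  have "track W S j r \<noteq> sw (W ! j) (track W S j r)" using tj by auto
  then have ns: "\<not> path_smooth_at (path (\<lambda>j. track W S j r)) v"
    unfolding j(2) path_smooth_iff[OF legal_track[OF r] jK tj] using j(1) by simp
  have "r = 2 * (r div 2) \<or> r = Suc (2 * (r div 2))" by presburger
  then have "path (\<lambda>j. track W S j r) \<in> {fst (ruling_disk_of S (r div 2)), snd (ruling_disk_of S (r div 2))}"
    unfolding ruling_disk_of_def by (metis fst_conv snd_conv insert_iff)
  moreover have "ruling_disk_of S (r div 2) \<in> ruling_of S" using r by (auto simp: ruling_of_def)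
  moreover have "v \<in> crossings [knot]" unfolding crossings_knot using j jK by blast
  ultimately show "v \<in> switches [knot] (ruling_of S)"
    unfolding switches_def using mem ns by blast
qed

lemma slice_disk:
  assumes "-1 \<le> x" "x \<le> real K + 1"
  shows "slice (path u, path l) x = {path_fun l x..path_fun u x}"
  unfolding slice_def by (auto simp: mem_path assms)

end

section \<open>Normality\<close>

context plat_knot begin

abbreviation nested :: "'a set \<Rightarrow> 'a set \<Rightarrow> bool" where
  "nested A B \<equiv> A \<inter> B = {} \<or> A \<subseteq> B \<or> B \<subseteq> A"

text \<open>For pairs of positions: each pair has exactly one member strictly between the members of the other one.\<close>

definition interleaved :: "nat \<Rightarrow> nat \<Rightarrow> nat \<Rightarrow> nat \<Rightarrow> bool" where
  "interleaved u l u' l' \<longleftrightarrow> u < u' \<and> u' < l \<and> l < l' \<or> u' < u \<and> u < l' \<and> l' < l"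

lemma intervals_nested_iff:
  fixes G :: "nat \<Rightarrow> real"
  assumes G: "\<And>p q. p < 2 * d \<Longrightarrow> q < 2 * d \<Longrightarrow> p < q \<Longrightarrow> G q < G p"
    and less: "u < l" "u' < l'" "l < 2 * d" "l' < 2 * d" and ne: "u \<noteq> u'" "u \<noteq> l'" "l \<noteq> u'" "l \<noteq> l'"
  shows "nested {G l..G u} {G l'..G u'}
    \<longleftrightarrow> \<not> interleaved u l u' l'"
proof -
  have lt: "G q < G p \<longleftrightarrow> p < q" if "p < 2 * d" "q < 2 * d" for p q
    using G[OF that] G[OF that(2,1)] by (cases p q rule: linorder_cases) auto
  have le: "G q \<le> G p \<longleftrightarrow> p \<le> q" if "p < 2 * d" "q < 2 * d" for p q
    using lt[OF that(2,1)] by (auto simp: not_less[symmetric])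
  have b: "u < 2 * d" "u' < 2 * d" using less by auto
  have n: "G l \<le> G u" "G l' \<le> G u'" using le[of u l] le[of u' l'] less b by simp_all
  note f = le[OF less(3,4)] le[OF less(4,3)] le[OF b] le[OF b(2,1)] le[OF b(1) less(4)] le[OF b(2) less(3)]
  have 1: "{G l..G u} \<inter> {G l'..G u'} = {} \<longleftrightarrow> l < u' \<or> l' < u"
    unfolding Int_atLeastAtMost atLeastatMost_empty_iff max.bounded_iff min.bounded_iff
    using n f by (simp add: not_le) blast
  have 2: "{G l..G u} \<subseteq> {G l'..G u'} \<longleftrightarrow> u' \<le> u \<and> l \<le> l'"
    unfolding atLeastatMost_subset_iff using n f by simp blast
  have 3: "{G l'..G u'} \<subseteq> {G l..G u} \<longleftrightarrow> u \<le> u' \<and> l' \<le> l"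
    unfolding atLeastatMost_subset_iff using n f by simp blast
  show ?thesis unfolding 1 2 3 interleaved_def using less(1,2) ne by presburger
qed

lemma noncrossing_iff_not_interleaved:
  assumes less: "u < l" "u' < l'"
    and R: "u = i \<and> l = m i \<or> u = m i \<and> l = i" and R': "u' = Suc i \<and> l' = m (Suc i) \<or> u' = m (Suc i) \<and> l' = Suc i"
    and ne: "u \<noteq> u'" "u \<noteq> l'" "l \<noteq> u'" "l \<noteq> l'"
  shows "noncrossing_at m i \<longleftrightarrow> \<not> interleaved u l u' l'"
  using R R' less ne unfolding noncrossing_at_def interleaved_def by (elim disjE conjE; simp; presburger)

lemma interleaved_commute: "interleaved u l u' l' \<longleftrightarrow> interleaved u' l' u l"
  by (auto simp: interleaved_def)

lemma partner_track:
  assumes "r div 2 = q" "track W S j r = i"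
  shows "track W S j (2 * q) = i \<and> track W S j (Suc (2 * q)) = partner S j i \<or>
    track W S j (2 * q) = partner S j i \<and> track W S j (Suc (2 * q)) = i"
proof -
  have p: "partner S j i = track W S j (adj r)" by (simp add: partner_def flip: assms(2))
  consider "r = 2 * q" | "r = Suc (2 * q)" using assms(1) by linarith
  then show ?thesis using p assms(2) by cases (auto simp: adj_def)
qed

text \<open>At a switch, all paths keep their positions, so on both sides of the crossing the slices of the two disks are intervals
  whose end points are ordered by the same four positions; only their order matters.\<close>

lemma normality_iff:
  assumes j: "j \<in> S" "j < K" and q: "q < d" "q' < d" "q \<noteq> q'"
    and mem: "crossing_point j \<in> boundary (ruling_disk_of S q)" "crossing_point j \<in> boundary (ruling_disk_of S q')"
    and less: "track W S j (2 * q) < track W S j (Suc (2 * q))" "track W S j (2 * q') < track W S j (Suc (2 * q'))"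
  shows "(\<forall>\<^sub>F x in at (real j + 1/2). nested (slice (ruling_disk_of S q) x) (slice (ruling_disk_of S q') x)) \<longleftrightarrow> noncrossing_at (partner S j) (W ! j)"
proof -
  let ?t = "\<lambda>r. track W S j r"
  define u l u' l' where "u = ?t (2 * q)" and "l = ?t (Suc (2 * q))" and "u' = ?t (2 * q')" and "l' = ?t (Suc (2 * q'))"
  have b: "2 * q < 2 * d" "Suc (2 * q) < 2 * d" "2 * q' < 2 * d" "Suc (2 * q') < 2 * d" using q by auto
  have "Suc (2 * q) \<noteq> 2 * q'" "2 * q \<noteq> Suc (2 * q')" by presburger+
  then have ne: "u \<noteq> u'" "u \<noteq> l'" "l \<noteq> u'" "l \<noteq> l'" using q(3) unfolding u_def l_def u'_def l'_def by auto
  have lt: "l < 2 * d" "l' < 2 * d" using b j track_less_iff[of j S] by (auto simp: l_def l'_def)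
  have ul: "u < l" "u' < l'" using less by (simp_all add: u_def l_def u'_def l'_def)
  have slab: "nested {pos_fun k l x..pos_fun k u x} {pos_fun k l' x..pos_fun k u' x} \<longleftrightarrow> \<not> interleaved u l u' l'"
    if "k \<le> K" "lo k < x" "x < hi k" for k x
    by (rule intervals_nested_iff[OF _ ul lt ne]) (rule pos_fun_order[OF that])
  have near: "(nested (slice (ruling_disk_of S q) x) (slice (ruling_disk_of S q') x)) \<longleftrightarrow> \<not> interleaved u l u' l'"
    if x: "lo j < x" "x < hi (Suc j)" "x \<noteq> real j + 1/2" for x
  proof -
    have I: "-1 \<le> x" "x \<le> real K + 1" using slab_bounds[of j] slab_bounds[of "Suc j"] j x by auto
    obtain k where k: "k = j \<or> k = Suc j" "lo k < x" "x < hi k"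
    proof (cases "x < real j + 1/2")
      case True
      then show thesis using x j by (intro that[of j]) (simp_all add: hi_less_K)
    next
      case False
      then show thesis using x j by (intro that[of "Suc j"]) (simp_all add: lo_Suc)
    qed
    have kK: "k \<le> K" using k(1) j by auto
    have val: "path_fun (\<lambda>j. track W S j r) x = pos_fun k (?t r) x" if "r < 2 * d" for r
    proof -
      have "track W S k r = ?t r" using k(1) j(1) by auto
      then show ?thesis using path_fun_slab[OF legal_track[OF that, of S] kK] k by simp
    qed
    show ?thesis
      unfolding ruling_disk_of_def slice_disk[OF I] val[OF b(1)] val[OF b(2)] val[OF b(3)] val[OF b(4)]
      using slab[OF kK k(2,3)] by (simp add: u_def l_def u'_def l'_def)
  qed
  have ev: "\<forall>\<^sub>F x in at (real j + 1/2). lo j < x \<and> x < hi (Suc j) \<and> x \<noteq> real j + 1/2"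
    using eventually_near_crossing[OF j(2)] unfolding eventually_at_filter by eventually_elim simp
  have "(\<forall>\<^sub>F x in at (real j + 1/2). nested (slice (ruling_disk_of S q) x) (slice (ruling_disk_of S q') x)) \<longleftrightarrow>
      (\<forall>\<^sub>F x in at (real j + 1/2). \<not> interleaved u l u' l')"
    by (rule eventually_subst, use ev in eventually_elim) (use near in blast)
  also have "\<dots> \<longleftrightarrow> \<not> interleaved u l u' l'" by simp
  also have "\<dots> \<longleftrightarrow> noncrossing_at (partner S j) (W ! j)"
  proof -
    obtain r where r: "r div 2 = q" "crossing_point j \<in> path (\<lambda>j. track W S j r)" using mem(1) mem_boundary_of by blast
    obtain r' where r': "r' div 2 = q'" "crossing_point j \<in> path (\<lambda>j. track W S j r')" using mem(2) mem_boundary_of by blast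
    have rd: "r < 2 * d" "r' < 2 * d" using r(1) r'(1) q by auto
    have t: "?t r = W ! j \<or> ?t r = Suc (W ! j)" "?t r' = W ! j \<or> ?t r' = Suc (W ! j)"
      using r(2) r'(2) path_at_crossing[OF legal_track[OF rd(1)] j(2)] path_at_crossing[OF legal_track[OF rd(2)] j(2)] by auto
    have "?t r \<noteq> ?t r'" using r(1) r'(1) q(3) by auto
    then consider "?t r = W ! j" "?t r' = Suc (W ! j)" | "?t r = Suc (W ! j)" "?t r' = W ! j"
      using t by metis
    then show ?thesis
    proof cases
      case 1
      show ?thesis
        using noncrossing_iff_not_interleaved[OF ul, of "W ! j" "partner S j"] ne
          partner_track[OF r(1) 1(1)] partner_track[OF r'(1) 1(2)]
        unfolding u_def[symmetric] l_def[symmetric] u'_def[symmetric] l'_def[symmetric] by blast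
    next
      case 2
      show ?thesis
        using noncrossing_iff_not_interleaved[OF ul(2,1), of "W ! j" "partner S j"] ne
          partner_track[OF r(1) 2(1)] partner_track[OF r'(1) 2(2)] interleaved_commute[of u l u' l']
        unfolding u_def[symmetric] l_def[symmetric] u'_def[symmetric] l'_def[symmetric] by metis
    qed
  qed
  finally show ?thesis .
qed

text \<open>The disks cover the front because for each \<open>j\<close> the tracks permute the positions.\<close>

lemma graded_normal_ruling_of:
  assumes S: "valid_switches S"
  shows "graded_normal_ruling [knot] potential (ruling_of S)"
proof -
  have sub: "S \<subseteq> {..<K}" using S by (simp add: valid_switches_def)
  note sw = switches_of[OF sub]
  have disk: "ruling_disk [knot] R" if "R \<in> ruling_of S" for R
    using that disk_tracks_ruling_disk[OF disk_tracks_of[OF S]] by (auto simp: ruling_of_def)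
  have union: "(\<Union>R\<in>ruling_of S. boundary R) = front [knot]"
  proof (intro equalityI subsetI)
    fix v assume "v \<in> (\<Union>R\<in>ruling_of S. boundary R)"
    then obtain q r where "q < d" "r div 2 = q" and v: "v \<in> path (\<lambda>j. track W S j r)"
      unfolding ruling_of_def using mem_boundary_of by auto
    then have "r < 2 * d" by auto
    then show "v \<in> front [knot]" using path_subset_front[OF legal_track] v by blast
  next
    fix v assume v: "v \<in> front [knot]"
    obtain x z where xz: "v = (x, z)" by (cases v)
    then have I: "-1 \<le> x" "x \<le> real K + 1" using v unfolding front_knot by auto
    obtain p where p: "p < 2 * d" "z = pos_fun (level x) p x"
      using v unfolding xz front_pos_fun[OF level_le level_slab[OF I]] by blast
    define r where "r = untrack W S (level x) p"
    have r: "r < 2 * d" using p(1) untrack_less_iff[OF level_le] by (simp add: r_def)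
    have "v \<in> path (\<lambda>j. track W S j r)"
      unfolding xz mem_path using I p(2) by (simp add: path_fun_def r_def)
    then have "v \<in> boundary (ruling_disk_of S (r div 2))" using mem_boundary_of by blast
    moreover have "ruling_disk_of S (r div 2) \<in> ruling_of S" using r by (auto simp: ruling_of_def)
    ultimately show "v \<in> (\<Union>R\<in>ruling_of S. boundary R)" by blast
  qed
  have meet: "boundary R \<inter> boundary R' \<subseteq> crossings [knot] \<union> front_proj ` cusps [knot]"
    if RR: "R \<in> ruling_of S" "R' \<in> ruling_of S" "R \<noteq> R'" for R R'
  proof
    fix v assume v: "v \<in> boundary R \<inter> boundary R'"
    obtain q q' where q: "q < d" "R = ruling_disk_of S q" "q' < d" "R' = ruling_disk_of S q'"
      using RR unfolding ruling_of_def by auto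
    obtain r r' where r: "r div 2 = q" "v \<in> path (\<lambda>j. track W S j r)" "r' div 2 = q'" "v \<in> path (\<lambda>j. track W S j r')"
      using v q mem_boundary_of by auto
    have rd: "r < 2 * d" "r' < 2 * d" using r q by auto
    have "r \<noteq> r'" using RR(3) q r by auto
    obtain x z where xz: "v = (x, z)" by (cases v)
    show "v \<in> crossings [knot] \<union> front_proj ` cusps [knot]"
      unfolding xz
      by (rule paths_meet[OF legal_track[OF rd(1)] legal_track[OF rd(2)]]) (use r \<open>r \<noteq> r'\<close> in \<open>simp_all add: xz\<close>)
  qed
  have normal: "\<forall>\<^sub>F x in at (fst v). nested (slice R x) (slice R' x)"
    if RR: "v \<in> switches [knot] (ruling_of S)" "R \<in> ruling_of S" "R' \<in> ruling_of S" "R \<noteq> R'" "v \<in> boundary R" "v \<in> boundary R'" for v R R'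
  proof -
    obtain j where j: "j \<in> S" "v = crossing_point j" using RR(1) sw by auto
    then have jK: "j < K" using sub by auto
    obtain q q' where q: "q < d" "R = ruling_disk_of S q" "q' < d" "R' = ruling_disk_of S q'"
      using RR unfolding ruling_of_def by auto
    have "q \<noteq> q'" using RR(4) q by auto
    have less: "track W S j (2 * q) < track W S j (Suc (2 * q))" "track W S j (2 * q') < track W S j (Suc (2 * q'))"
      using disk_tracks_of[OF S q(1)] disk_tracks_of[OF S q(3)] jK unfolding disk_tracks_def by auto
    have "noncrossing_at (partner S j) (W ! j)" using S j(1) by (simp add: valid_switches_def)
    then show ?thesis
      using normality_iff[OF j(1) jK q(1,3) \<open>q \<noteq> q'\<close> _ _ less] RR(5,6) q(2,4) j(2) by (simp add: crossing_point_def)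
  qed
  have graded: "crossing_degree [knot] potential v = 0" if v: "v \<in> switches [knot] (ruling_of S)" for v
  proof -
    obtain j where j: "j \<in> S" "v = crossing_point j" using v sw by auto
    then have "j < K" using sub by auto
    moreover have "even (upper_strand j) \<longleftrightarrow> even (lower_strand j)" using S j(1) by (simp add: valid_switches_def)
    ultimately show ?thesis using crossing_degree_knot j(2) by simp
  qed
  show ?thesis
    unfolding graded_normal_ruling_def normal_ruling_def
  proof (intro conjI ballI impI)
    show "ruling_disk [knot] R" if "R \<in> ruling_of S" for R by (rule disk[OF that])
    show "(\<Union>R\<in>ruling_of S. boundary R) = front [knot]" by (rule union)
    show "boundary R \<inter> boundary R' \<subseteq> crossings [knot] \<union> front_proj ` cusps [knot]"
      if "R \<in> ruling_of S" "R' \<in> ruling_of S" "R \<noteq> R'" for R R' by (rule meet[OF that])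
    show "\<forall>\<^sub>F x in at (fst v). nested (slice R x) (slice R' x)"
      if "v \<in> switches [knot] (ruling_of S)" "R \<in> ruling_of S" "R' \<in> ruling_of S"
        "R \<noteq> R' \<and> v \<in> boundary R \<and> v \<in> boundary R'" for v R R'
      using that by (intro normal) simp_all
    show "crossing_degree [knot] potential v = 0" if "v \<in> switches [knot] (ruling_of S)" for v
      by (rule graded[OF that])
  qed
qed

lemma path_cong: "(\<And>j. j \<le> K \<Longrightarrow> t j = s j) \<Longrightarrow> path t = path s"
  using level_le by (simp add: path_def path_fun_def)

text \<open>The tracks of a ruling disk are unique (\<open>path_eqD\<close>), so those obtained from the disk condition are
  the given ones.\<close>

lemma disk_tracks_ruling_disk_of:
  assumes "ruling_disk [knot] (ruling_disk_of S q)" "q < d"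
  shows "disk_tracks (ruling_disk_of S q) (\<lambda>j. track W S j (2 * q)) (\<lambda>j. track W S j (Suc (2 * q)))"
proof -
  have q: "2 * q < 2 * d" "Suc (2 * q) < 2 * d" using assms(2) by auto
  obtain u l where ul: "disk_tracks (ruling_disk_of S q) u l" using ruling_disk_tracks[OF assms(1)] by blast
  then have leg: "legal u" "legal l" and p: "path (\<lambda>j. track W S j (2 * q)) = path u" "path (\<lambda>j. track W S j (Suc (2 * q))) = path l"
    by (auto simp: disk_tracks_def ruling_disk_of_def)
  have "track W S j (2 * q) = u j" "track W S j (Suc (2 * q)) = l j" if "j \<le> K" for j
    using path_eqD[OF legal_track[OF q(1)] leg(1) p(1) that] path_eqD[OF legal_track[OF q(2)] leg(2) p(2) that] by auto
  then show ?thesis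
    using ul legal_track[OF q(1)] legal_track[OF q(2)] p unfolding disk_tracks_def by (simp del: track.simps)
qed

lemma valid_switches_of_graded:
  assumes sub: "S \<subseteq> {..<K}" and graded: "graded_normal_ruling [knot] potential (ruling_of S)"
  shows "valid_switches S"
proof -
  note sw = switches_of[OF sub]
  from graded have disks: "\<forall>R\<in>ruling_of S. ruling_disk [knot] R"
    and normal: "\<forall>v\<in>switches [knot] (ruling_of S). \<forall>R\<in>ruling_of S. \<forall>R'\<in>ruling_of S.
      R \<noteq> R' \<and> v \<in> boundary R \<and> v \<in> boundary R' \<longrightarrow> (\<forall>\<^sub>F x in at (fst v).
        nested (slice R x) (slice R' x))"
    and degree: "\<forall>v\<in>switches [knot] (ruling_of S). crossing_degree [knot] potential v = 0"
    unfolding graded_normal_ruling_def normal_ruling_def by - (elim conjE, assumption)+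
  have mem: "ruling_disk_of S q \<in> ruling_of S" if "q < d" for q using that by (auto simp: ruling_of_def)
  have tracks: "disk_tracks (ruling_disk_of S q) (\<lambda>j. track W S j (2 * q)) (\<lambda>j. track W S j (Suc (2 * q)))" if "q < d" for q
    by (rule disk_tracks_ruling_disk_of[OF bspec[OF disks mem[OF that]] that])
  have unt: "untrack W S j (W ! j) < 2 * d" "untrack W S j (Suc (W ! j)) < 2 * d" if "j < K" for j
    using W_less[of "W ! j"] that untrack_less_iff[of j S] by auto
  have ne: "partner S j (W ! j) \<noteq> Suc (W ! j)" if j: "j < K" for j
  proof
    assume eq: "partner S j (W ! j) = Suc (W ! j)"
    define r where "r = untrack W S j (W ! j)"
    have "r div 2 < d" using unt(1)[OF j] by (auto simp: r_def)
    then have "\<not> (track W S j (2 * (r div 2)) = W ! j \<and> track W S j (Suc (2 * (r div 2))) = Suc (W ! j))"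
      "track W S j (2 * (r div 2)) < track W S j (Suc (2 * (r div 2)))"
      using tracks[of "r div 2"] j unfolding disk_tracks_def by auto
    then show False using partner_track[OF refl, of S j r "W ! j"] eq by (auto simp: r_def)
  qed
  have fin: "partner S K p = adj p" for p
  proof (cases "p < 2 * d")
    case True
    define r where "r = untrack W S K p"
    have "r < 2 * d" using True untrack_less_iff[of K S p] by (simp add: r_def)
    then have "r div 2 < d" by auto
    then have "track W S K (Suc (2 * (r div 2))) = adj (track W S K (2 * (r div 2)))"
      using tracks[of "r div 2"] unfolding disk_tracks_def by auto
    moreover have "track W S K r = p" by (simp add: r_def)
    ultimately show ?thesis using partner_track[OF refl, of S K r p] by (metis adj_adj)
  next
    case False
    then show ?thesis
      unfolding partner_def untrack_outside[OF le_refl False] using adj_less[of p] by (intro track_outside) auto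
  qed
  have good: "(even (upper_strand j) \<longleftrightarrow> even (lower_strand j)) \<and> noncrossing_at (partner S j) (W ! j)" if j: "j \<in> S" for j
  proof
    have jK: "j < K" using j sub by auto
    have v: "crossing_point j \<in> switches [knot] (ruling_of S)" using sw j by blast
    then have "crossing_degree [knot] potential (crossing_point j) = 0"
      using degree by blast
    then show "even (upper_strand j) \<longleftrightarrow> even (lower_strand j)" using crossing_degree_knot[OF jK] by simp
    define r r' where "r = untrack W S j (W ! j)" and "r' = untrack W S j (Suc (W ! j))"
    have rd: "r < 2 * d" "r' < 2 * d" using unt[OF jK] by (auto simp: r_def r'_def)
    have q: "r div 2 < d" "r' div 2 < d" using rd by auto
    have tr: "track W S j r = W ! j" "track W S j r' = Suc (W ! j)" by (simp_all add: r_def r'_def)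
    have less: "track W S j (2 * q) < track W S j (Suc (2 * q))" if "q < d" for q
      using tracks[OF that] jK unfolding disk_tracks_def by auto
    have qq: "r div 2 \<noteq> r' div 2"
    proof
      assume "r div 2 = r' div 2"
      then have *: "track W S j (2 * (r div 2)) = Suc (W ! j) \<or> track W S j (Suc (2 * (r div 2))) = Suc (W ! j)"
        using partner_track[OF refl tr(2)] by metis
      then have "partner S j (W ! j) = Suc (W ! j)" using partner_track[OF refl tr(1)] by auto
      then show False using ne[OF jK] by simp
    qed
    have b: "crossing_point j \<in> boundary (ruling_disk_of S (r div 2))" "crossing_point j \<in> boundary (ruling_disk_of S (r' div 2))"
      using path_at_crossing[OF legal_track[OF rd(1)] jK] path_at_crossing[OF legal_track[OF rd(2)] jK] tr mem_boundary_of by blast+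
    have "ruling_disk_of S (r div 2) \<noteq> ruling_disk_of S (r' div 2)"
    proof
      assume eq: "ruling_disk_of S (r div 2) = ruling_disk_of S (r' div 2)"
      have "2 * (r div 2) < 2 * d" "2 * (r' div 2) < 2 * d" using q by auto
      from path_eqD[OF legal_track[OF this(1)] legal_track[OF this(2)], of S S 0] eq qq show False
        by (simp add: ruling_disk_of_def)
    qed
    then have "\<forall>\<^sub>F x in at (fst (crossing_point j)). nested (slice (ruling_disk_of S (r div 2)) x) (slice (ruling_disk_of S (r' div 2)) x)"
      using normal[rule_format, OF v mem[OF q(1)] mem[OF q(2)]] b by simp
    then show "noncrossing_at (partner S j) (W ! j)"
      using normality_iff[OF j jK q qq b less[OF q(1)] less[OF q(2)]] by (simp add: crossing_point_def)
  qed
  show ?thesis unfolding valid_switches_def using sub ne good fin by auto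
qed

end

section \<open>Every normal ruling comes from a set of switches\<close>

context plat_knot begin

lemma mid_slab:
  assumes "j \<le> K"
  shows "lo j < (lo j + hi j) / 2" "(lo j + hi j) / 2 < hi j"
  using lo_less_hi[OF assms] by auto

lemma slab_point_regular:
  assumes j: "j \<le> K" "lo j < x" "x < hi j"
  shows "(x, z) \<notin> crossings [knot] \<union> front_proj ` cusps [knot]"
proof
  assume "(x, z) \<in> crossings [knot] \<union> front_proj ` cusps [knot]"
  then consider i where "i < K" "x = real i + 1/2" | "x = -1" | "x = real K + 1"
    unfolding crossings_knot cusps_knot image_Un Un_iff left_cusp_front right_cusp_front
    by (auto simp: crossing_point_def)
  then show False
  proof cases
    case 1
    have "real j - 1/2 < x \<or> j = 0" "x < real j + 1/2 \<or> j = K" using j(2,3) by (auto simp: lo_def hi_def split: if_splits)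
    then have "j \<le> i \<or> j = 0" "i < j \<or> j = K" using 1(2) by linarith+
    then show False
    proof (elim disjE)
      assume "j = 0" "i < j" then show False by simp
    next
      assume "j \<le> i" "j = K" then show False using 1(1) by simp
    next
      assume "j = 0" "j = K" then show False using 1(1) by simp
    qed simp
  qed (use j slab_bounds[of j] in auto)
qed

text \<open>Disks are pairs of tracks, and tracks of different disks never share a position, because between the
  crossings the front has no points where disks may meet. Since the disks cover the cusps on the left, there is
  exactly one track for each starting position, and for each \<open>j\<close> the tracks permute the positions.
  At a crossing, a permutation that moves each position by 0 or by the exchange
  either fixes all positions or exchanges the two at the crossing. So the crossing is a switch or it is not, and
  all tracks follow from the set of switches.\<close>

lemma normal_ruling_is_ruling_of:
  assumes "normal_ruling [knot] \<rho>"
  shows "\<exists>S. S \<subseteq> {..<K} \<and> \<rho> = ruling_of S"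
proof -
  from assms have disk: "\<forall>R\<in>\<rho>. ruling_disk [knot] R" and union: "(\<Union>R\<in>\<rho>. boundary R) = front [knot]"
    and meet: "\<forall>R\<in>\<rho>. \<forall>S\<in>\<rho>. R \<noteq> S \<longrightarrow> boundary R \<inter> boundary S \<subseteq> crossings [knot] \<union> front_proj ` cusps [knot]"
    unfolding normal_ruling_def by - (elim conjE, assumption)+
  have "\<forall>R\<in>\<rho>. \<exists>ul. disk_tracks R (fst ul) (snd ul)"
  proof
    fix R assume "R \<in> \<rho>"
    then obtain u l where "disk_tracks R u l" using ruling_disk_tracks disk by blast
    then show "\<exists>ul. disk_tracks R (fst ul) (snd ul)" by (intro exI[of _ "(u, l)"]) simp
  qed
  then obtain UL where UL: "\<And>R. R \<in> \<rho> \<Longrightarrow> disk_tracks R (fst (UL R)) (snd (UL R))" by metis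
  define U L where "U R = fst (UL R)" and "L R = snd (UL R)" for R
  have tracks: "R = (path (U R), path (L R))" "legal (U R)" "legal (L R)" "L R 0 = adj (U R 0)" "\<And>j. j \<le> K \<Longrightarrow> U R j < L R j"
    if "R \<in> \<rho>" for R
    using UL[OF that] unfolding disk_tracks_def U_def L_def by auto
  have bd: "boundary R = path (U R) \<union> path (L R)" if "R \<in> \<rho>" for R
    using tracks(1)[OF that] by (metis boundary_def fst_conv snd_conv)
  have same: "R = R'"
    if R: "R \<in> \<rho>" "R' \<in> \<rho>" "t = U R \<or> t = L R" "t' = U R' \<or> t' = L R'" "j \<le> K" "t j = t' j" for R R' t t' j
  proof (rule ccontr)
    assume "R \<noteq> R'"
    let ?x = "(lo j + hi j) / 2"
    note x = mid_slab[OF R(5)]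
    have leg: "legal t" using R(3) tracks(2)[OF R(1)] tracks(3)[OF R(1)] by (elim disjE) simp_all
    moreover have "legal t'" using R(4) tracks(2)[OF R(2)] tracks(3)[OF R(2)] by (elim disjE) simp_all
    ultimately have leg: "legal t" "legal t'" .
    have I: "-1 \<le> ?x" "?x \<le> real K + 1" using x slab_bounds[OF R(5)] by linarith+
    have "path_fun t ?x = path_fun t' ?x"
      using path_fun_slab[OF leg(1) R(5)] path_fun_slab[OF leg(2) R(5)] x R(6) by simp
    then have "(?x, path_fun t ?x) \<in> path t" "(?x, path_fun t ?x) \<in> path t'" using I by (auto simp: mem_path)
    moreover have "path t \<subseteq> boundary R" "path t' \<subseteq> boundary R'" unfolding bd[OF R(1)] bd[OF R(2)] using R(3,4) by blast+
    ultimately have "(?x, path_fun t ?x) \<in> boundary R \<inter> boundary R'" by blast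
    then have "(?x, path_fun t ?x) \<in> crossings [knot] \<union> front_proj ` cusps [knot]"
      using meet R(1,2) \<open>R \<noteq> R'\<close> by blast
    then show False using slab_point_regular[OF R(5) x] by blast
  qed
  have even0: "even (U R 0)" "U R 0 < 2 * d" if "R \<in> \<rho>" for R
  proof -
    have "U R 0 < adj (U R 0)" using tracks(4,5)[OF that] by (metis le0)
    then show "even (U R 0)" by (auto simp: adj_def split: if_splits)
    show "U R 0 < 2 * d" using tracks(2)[OF that] by (rule legal_less) simp
  qed
  have "\<exists>R\<in>\<rho>. U R 0 = 2 * q" if q: "q < d" for q
  proof -
    let ?x = "(lo 0 + hi 0) / 2"
    note x = mid_slab[of 0, simplified]
    have "(?x, pos_fun 0 (2 * q) ?x) \<in> front [knot]"
      using front_pos_fun[of 0 ?x] x q by (simp add: less_imp_le) (intro exI[of _ "2 * q"], simp)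
    then obtain R where R: "R \<in> \<rho>" "(?x, pos_fun 0 (2 * q) ?x) \<in> boundary R" using union by blast
    have "pos_fun 0 (2 * q) ?x = path_fun (U R) ?x \<or> pos_fun 0 (2 * q) ?x = path_fun (L R) ?x"
      using R(2) unfolding bd[OF R(1)] by (auto simp: mem_path)
    then have "2 * q = U R 0 \<or> 2 * q = L R 0"
      using path_fun_slab[OF tracks(2)[OF R(1)], of 0 ?x] path_fun_slab[OF tracks(3)[OF R(1)], of 0 ?x] x q
        pos_fun_eq_iff[of 0 ?x "2 * q" "U R 0"] pos_fun_eq_iff[of 0 ?x "2 * q" "L R 0"]
        legal_less[OF tracks(2)[OF R(1)], of 0] legal_less[OF tracks(3)[OF R(1)], of 0] by (auto simp: less_imp_le)
    moreover have "odd (L R 0)" using tracks(4)[OF R(1)] even0(1)[OF R(1)] by (simp add: adj_def)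
    ultimately have "2 * q = U R 0" by (metis dvd_triv_left)
    then show ?thesis using R(1) by metis
  qed
  then have "\<forall>q\<in>{..<d}. \<exists>R. R \<in> \<rho> \<and> U R 0 = 2 * q" by blast
  from bchoice[OF this] obtain D where "\<forall>q\<in>{..<d}. D q \<in> \<rho> \<and> U (D q) 0 = 2 * q" ..
  then have D: "\<And>q. q < d \<Longrightarrow> D q \<in> \<rho>" "\<And>q. q < d \<Longrightarrow> U (D q) 0 = 2 * q" by blast+
  define T where "T p = (if even p then U (D (p div 2)) else L (D (p div 2)))" for p
  have half: "p div 2 < d" if "p < 2 * d" for p using that by auto
  have T0: "T p 0 = p" if "p < 2 * d" for p
    using D(2)[OF half[OF that]] tracks(4)[OF D(1)[OF half[OF that]]]
    by (cases "even p") (auto simp: T_def adj_def elim!: evenE oddE)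
  have legT: "legal (T p)" if "p < 2 * d" for p
    using tracks(2,3)[OF D(1)[OF half[OF that]]] by (simp add: T_def)
  have UL_T: "T p = U (D (p div 2)) \<or> T p = L (D (p div 2))" for p by (simp add: T_def)
  have injT: "p = p'" if p: "p < 2 * d" "p' < 2 * d" "j \<le> K" "T p j = T p' j" for p p' j
  proof -
    have "D (p div 2) = D (p' div 2)"
      by (rule same[OF D(1)[OF half[OF p(1)]] D(1)[OF half[OF p(2)]] UL_T[of p] UL_T[of p'] p(3,4)])
    then have "2 * (p div 2) = 2 * (p' div 2)" using D(2)[OF half[OF p(1)]] D(2)[OF half[OF p(2)]] by metis
    then have eq: "p div 2 = p' div 2" by simp
    have lt: "U (D (p div 2)) j < L (D (p div 2)) j" by (rule tracks(5)[OF D(1)[OF half[OF p(1)]] p(3)])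
    have "T p j = (if even p then U (D (p div 2)) j else L (D (p div 2)) j)"
      "T p' j = (if even p' then U (D (p div 2)) j else L (D (p div 2)) j)" by (simp_all add: T_def eq)
    then have "even p = even p'" using p(4) lt by (cases "even p"; cases "even p'"; simp)
    then show ?thesis using eq by presburger
  qed
  have surjT: "\<exists>a<2 * d. T a j = i" if "j \<le> K" "i < 2 * d" for i j
  proof -
    have "inj_on (\<lambda>p. T p j) {..<2 * d}" using injT[OF _ _ that(1)] by (auto simp: inj_on_def)
    moreover have "(\<lambda>p. T p j) ` {..<2 * d} \<subseteq> {..<2 * d}" using legal_less[OF legT that(1)] by auto
    ultimately have "(\<lambda>p. T p j) ` {..<2 * d} = {..<2 * d}" by (intro endo_inj_surj) simp_all
    then have "i \<in> (\<lambda>p. T p j) ` {..<2 * d}" using that(2) by simp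
    then show ?thesis by auto
  qed
  \<comment> \<open>It is enough to look at the track in the upper position.\<close>
  define S where "S = {j. j < K \<and> (\<exists>p<2 * d. T p j = W ! j \<and> T p (Suc j) = W ! j)}"
  have step: "T p (Suc j) = (if j \<in> S then T p j else sw (W ! j) (T p j))" if p: "p < 2 * d" and j: "j < K" for p j
  proof -
    have opt: "T r (Suc j) = T r j \<or> T r (Suc j) = sw (W ! j) (T r j)" if "r < 2 * d" for r
      using legT[OF that] j by (simp add: legal_def)
    note inj = injT[where j = j] injT[where j = "Suc j"]
    show ?thesis
    proof (cases "j \<in> S")
      case True
      then obtain a where a: "a < 2 * d" "T a j = W ! j" "T a (Suc j) = W ! j" by (auto simp: S_def)
      have "T p (Suc j) = T p j"
      proof (rule ccontr)
        assume ne: "T p (Suc j) \<noteq> T p j"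
        then have sw: "T p (Suc j) = sw (W ! j) (T p j)" using opt[OF p] by simp
        then have "T p j = W ! j \<or> T p j = Suc (W ! j)" using ne sw_other by metis
        then show False
        proof
          assume "T p j = W ! j"
          then have "p = a" using inj(1)[OF p a(1)] a(2) j by simp
          then show False using ne a by simp
        next
          assume q: "T p j = Suc (W ! j)"
          then have "p = a" using inj(2)[OF p a(1)] sw a(3) j by simp
          then show False using q a(2) by simp
        qed
      qed
      then show ?thesis using True by simp
    next
      case False
      have "T p (Suc j) = sw (W ! j) (T p j)"
      proof (rule ccontr)
        assume ne: "T p (Suc j) \<noteq> sw (W ! j) (T p j)"
        then have st: "T p (Suc j) = T p j" using opt[OF p] by simp
        then have "T p j = W ! j \<or> T p j = Suc (W ! j)" using ne sw_other by metis
        then show False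
        proof
          assume "T p j = W ! j"
          then show False using False st p j by (auto simp: S_def)
        next
          assume q: "T p j = Suc (W ! j)"
          have "W ! j < 2 * d" using W_less[of "W ! j"] j by simp
          then obtain a where a: "a < 2 * d" "T a j = W ! j" using surjT[of j] j by auto
          have "T a (Suc j) \<noteq> W ! j" using False a j by (auto simp: S_def)
          then have "T a (Suc j) = T p (Suc j)" using opt[OF a(1)] a(2) st q by auto
          then have "a = p" using inj(2)[OF a(1) p] j by simp
          then show False using q a(2) by simp
        qed
      qed
      then show ?thesis using False by simp
    qed
  qed
  have T_track: "T p j = track W S j p" if "p < 2 * d" "j \<le> K" for p j
    using that(2)
  proof (induction j)
    case 0
    then show ?case using T0[OF that(1)] by simp
  next
    case (Suc j)
    then show ?case using step[OF that(1), of j] by simp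
  qed
  have disk_eq: "D q = ruling_disk_of S q" if q: "q < d" for q
  proof -
    have "T (2 * q) = U (D q)" "T (Suc (2 * q)) = L (D q)" by (simp_all add: T_def)
    then have "path (U (D q)) = path (\<lambda>j. track W S j (2 * q))" "path (L (D q)) = path (\<lambda>j. track W S j (Suc (2 * q)))"
      using T_track[of "2 * q"] T_track[of "Suc (2 * q)"] q by (auto intro!: path_cong)
    then show ?thesis using tracks(1)[OF D(1)[OF q]] by (metis ruling_disk_of_def)
  qed
  have "\<rho> = ruling_of S"
  proof (intro equalityI subsetI)
    fix R assume R: "R \<in> \<rho>"
    define q where "q = U R 0 div 2"
    have q: "q < d" "U R 0 = 2 * q" using even0[OF R] by (auto simp: q_def)
    have "R = D q" using same[OF R D(1)[OF q(1)], of "U R" "U (D q)" 0] D(2)[OF q(1)] q(2) by simp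
    then show "R \<in> ruling_of S" using disk_eq[OF q(1)] q(1) by (auto simp: ruling_of_def)
  next
    fix R assume "R \<in> ruling_of S"
    then obtain q where q: "q < d" "R = ruling_disk_of S q" by (auto simp: ruling_of_def)
    have "R = D q" unfolding q(2) by (rule disk_eq[OF q(1), symmetric])
    then show "R \<in> \<rho>" using D(1)[OF q(1)] by simp
  qed
  moreover have "S \<subseteq> {..<K}" by (auto simp: S_def)
  ultimately show ?thesis by blast
qed

end

section \<open>The ruling polynomial of a plat knot\<close>

context plat_knot begin

lemma graded_normal_rulings:
  "{\<rho>. graded_normal_ruling [knot] potential \<rho>} = ruling_of ` {S. valid_switches S}"
proof (intro equalityI subsetI)
  fix \<rho> assume "\<rho> \<in> {\<rho>. graded_normal_ruling [knot] potential \<rho>}"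
  then have g: "graded_normal_ruling [knot] potential \<rho>" by simp
  then have "normal_ruling [knot] \<rho>" by (simp add: graded_normal_ruling_def)
  then obtain S where "S \<subseteq> {..<K}" "\<rho> = ruling_of S" using normal_ruling_is_ruling_of by blast
  then show "\<rho> \<in> ruling_of ` {S. valid_switches S}" using valid_switches_of_graded g by blast
qed (use graded_normal_ruling_of in auto)

lemma inj_crossing_point: "inj crossing_point"
  by (rule injI) (simp add: crossing_point_def)

lemma inj_ruling_of: "inj_on ruling_of {S. valid_switches S}"
proof (rule inj_onI)
  fix S S' assume S: "S \<in> {S. valid_switches S}" "S' \<in> {S. valid_switches S}" and eq: "ruling_of S = ruling_of S'"
  then have "S \<subseteq> {..<K}" "S' \<subseteq> {..<K}" by (simp_all add: valid_switches_def)
  from switches_of[OF this(1)] switches_of[OF this(2)] eq have "crossing_point ` S = crossing_point ` S'" by simp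
  then show "S = S'" using inj_image_eq_iff[OF inj_crossing_point] by blast
qed

lemma card_ruling_of: "card (ruling_of S) = d"
proof -
  have "inj_on (ruling_disk_of S) {..<d}"
  proof (rule inj_onI)
    fix q q' assume q: "q \<in> {..<d}" "q' \<in> {..<d}" and eq: "ruling_disk_of S q = ruling_disk_of S q'"
    have "2 * q < 2 * d" "2 * q' < 2 * d" using q by auto
    from path_eqD[OF legal_track[OF this(1)] legal_track[OF this(2)], of S S 0] eq
    show "q = q'" by (simp add: ruling_disk_of_def)
  qed
  then show ?thesis by (simp add: ruling_of_def card_image)
qed

lemma euler_char_of:
  assumes "valid_switches S"
  shows "ruling_euler_char [knot] (ruling_of S) = int d - int (card S)"
proof -
  have "S \<subseteq> {..<K}" using assms by (simp add: valid_switches_def)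
  then have "card (switches [knot] (ruling_of S)) = card S"
    unfolding switches_of[OF \<open>S \<subseteq> {..<K}\<close>] by (intro card_image inj_on_subset[OF inj_crossing_point]) simp
  then show ?thesis by (simp add: ruling_euler_char_def card_ruling_of)
qed

lemma track_agree: "S \<inter> {..<j} = S' \<inter> {..<j} \<Longrightarrow> track W S j p = track W S' j p"
proof (induction j)
  case (Suc j)
  have "i \<in> S \<longleftrightarrow> i \<in> S'" if "i < Suc j" for i using Suc.prems that by blast
  then have "S \<inter> {..<j} = S' \<inter> {..<j}" "j \<in> S \<longleftrightarrow> j \<in> S'" by (auto simp: less_Suc_eq)
  then show ?case using Suc.IH by simp
qed simp

lemma partner_agree:
  assumes "S \<inter> {..<j} = S' \<inter> {..<j}"
  shows "partner S j = partner S' j"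
proof
  fix i
  have "untrack W S j i = untrack W S' j i"
    using track_agree[OF assms] by (metis track_untrack untrack_track)
  then show "partner S j i = partner S' j i" using track_agree[OF assms] by (simp add: partner_def)
qed

lemma partner_Suc: "partner S (Suc j) = (if j \<in> S then partner S j else sw (W ! j) \<circ> partner S j \<circ> sw (W ! j))"
  by (auto simp: partner_def fun_eq_iff)

definition may_switch :: "nat set \<Rightarrow> nat \<Rightarrow> bool" where
  "may_switch S j \<longleftrightarrow> (even (upper_strand j) \<longleftrightarrow> even (lower_strand j)) \<and> noncrossing_at (partner S j) (W ! j)"

definition valid_before :: "nat \<Rightarrow> nat set \<Rightarrow> bool" where
  "valid_before j S \<longleftrightarrow> S \<subseteq> {..<j} \<and> (\<forall>i<j. partner S i (W ! i) \<noteq> Suc (W ! i)) \<and> (\<forall>i\<in>S. may_switch S i)"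

lemma valid_before_Suc:
  "{S. valid_before (Suc j) S} = {S. valid_before j S \<and> partner S j (W ! j) \<noteq> Suc (W ! j)} \<union>
     insert j ` {S. valid_before j S \<and> partner S j (W ! j) \<noteq> Suc (W ! j) \<and> may_switch S j}"
proof -
  have ins: "partner (insert j S) i = partner S i" if "i \<le> j" for S i
    by (rule partner_agree) (use that in auto)
  have ms: "may_switch (insert j S) i = may_switch S i" if "i \<le> j" for S i
    using ins[OF that] by (simp add: may_switch_def)
  have 1: "valid_before (Suc j) S \<longleftrightarrow> valid_before j S \<and> partner S j (W ! j) \<noteq> Suc (W ! j)" if "j \<notin> S" for S
  proof -
    have "S \<subseteq> {..<Suc j} \<longleftrightarrow> S \<subseteq> {..<j}" using that by (auto simp: less_Suc_eq)
    then show ?thesis by (auto simp: valid_before_def less_Suc_eq)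
  qed
  have 2: "valid_before (Suc j) (insert j S) \<longleftrightarrow>
      valid_before j S \<and> partner S j (W ! j) \<noteq> Suc (W ! j) \<and> may_switch S j" if "j \<notin> S" for S
  proof -
    have "insert j S \<subseteq> {..<Suc j} \<longleftrightarrow> S \<subseteq> {..<j}" using that by (auto simp: less_Suc_eq)
    moreover have "(\<forall>i<Suc j. partner (insert j S) i (W ! i) \<noteq> Suc (W ! i)) \<longleftrightarrow>
        (\<forall>i<j. partner S i (W ! i) \<noteq> Suc (W ! i)) \<and> partner S j (W ! j) \<noteq> Suc (W ! j)"
      using ins[of _ S] by (simp add: less_Suc_eq_le le_less all_conj_distrib imp_conjR disj_imp) (metis less_imp_le order_refl)
    moreover have "(\<forall>i\<in>insert j S. may_switch (insert j S) i) \<longleftrightarrow> may_switch S j \<and> (\<forall>i\<in>S. may_switch S i)"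
      if "S \<subseteq> {..<j}"
    proof -
      have "may_switch (insert j S) i = may_switch S i" if "i \<in> insert j S" for i
        using that \<open>S \<subseteq> {..<j}\<close> by (intro ms) auto
      then show ?thesis by simp
    qed
    ultimately show ?thesis unfolding valid_before_def by blast
  qed
  show ?thesis
  proof (intro equalityI subsetI)
    fix S assume S: "S \<in> {S. valid_before (Suc j) S}"
    show "S \<in> {S. valid_before j S \<and> partner S j (W ! j) \<noteq> Suc (W ! j)} \<union>
     insert j ` {S. valid_before j S \<and> partner S j (W ! j) \<noteq> Suc (W ! j) \<and> may_switch S j}"
    proof (cases "j \<in> S")
      case True
      then have "S = insert j (S - {j})" "j \<notin> S - {j}" by auto
      moreover from this have "S - {j} \<in> {S. valid_before j S \<and> partner S j (W ! j) \<noteq> Suc (W ! j) \<and> may_switch S j}"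
        using S 2[of "S - {j}"] by (simp del: insert_Diff_single)
      ultimately show ?thesis by blast
    next
      case False
      then show ?thesis using S 1 by simp
    qed
  next
    fix S assume "S \<in> {S. valid_before j S \<and> partner S j (W ! j) \<noteq> Suc (W ! j)} \<union>
     insert j ` {S. valid_before j S \<and> partner S j (W ! j) \<noteq> Suc (W ! j) \<and> may_switch S j}"
    moreover have notin: "j \<notin> S'" if "valid_before j S'" for S' using that unfolding valid_before_def by blast
    ultimately show "S \<in> {S. valid_before (Suc j) S}"
    proof (elim UnE)
      assume "S \<in> {S. valid_before j S \<and> partner S j (W ! j) \<noteq> Suc (W ! j)}"
      then show ?thesis using 1[OF notin] by simp
    next
      assume "S \<in> insert j ` {S. valid_before j S \<and> partner S j (W ! j) \<noteq> Suc (W ! j) \<and> may_switch S j}"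
      then obtain S' where S': "S = insert j S'" "valid_before j S' \<and> partner S' j (W ! j) \<noteq> Suc (W ! j) \<and> may_switch S' j" by blast
      then show ?thesis using 2[OF notin] by simp
    qed
  qed
qed

lemma finite_valid_before: "finite {S. valid_before j S}"
  by (rule finite_subset[of _ "Pow {..<j}"]) (auto simp: valid_before_def)

text \<open>The sum over all choices for the first \<open>j\<close> crossings, where each choice is weighted by the remaining
  \<open>ruling_sum\<close>, does not depend on \<open>j\<close>: a set of switches for \<open>j\<close> crossings has
  at most two extensions by the next crossing, which are the two summands in the definition of \<open>ruling_sum\<close>.
  For \<open>j = K\<close> it is the sum in question.\<close>

lemma sum_valid_before:
  fixes z :: "'a::comm_ring_1"
  assumes "j \<le> K"
  shows "(\<Sum>S | valid_before j S. z ^ card S * ruling_sum z (drop j W) (partner S j) (even \<circ> lab W j)) =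
    ruling_sum z W adj even"
  using assms
proof (induction j)
  case 0
  have "{S. valid_before 0 S} = {{}}" by (auto simp: valid_before_def)
  moreover have "partner {} 0 = adj" "even \<circ> lab W 0 = even" by (auto simp: partner_def fun_eq_iff)
  ultimately show ?case by simp
next
  case (Suc j)
  then have j: "j < K" by simp
  let ?i = "W ! j" and ?ty = "even \<circ> lab W (Suc j)"
  define A where "A S = z ^ card S * ruling_sum z (drop (Suc j) W) (partner S (Suc j)) ?ty" for S
  let ?P = "{S. valid_before j S \<and> partner S j ?i \<noteq> Suc ?i}"
  let ?Q = "{S. valid_before j S \<and> partner S j ?i \<noteq> Suc ?i \<and> may_switch S j}"
  have fin: "finite ?P" "finite ?Q" using finite_valid_before[of j] by (auto intro: rev_finite_subset)
  have notin: "j \<notin> S" if "valid_before j S" for S using that by (auto simp: valid_before_def)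
  have finS: "finite S" if "valid_before j S" for S using that by (auto simp: valid_before_def intro: finite_subset)
  have step: "z ^ card S * ruling_sum z (drop j W) (partner S j) (even \<circ> lab W j) =
      (if partner S j ?i \<noteq> Suc ?i then A S else 0) + (if partner S j ?i \<noteq> Suc ?i \<and> may_switch S j then A (insert j S) else 0)"
    if S: "valid_before j S" for S
  proof -
    have dr: "drop j W = ?i # drop (Suc j) W" using j by (simp add: Cons_nth_drop_Suc)
    have ty: "even \<circ> lab W j \<circ> sw ?i = ?ty" by (auto simp: fun_eq_iff)
    have p: "partner S (Suc j) = sw ?i \<circ> partner S j \<circ> sw ?i" using notin[OF S] by (simp add: partner_Suc)
    have "partner (insert j S) j = partner S j" by (rule partner_agree) auto
    then have q: "partner (insert j S) (Suc j) = partner S j" by (simp add: partner_Suc)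
    have c: "card (insert j S) = Suc (card S)" using notin[OF S] finS[OF S] by simp
    show ?thesis
      unfolding dr ruling_sum.simps ty A_def p q c by (auto simp: may_switch_def algebra_simps)
  qed
  have "ruling_sum z W adj even = (\<Sum>S | valid_before j S. z ^ card S * ruling_sum z (drop j W) (partner S j) (even \<circ> lab W j))"
    by (rule Suc.IH[symmetric]) (use j in simp)
  also have "\<dots> = (\<Sum>S | valid_before j S. (if partner S j ?i \<noteq> Suc ?i then A S else 0)
      + (if partner S j ?i \<noteq> Suc ?i \<and> may_switch S j then A (insert j S) else 0))"
    by (rule sum.cong[OF refl]) (simp add: step)
  also have "\<dots> = sum A ?P + (\<Sum>S\<in>?Q. A (insert j S))"
    using finite_valid_before[of j] by (simp add: sum.distrib sum.inter_filter[symmetric] Collect_conj_eq[symmetric])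
  also have "(\<Sum>S\<in>?Q. A (insert j S)) = sum A (insert j ` ?Q)"
  proof -
    have "inj_on (insert j) ?Q"
    proof (rule inj_onI)
      fix S S' assume "S \<in> ?Q" "S' \<in> ?Q" "insert j S = insert j S'"
      moreover have "j \<notin> S" "j \<notin> S'" using calculation notin by auto
      ultimately show "S = S'" by (metis Diff_insert_absorb)
    qed
    then show ?thesis by (simp add: sum.reindex)
  qed
  also have "sum A ?P + sum A (insert j ` ?Q) = sum A (?P \<union> insert j ` ?Q)"
    using fin notin by (intro sum.union_disjoint[symmetric]) auto
  also have "?P \<union> insert j ` ?Q = {S. valid_before (Suc j) S}" by (rule valid_before_Suc[symmetric])
  finally show ?case unfolding A_def by (rule sym)
qed

lemma sum_valid_switches:
  fixes z :: "'a::comm_ring_1"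
  shows "(\<Sum>S | valid_switches S. z ^ card S) = ruling_sum z W adj even"
proof -
  have "{S. valid_switches S} = {S. valid_before K S \<and> partner S K = adj}"
    by (auto simp: valid_switches_def valid_before_def may_switch_def)
  then have "(\<Sum>S | valid_switches S. z ^ card S) = (\<Sum>S | valid_before K S. if partner S K = adj then z ^ card S else 0)"
    using finite_valid_before[of K] by (simp add: sum.inter_filter[symmetric])
  also have "\<dots> = (\<Sum>S | valid_before K S. z ^ card S * ruling_sum z (drop K W) (partner S K) (even \<circ> lab W K))"
    by (rule sum.cong) auto
  also have "\<dots> = ruling_sum z W adj even" by (rule sum_valid_before) simp
  finally show ?thesis .
qed

lemma fls_X_power: "fls_X ^ n = (fls_X_intpow (int n) :: int fls)"
  by (simp add: fls_X_power_conv_shift_1)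

theorem ruling_polynomial_knot:
  "ruling_polynomial [knot] potential = fls_X_intpow (1 - int d) * ruling_sum fls_X W adj even"
proof -
  have "(\<Sum>\<rho> | graded_normal_ruling [knot] potential \<rho>. fls_X_intpow (- ruling_euler_char [knot] \<rho>) :: int fls) =
      (\<Sum>S | valid_switches S. fls_X_intpow (- ruling_euler_char [knot] (ruling_of S)))"
    unfolding graded_normal_rulings by (simp add: sum.reindex[OF inj_ruling_of])
  also have "\<dots> = (\<Sum>S | valid_switches S. fls_X_intpow (- int d) * fls_X ^ card S)"
  proof (rule sum.cong[OF refl])
    fix S assume "S \<in> {S. valid_switches S}"
    then have "- ruling_euler_char [knot] (ruling_of S) = - int d + int (card S)" by (simp add: euler_char_of)
    then show "fls_X_intpow (- ruling_euler_char [knot] (ruling_of S)) = (fls_X_intpow (- int d) * fls_X ^ card S :: int fls)"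
      by (simp only: fls_X_power fls_X_intpow_times_fls_X_intpow)
  qed
  also have "\<dots> = fls_X_intpow (- int d) * ruling_sum fls_X W adj even"
    by (simp add: sum_distrib_left[symmetric] sum_valid_switches)
  finally have "ruling_polynomial [knot] potential =
      fls_X ^ 1 * (fls_X_intpow (- int d) * ruling_sum fls_X W adj even)"
    by (simp add: ruling_polynomial_def card_components_knot)
  also have "\<dots> = (fls_X_intpow 1 * fls_X_intpow (- int d)) * ruling_sum fls_X W adj even"
    by (simp only: fls_X_power mult.assoc) simp
  also have "fls_X_intpow 1 * fls_X_intpow (- int d) = (fls_X_intpow (1 - int d) :: int fls)"
    using fls_X_intpow_times_fls_X_intpow[of 1 "- int d"] by simp
  finally show ?thesis .
qed

end

section \<open>The knots realising the polynomials\<close>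

text \<open>Pushing a labelling \<open>f\<close> of the positions through the crossings of a word.\<close>

definition permute :: "(nat \<Rightarrow> nat) \<Rightarrow> nat list \<Rightarrow> nat \<Rightarrow> nat" where
  "permute f V = fold (\<lambda>i f. f \<circ> sw i) V f"

lemma permute_simps [simp]:
  "permute f [] = f"
  "permute f (i # V) = permute (f \<circ> sw i) V"
  "permute f (V @ V') = permute (permute f V) V'"
  by (simp_all add: permute_def)

lemma lab_take: "j \<le> length W \<Longrightarrow> lab W j = permute id (take j W)"
proof (induction j)
  case 0
  then show ?case by (simp add: fun_eq_iff)
next
  case (Suc j)
  then show ?case by (simp add: take_Suc_conv_app_nth fun_eq_iff)
qed

lemma lab_final: "lab W (length W) = permute id W"
  using lab_take[of "length W" W] by simp

lemma nth_list_sw: "r < 6 \<Longrightarrow> list_sw i t ! r = t ! sw i r"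
  by (simp add: list_sw_def)

lemma permute_window:
  assumes "\<forall>i\<in>set V. i < 5" "r < 6"
  shows "permute f (map ((+) k) V) (k + r) = f (k + fold list_sw V [0..<6] ! r)"
  using assms
proof (induction V arbitrary: r rule: rev_induct)
  case (snoc i V)
  then have "sw i r < 6" by (intro sw_less) auto
  then have "permute f (map ((+) k) V) (k + sw i r) = f (k + fold list_sw V [0..<6] ! sw i r)"
    using snoc by simp
  then show ?case using \<open>r < 6\<close> by (simp add: sw_add nth_list_sw del: upt_rec_numeral upt_Suc)
qed simp

lemma permute_outside:
  "\<forall>i\<in>set V. p < i \<or> Suc i < p \<Longrightarrow> permute f V p = f p"
  by (induction V rule: rev_induct) (auto simp: sw_other)

text \<open>The strands found in the six positions of the window after a block, given by their positions before it.\<close>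

lemma block_strands:
  "fold list_sw slip_block [0..<6] = [4,2,0,1,5,3]"
  "fold list_sw weight_block [0..<6] = [4,3,0,1,2,5]"
  by code_simp+

text \<open>Among the first \<open>k\<close> positions, some right cusp joins the strand \<open>u\<close> of type U to the strand that shares its left
  cusp with the strand \<open>v\<close>. So the knot runs through \<open>u\<close> to the right and returns to the left end of \<open>v\<close>.\<close>

definition right_cusp_joins :: "(nat \<Rightarrow> nat) \<Rightarrow> nat \<Rightarrow> nat \<Rightarrow> nat \<Rightarrow> bool" where
  "right_cusp_joins f k u v \<longleftrightarrow> (\<exists>i<k. even i \<and> f i = u \<and> f (Suc i) = Suc v)"

text \<open>The strands of type U in the order in which the knot runs through them, beginning with strand 0. While the blocks
  are read, the knot consists of two open chains that end in the strands 2 and 0, and the beginnings of \<open>us\<close> and \<open>ws\<close> lead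
  to the active strands of type L. The block whose window starts in position \<open>k\<close> joins the new pair
  \<open>k + 4\<close>, \<open>k + 5\<close> to the beginning of one chain; which one depends on the block. The closing crossings connect the active strands
  2 and 0 to the beginnings of the chains.\<close>

fun cusp_cycle :: "nat \<Rightarrow> bool list \<Rightarrow> nat list \<Rightarrow> nat list \<Rightarrow> nat list" where
  "cusp_cycle k [] us ws = 0 # us @ 2 # ws"
| "cusp_cycle k (b # bs) us ws =
    (if b then cusp_cycle (k + 2) bs ((k + 4) # us) ws else cusp_cycle (k + 2) bs us ((k + 4) # ws))"

lemma right_cusp_joins_mono:
  assumes "right_cusp_joins f k u v" "\<And>p. p < k \<Longrightarrow> g p = f p" "even k" "k \<le> k'"
  shows "right_cusp_joins g k' u v"
proof -
  obtain i where i: "i < k" "even i" "f i = u" "f (Suc i) = Suc v" using assms(1) by (auto simp: right_cusp_joins_def)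
  then have "Suc i < k" using assms(3) by presburger
  then show ?thesis using i assms(2,4) by (auto simp: right_cusp_joins_def intro!: exI[of _ i])
qed

text \<open>The invariant: the active strands are 0 and 2 of type U, followed by the strands of type L that share the left
  cusps of the first elements of the two chains; the positions below are untouched, and
  the consecutive elements of both chains are joined by finished right cusps.\<close>

lemma cusp_cycle_joined:
  assumes "even k" "f k = 0" "f (k + 1) = 2" "f (k + 2) = Suc (hd (ws @ [0]))" "f (k + 3) = Suc (hd (us @ [2]))"
    and "\<And>p. k + 4 \<le> p \<Longrightarrow> f p = p"
    and "successively (right_cusp_joins f k) (us @ [2])" "successively (right_cusp_joins f k) (ws @ [0])"
  shows "successively (right_cusp_joins (permute f (block_word k bs)) (k + 2 * (length bs + 2)))
    (cusp_cycle k bs us ws @ [0])"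
  using assms
proof (induction bs arbitrary: f k us ws)
  case Nil
  let ?g = "permute f [k, Suc k]"
  have g: "?g k = 2" "?g (Suc k) = Suc (hd (ws @ [0]))" "?g (k + 2) = 0" "?g (Suc (k + 2)) = Suc (hd (us @ [2]))"
    using Nil.prems(2-5) by (simp_all add: sw_def eval_nat_numeral)
  have old: "?g p = f p" if "p < k" for p using that by (simp add: sw_def)
  have new: "right_cusp_joins ?g (k + 4) u v" if "right_cusp_joins f k u v" for u v
    by (rule right_cusp_joins_mono[OF that old Nil.prems(1)]) auto
  have chains: "successively (right_cusp_joins ?g (k + 4)) (us @ [2])" "successively (right_cusp_joins ?g (k + 4)) (ws @ [0])"
    by (rule successively_mono[OF Nil.prems(7) new], assumption+) (rule successively_mono[OF Nil.prems(8) new], assumption+)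
  have "right_cusp_joins ?g (k + 4) 0 (hd (us @ [2]))" "right_cusp_joins ?g (k + 4) 2 (hd (ws @ [0]))"
    unfolding right_cusp_joins_def using g Nil.prems(1) 
    by (rule_tac [1] exI[of _ "k + 2"], rule_tac [2] exI[of _ k]) simp_all
  then have "successively (right_cusp_joins ?g (k + 4)) (([0] @ (us @ [2])) @ (ws @ [0]))"
    using chains unfolding successively_append_iff by simp
  then show ?case by (simp add: comp_def)
next
  case (Cons b bs)
  let ?g = "permute f (map ((+) k) (block b))"
  have old: "?g p = f p" if "p < k" for p using that by (intro permute_outside) auto
  have far: "?g p = f p" if "k + 6 \<le> p" for p
  proof (rule permute_outside, rule ballI)
    fix i assume "i \<in> set (map ((+) k) (block b))"
    then obtain j where "i = k + j" "j \<in> set (block b)" by auto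
    then show "p < i \<or> Suc i < p" using that bspec[OF block_less[of b], of j] by simp
  qed
  note at = permute_window[OF block_less[of b], of _ f k]
  have ev: "even (k + 2)" using Cons.prems(1) by simp
  have new: "right_cusp_joins ?g (k + 2) u v" if "right_cusp_joins f k u v" for u v
    by (rule right_cusp_joins_mono[OF that old Cons.prems(1)]) auto
  have chains: "successively (right_cusp_joins ?g (k + 2)) (us @ [2])" "successively (right_cusp_joins ?g (k + 2)) (ws @ [0])"
    by (rule successively_mono[OF Cons.prems(7) new], assumption+) (rule successively_mono[OF Cons.prems(8) new], assumption+)
  have f: "f (k + 4) = k + 4" "f (k + 5) = k + 5" using Cons.prems(6) by simp_all
  have g: "?g (k + 2) = 0" "?g (k + 3) = 2" "?g k = k + 4"
    "?g (k + 1) = (if b then Suc (hd (us @ [2])) else Suc (hd (ws @ [0])))"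
    "?g (k + 4) = (if b then Suc (hd (ws @ [0])) else k + 5)"
    "?g (k + 5) = (if b then k + 5 else Suc (hd (us @ [2])))"
    using at[of 0] at[of 1] at[of 2] at[of 3] at[of 4] at[of 5] Cons.prems(2-5) f
    by (simp_all add: block_def block_strands split: if_splits)
  have id: "?g p = p" if "k + 2 + 4 \<le> p" for p
    using far[of p] Cons.prems(6)[of p] that by simp
  have joined: "right_cusp_joins ?g (k + 2) (k + 4) (hd (if b then us @ [2] else ws @ [0]))"
    unfolding right_cusp_joins_def using g Cons.prems(1) by (intro exI[of _ k]) simp
  show ?case
  proof (cases b)
    case True
    have "successively (right_cusp_joins ?g (k + 2)) (((k + 4) # us) @ [2])"
      using chains(1) joined True by (cases "us") simp_all
    from Cons.IH[OF ev _ _ _ _ id this chains(2)] g True show ?thesis by (simp add: numeral_eq_Suc)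
  next
    case False
    have "successively (right_cusp_joins ?g (k + 2)) (((k + 4) # ws) @ [0])"
      using chains(2) joined False by (cases "ws") simp_all
    from Cons.IH[OF ev _ _ _ _ id chains(1) this] g False show ?thesis by (simp add: numeral_eq_Suc)
  qed
qed

lemma length_cusp_cycle: "length (cusp_cycle k bs us ws) = length bs + length us + length ws + 2"
  by (induction bs arbitrary: k us ws) simp_all

lemma set_cusp_cycle:
  "set (cusp_cycle k bs us ws) = {0, 2} \<union> set us \<union> set ws \<union> (\<lambda>i. k + 4 + 2 * i) ` {..<length bs}"
proof (induction bs arbitrary: k us ws)
  case (Cons b bs)
  have "(\<lambda>i. k + 4 + 2 * i) ` {..<length (b # bs)} = insert (k + 4) ((\<lambda>i. k + 2 + 4 + 2 * i) ` {..<length bs})"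
    by (simp add: lessThan_Suc_eq_insert_0 image_image ac_simps)
  then show ?case by (simp only: cusp_cycle.simps Cons.IH split: if_split) auto
qed auto

definition knot_cycle :: "bool list \<Rightarrow> nat list" where
  "knot_cycle bs = cusp_cycle 0 bs [] []"

lemma length_knot_cycle [simp]: "length (knot_cycle bs) = length bs + 2"
  by (simp add: knot_cycle_def length_cusp_cycle)

lemma set_knot_cycle: "set (knot_cycle bs) = (\<lambda>i. 2 * i) ` {..<length bs + 2}"
proof -
  have "(\<lambda>i. 2 * i) ` {..<length bs + 2} = {0, 2} \<union> (\<lambda>i. 4 + 2 * i) ` {..<length bs}"
    by (simp add: lessThan_Suc_eq_insert_0 image_image numeral_eq_Suc)
  then show ?thesis by (simp add: knot_cycle_def set_cusp_cycle)
qed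

lemma knot_cycle_joined:
  "successively (right_cusp_joins (lab (front_word bs) (length (front_word bs))) (2 * (length bs + 2)))
    (knot_cycle bs @ [0])"
proof -
  have "permute id (front_word bs) = permute (sw 1) (block_word 0 bs)" by (simp add: front_word_def)
  then show ?thesis
    using cusp_cycle_joined[of 0 "sw 1" "[]" "[]" bs] unfolding lab_final knot_cycle_def by (simp add: sw_def)
qed

text \<open>Between two strands of type U in the cycle, the knot returns along the strand of type L that shares
  the left cusp of the second one.\<close>

definition strand_order :: "bool list \<Rightarrow> nat \<Rightarrow> nat" where
  "strand_order bs k =
    (if even k then knot_cycle bs ! (k div 2) else Suc (knot_cycle bs ! (Suc (k div 2) mod (length bs + 2))))"

lemma strand_order_surj:
  "strand_order bs ` {..<2 * (length bs + 2)} = {..<2 * (length bs + 2)}"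
proof (intro equalityI subsetI)
  let ?d = "length bs + 2"
  fix p assume "p \<in> strand_order bs ` {..<2 * ?d}"
  then obtain k where k: "k < 2 * ?d" "p = strand_order bs k" by auto
  have "knot_cycle bs ! i \<in> (\<lambda>i. 2 * i) ` {..<?d}" if "i < ?d" for i
    using nth_mem[of i "knot_cycle bs"] that by (simp add: set_knot_cycle)
  then have "\<exists>j<?d. knot_cycle bs ! i = 2 * j" if "i < ?d" for i using that by blast
  moreover have "k div 2 < ?d" "Suc (k div 2) mod ?d < ?d" using k(1) by (auto intro: mod_less_divisor)
  ultimately obtain i j where ij: "i < ?d" "knot_cycle bs ! (k div 2) = 2 * i"
      "j < ?d" "knot_cycle bs ! (Suc (k div 2) mod ?d) = 2 * j" by metis
  then show "p \<in> {..<2 * ?d}" using k(2) by (simp add: strand_order_def)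
next
  let ?d = "length bs + 2"
  fix p assume "p \<in> {..<2 * ?d}"
  then have "2 * (p div 2) \<in> set (knot_cycle bs)" by (auto simp: set_knot_cycle)
  then obtain i where i: "i < ?d" "knot_cycle bs ! i = 2 * (p div 2)" by (auto simp: in_set_conv_nth)
  show "p \<in> strand_order bs ` {..<2 * ?d}"
  proof (cases "even p")
    case True
    then have "p = strand_order bs (2 * i)" using i by (simp add: strand_order_def)
    then show ?thesis using i(1) by (intro image_eqI[of _ _ "2 * i"]) simp_all
  next
    case False
    define q where "q = (i + (?d - 1)) mod ?d"
    have "Suc q mod ?d = (i + ?d) mod ?d" unfolding q_def by (simp add: mod_Suc_eq)
    then have "Suc q mod ?d = i" using i(1) by (simp only: mod_add_self2 mod_less)
    moreover have "p = Suc (2 * (p div 2))" using False by presburger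
    ultimately have "p = strand_order bs (Suc (2 * q))" using i(2) by (simp add: strand_order_def)
    moreover have "Suc (2 * q) < 2 * ?d"
    proof -
      have "q < ?d" unfolding q_def by (rule mod_less_divisor) simp
      then show ?thesis by simp
    qed
    ultimately show ?thesis by blast
  qed
qed

lemma strand_order_right:
  assumes "k < 2 * (length bs + 2)" "even k"
  shows "\<exists>i. even i \<and> lab (front_word bs) (length (front_word bs)) i = strand_order bs k \<and>
    lab (front_word bs) (length (front_word bs)) (Suc i) = strand_order bs (Suc k)"
proof -
  let ?d = "length bs + 2" and ?c = "knot_cycle bs"
  define q where "q = k div 2"
  have q: "q < ?d" using assms(1) by (auto simp: q_def)
  have hd: "?c ! 0 = 0"
  proof -
    have "cusp_cycle k bs us ws ! 0 = 0" for k us ws by (induction bs arbitrary: k us ws) auto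
    then show ?thesis by (simp add: knot_cycle_def)
  qed
  have "(?c @ [0]) ! Suc q = ?c ! (Suc q mod ?d)"
    using q hd by (cases "Suc q = ?d") (auto simp: nth_append)
  moreover have "(?c @ [0]) ! q = ?c ! q" using q by (simp add: nth_append)
  moreover have "right_cusp_joins (lab (front_word bs) (length (front_word bs))) (2 * ?d) ((?c @ [0]) ! q) ((?c @ [0]) ! Suc q)"
    using knot_cycle_joined[of bs] q unfolding successively_conv_nth by simp
  ultimately show ?thesis using assms(2) by (auto simp: right_cusp_joins_def strand_order_def q_def)
qed

text \<open>Every strand is an entry of the cycle, and the two strands joined by a right cusp end in an even position and in
  the odd position below it; so parities are preserved.\<close>

lemma plat_knot_family: "plat_knot (front_word bs) (length bs + 2) (strand_order bs)"
proof -
  let ?d = "length bs + 2" and ?W = "front_word bs" and ?e = "strand_order bs"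
  have par: "even (?e k) \<longleftrightarrow> even k" if "k < 2 * ?d" for k
  proof -
    have "even (knot_cycle bs ! i)" if "i < ?d" for i
      using nth_mem[of i "knot_cycle bs"] that by (auto simp: set_knot_cycle)
    from this[of "k div 2"] this[of "Suc (k div 2) mod ?d"] that show ?thesis
      by (auto simp: strand_order_def)
  qed
  have right: "even (pos ?W (length ?W) (?e k))" "pos ?W (length ?W) (?e (Suc k)) = Suc (pos ?W (length ?W) (?e k))"
    if k: "k < 2 * ?d" "even k" for k
  proof -
    obtain i where "even i" "lab ?W (length ?W) i = ?e k" "lab ?W (length ?W) (Suc i) = ?e (Suc k)"
      using strand_order_right[OF k] by blast
    then show "even (pos ?W (length ?W) (?e k))" "pos ?W (length ?W) (?e (Suc k)) = Suc (pos ?W (length ?W) (?e k))"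
      by (metis track_untrack)+
  qed
  show ?thesis
  proof
    show "bij_betw ?e {..<2 * ?d} {..<2 * ?d}"
      using strand_order_surj[of bs] by (simp add: bij_betw_def eq_card_imp_inj_on)
    show "even (pos ?W (length ?W) p) \<longleftrightarrow> even p" if "p < 2 * ?d" for p
    proof -
      have "p \<in> ?e ` {..<2 * ?d}" unfolding strand_order_surj using that by simp
      then obtain k where k: "k < 2 * ?d" "p = ?e k" by (elim imageE) simp
      show ?thesis
      proof (cases "even k")
        case True
        then show ?thesis using right(1)[OF k(1)] par[OF k(1)] k(2) by simp
      next
        case False
        then obtain k' where "k = Suc k'" "even k'" by (cases k) auto
        then show ?thesis using right[of k'] par[OF k(1)] k by simp
      qed
    qed
    show "?e k = Suc (?e (Suc k mod (2 * ?d)))" if "k < 2 * ?d" "odd k" for k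
    proof -
      have "Suc k = 2 * Suc (k div 2)" using that(2) by presburger
      then have "Suc k mod (2 * ?d) = 2 * (Suc (k div 2) mod ?d)" by (simp only: mod_mult_mult1)
      then show ?thesis using that(2) by (simp add: strand_order_def)
    qed
    show "Suc i < 2 * ?d" if "i \<in> set ?W" for i using that by (rule front_word_less)
    show "even (?e k) \<longleftrightarrow> even k" if "k < 2 * ?d" for k using that by (rule par)
    show "pos ?W (length ?W) (?e (Suc k)) = Suc (pos ?W (length ?W) (?e k))" if "k < 2 * ?d" "even k" for k
      using that by (rule right(2))
  qed simp
qed

theorem theorem1p4:
  fixes a :: "nat \<Rightarrow> nat" and n :: nat
  shows "\<exists>L \<mu>. legendrian_link L \<and> generic_front L \<and> maslov_potential L \<mu> \<and>
           ruling_polynomial L \<mu> = (\<Sum>k\<le>n. of_nat (a k) * fls_X ^ (2 * k))"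
proof -
  define bs where "bs = coefficient_blocks a n"
  interpret plat_knot "front_word bs" "length bs + 2" "strand_order bs" by (rule plat_knot_family)
  \<comment> \<open>One pair of strands per block and two more make \<open>d = length bs + 2\<close> disks.\<close>
  have "ruling_polynomial [knot] potential =
      fls_X_intpow (1 - int (length bs + 2)) * (fls_X ^ Suc (length bs) * slip_sum fls_X bs)"
    unfolding ruling_polynomial_knot ruling_sum_front_word ..
  also have "\<dots> = fls_X_intpow (1 - int (length bs + 2) + int (Suc (length bs))) * slip_sum fls_X bs"
    unfolding fls_X_power fls_X_intpow_times_fls_X_intpow[symmetric] by (rule mult.assoc[symmetric])
  also have "\<dots> = slip_sum fls_X bs" by simp
  also have "\<dots> = (\<Sum>k\<le>n. of_nat (a k) * fls_X ^ (2 * k))"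
    unfolding bs_def by (rule slip_sum_coefficient_blocks)
  finally show ?thesis
    using legendrian_link_knot generic_front_knot maslov_potential_knot by blast
qed

end
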